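(* Let $\phi$ be a finite-range repulsive pair potential, fix $\lambda\in(0,\lambda_{SSM})$, and let $\nu_0=\mu_{\boldsymbol\lambda}$ for an activity function $\boldsymbol\lambda:\Lambda\to[0,\lambda]$. Let $(\nu_t)_{t\ge0}$ be the negative-fields localization process started at $\nu_0$, and for $t\ge0$ set $\hat C_t=C_{e^{-t}\lambda}$. Then for every $t\ge0$ and every measurable $\varphi:\Omega\to[-1,1]$, $$\mathbb{E}\big[\operatorname{Var}_{\nu_t}[\varphi]\big]\ge\exp\Big(-\int_0^t\hat C_s\,ds\Big)\operatorname{Var}_{\nu_0}[\varphi].$$
   Context: $\Lambda\subseteq\mathbb{R}^d$ bounded measurable, $\Omega$ its finite subsets; $\eta(f)=\sum_{x\in\eta}f(x)$. Gibbs point process $\mu_{\boldsymbol\lambda}$ with repulsive pair potential $\phi$ (symmetric, $\ge0$, finite range): density $\propto\prod_{x\in\eta}\boldsymbol\lambda(x)e^{-H(\eta)}$, $H(\eta)=\sum_{\{x,y\}\subseteq\eta}\phi(x,y)$; $Z(\boldsymbol\lambda)$ its partition function. $\mu^{+A}_{\boldsymbol\lambda}$ is the law of $\eta\cup A$, $\eta\sim\mu_{\boldsymbol\lambda}$. Pinning: $\mathcal R_A\mu^{+S}_{\boldsymbol\lambda}=\mu^{+S\cup A}_{\boldsymbol\lambda\exp(-\sum_{x\in A\setminus S}\phi(x,\cdot))}$; tilt: $\mathcal T_{-t}\mu^{+S}_{\boldsymbol\lambda}=\mu^{+S}_{e^{-t}\boldsymbol\lambda}$. Influence operator of $\mu_{\boldsymbol\lambda}$: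 $\Psi_{\boldsymbol\lambda}f(x)=\mathbb{E}_{\mathcal R_{\{x\}}\mu_{\boldsymbol\lambda}}[\eta(f)]-\mathbb{E}_{\mu_{\boldsymbol\lambda}}[\eta(f)]$, intensity $\iota_{\boldsymbol\lambda}(B)=\mathbb{E}_{\mu_{\boldsymbol\lambda}}|\eta\cap B|$, $\langle f,g\rangle_\iota=\int fg\,d\iota$. $C_\lambda$ is the smallest number such that $\langle f,\Psi_{\boldsymbol\lambda}f\rangle_{\iota_{\boldsymbol\lambda}}\le C_\lambda\langle f,f\rangle_{\iota_{\boldsymbol\lambda}}$ for all $\boldsymbol\lambda:\Lambda\to[0,\lambda]$ and bounded measurable $f$. SSM and $\lambda_{SSM}$: SSM with activities bounded by $\lambda$ means there are $\alpha,\beta$ with $\|\mu_{\boldsymbol\lambda}-\mu_{\boldsymbol\lambda'}\|_B\le\alpha|B|e^{-\beta\operatorname{dist}(B,\operatorname{supp}(\boldsymbol\lambda-\boldsymbol\lambda'))}$ (TV distance of restrictions to $B$) for all bounded measurable $B$ and activities $\boldsymbol\lambda,\boldsymbol\lambda'\le\lambda$; $\lambda_{SSM}$ is the supremum of $\lambda$ for which SSM holds at all smaller activities. Negative-fields localization: let $X$ be a Poisson point process of intensity $\lambda$ on $\Lambda\times[0,\infty)\times[0,1]$, with points $(x_i,t_i,l_i)$ ordered by $t_1<t_2<\cdots$, $t_0=0$. Set $A(0)=\emptyset$, $A$ constant on $[t_i,t_{i+1})$, and $A(t_i)=A(t_{i-1})\cup\{x_i\}$ if $l_i\le\tilde\iota_{t_i}(x_i)/\lambda$,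 else $A(t_i)=A(t_{i-1})$, where $\tilde\iota_{t_i}(x)=\boldsymbol\lambda'(x)Z(\boldsymbol\lambda'e^{-\phi(x,\cdot)})/Z(\boldsymbol\lambda')$ is the one-point density of $\mu_{\boldsymbol\lambda'}$ with $\boldsymbol\lambda'=e^{-t_i}\boldsymbol\lambda\exp(-\sum_{y\in A(t_{i-1})}\phi(y,\cdot))$. Then $\nu_t=\mathcal T_{-t}\mathcal R_{A(t)}\nu_0$ (a random probability measure); the expectation is over $X$. *)

theory Defs
  imports "HOL-Probability.Probability"
begin
definition configs :: "'a::euclidean_space set \<Rightarrow> 'a set set" where
  "configs \<Lambda> = {\<eta>. finite \<eta> \<and> \<eta> \<subseteq> \<Lambda>}"

definition config_space :: "'a::euclidean_space set \<Rightarrow> 'a set measure" where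
  "config_space \<Lambda> = sigma (configs \<Lambda>)
     {{\<eta> \<in> configs \<Lambda>. card (\<eta> \<inter> B) = k} | B k. B \<in> sets borel}"

text \<open>The (unnormalised) law of a Poisson process of unit intensity:
  \<open>\<Sum>\<^sub>n 1/n! \<integral>\<close> over \<open>\<Lambda>\<^sup>n\<close>, transported to unordered configurations. It differs from the Poisson
  law by the constant factor \<open>exp |\<Lambda>|\<close>, which cancels in every normalised quantity below.
  Tuples with repeated coordinates form a null set.\<close>

definition lebesgue_poisson :: "'a::euclidean_space set \<Rightarrow> 'a set measure" where
  "lebesgue_poisson \<Lambda> = measure_of (configs \<Lambda>) (sets (config_space \<Lambda>))
     (\<lambda>E. \<Sum>n. emeasure (distr (PiM {..<n} (\<lambda>_. restrict_space lborel \<Lambda>)) (config_space \<Lambda>)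
                          (\<lambda>x. x ` {..<n})) E / fact n)"

text \<open>Potentials take values in \<open>[0,\<infinity>]\<close>, so hard-core interactions are included.\<close>

definition repulsive_finite_range :: "('a::euclidean_space \<Rightarrow> 'a \<Rightarrow> ennreal) \<Rightarrow> bool" where
  "repulsive_finite_range \<phi> \<longleftrightarrow>
     (\<lambda>(x, y). \<phi> x y) \<in> borel_measurable (borel \<Otimes>\<^sub>M borel) \<and>
     (\<forall>x y. \<phi> x y = \<phi> y x) \<and>
     (\<exists>R. \<forall>x y. dist x y > R \<longrightarrow> \<phi> x y = 0)"

definition exp_neg :: "ennreal \<Rightarrow> real" where
  "exp_neg r = (if r = \<infinity> then 0 else exp (- enn2real r))"

text \<open>Each unordered pair of distinct points is counted twice in the double sum.\<close>

definition energy :: "('a \<Rightarrow> 'a \<Rightarrow> ennreal) \<Rightarrow> 'a set \<Rightarrow> ennreal" where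
  "energy \<phi> \<eta> = (\<Sum>x\<in>\<eta>. \<Sum>y\<in>\<eta> - {x}. \<phi> x y) / 2"

definition gibbs_weight :: "('a \<Rightarrow> 'a \<Rightarrow> ennreal) \<Rightarrow> ('a \<Rightarrow> real) \<Rightarrow> 'a set \<Rightarrow> real" where
  "gibbs_weight \<phi> lam \<eta> = (\<Prod>x\<in>\<eta>. lam x) * exp_neg (energy \<phi> \<eta>)"

definition partition_function ::
  "('a::euclidean_space \<Rightarrow> 'a \<Rightarrow> ennreal) \<Rightarrow> 'a set \<Rightarrow> ('a \<Rightarrow> real) \<Rightarrow> real" where
  "partition_function \<phi> \<Lambda> lam = (\<integral>\<eta>. gibbs_weight \<phi> lam \<eta> \<partial>lebesgue_poisson \<Lambda>)"

definition gibbs ::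
  "('a::euclidean_space \<Rightarrow> 'a \<Rightarrow> ennreal) \<Rightarrow> 'a set \<Rightarrow> ('a \<Rightarrow> real) \<Rightarrow> 'a set measure" where
  "gibbs \<phi> \<Lambda> lam = density (lebesgue_poisson \<Lambda>)
     (\<lambda>\<eta>. ennreal (gibbs_weight \<phi> lam \<eta> / partition_function \<phi> \<Lambda> lam))"

definition activities :: "'a::euclidean_space set \<Rightarrow> real \<Rightarrow> ('a \<Rightarrow> real) set" where
  "activities \<Lambda> c = {lam \<in> borel_measurable (restrict_space borel \<Lambda>). \<forall>x\<in>\<Lambda>. 0 \<le> lam x \<and> lam x \<le> c}"

text \<open>Pinning and tilting act on the parameters \<open>(S, lam)\<close> of the measure \<open>\<mu>\<^sup>+\<^sup>S\<close> with
  activity \<open>lam\<close>.\<close>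

definition pinned_gibbs ::
  "('a::euclidean_space \<Rightarrow> 'a \<Rightarrow> ennreal) \<Rightarrow> 'a set \<Rightarrow> 'a set \<times> ('a \<Rightarrow> real) \<Rightarrow> 'a set measure" where
  "pinned_gibbs \<phi> \<Lambda> = (\<lambda>(S, lam). distr (gibbs \<phi> \<Lambda> lam) (config_space \<Lambda>) (\<lambda>\<eta>. \<eta> \<union> S))"

definition pin ::
  "('a \<Rightarrow> 'a \<Rightarrow> ennreal) \<Rightarrow> 'a set \<Rightarrow> 'a set \<times> ('a \<Rightarrow> real) \<Rightarrow> 'a set \<times> ('a \<Rightarrow> real)" where
  "pin \<phi> A = (\<lambda>(S, lam). (S \<union> A, \<lambda>y. lam y * exp_neg (\<Sum>x\<in>A - S. \<phi> x y)))"

definition tilt :: "real \<Rightarrow> 'a set \<times> ('a \<Rightarrow> real) \<Rightarrow> 'a set \<times> ('a \<Rightarrow> real)" where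
  "tilt s = (\<lambda>(S, lam). (S, \<lambda>y. exp s * lam y))"

definition influence ::
  "('a::euclidean_space \<Rightarrow> 'a \<Rightarrow> ennreal) \<Rightarrow> 'a set \<Rightarrow> ('a \<Rightarrow> real) \<Rightarrow> ('a \<Rightarrow> real) \<Rightarrow> 'a \<Rightarrow> real" where
  "influence \<phi> \<Lambda> lam f x =
     (\<integral>\<eta>. (\<Sum>y\<in>\<eta>. f y) \<partial>pinned_gibbs \<phi> \<Lambda> (pin \<phi> {x} ({}, lam))) -
     (\<integral>\<eta>. (\<Sum>y\<in>\<eta>. f y) \<partial>gibbs \<phi> \<Lambda> lam)"

definition intensity ::
  "('a::euclidean_space \<Rightarrow> 'a \<Rightarrow> ennreal) \<Rightarrow> 'a set \<Rightarrow> ('a \<Rightarrow> real) \<Rightarrow> 'a measure" where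
  "intensity \<phi> \<Lambda> lam = measure_of \<Lambda> (sets (restrict_space borel \<Lambda>))
     (\<lambda>B. \<integral>\<^sup>+\<eta>. of_nat (card (\<eta> \<inter> B)) \<partial>gibbs \<phi> \<Lambda> lam)"

definition inner_int :: "'a measure \<Rightarrow> ('a \<Rightarrow> real) \<Rightarrow> ('a \<Rightarrow> real) \<Rightarrow> real" where
  "inner_int M f g = (\<integral>x. f x * g x \<partial>M)"

text \<open>If \<open>\<Lambda>\<close> is a null set then every \<open>C\<close> is admissible, there is no smallest one, and the
  value is an unspecified constant.\<close>

definition influence_const ::
  "('a::euclidean_space \<Rightarrow> 'a \<Rightarrow> ennreal) \<Rightarrow> 'a set \<Rightarrow> real \<Rightarrow> real" where
  "influence_const \<phi> \<Lambda> c = Inf {C. \<forall>lam\<in>activities \<Lambda> c.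
     \<forall>f\<in>borel_measurable (restrict_space borel \<Lambda>). bounded (f ` \<Lambda>) \<longrightarrow>
       inner_int (intensity \<phi> \<Lambda> lam) f (influence \<phi> \<Lambda> lam f)
         \<le> C * inner_int (intensity \<phi> \<Lambda> lam) f f}"

definition tv_dist :: "'b measure \<Rightarrow> 'b measure \<Rightarrow> real" where
  "tv_dist M N = (SUP E\<in>sets M. \<bar>measure M E - measure N E\<bar>)"

text \<open>The constants are uniform over all finite volumes; for a single fixed \<open>\<Lambda>\<close> the condition
  would hold at every activity. Since \<open>setdist\<close> to the empty set is \<open>0\<close> rather than \<open>\<infinity>\<close>, the
  bound reads \<open>0 \<le> \<alpha>|B|\<close> when the two activities coincide.\<close>

definition SSM :: "('a::euclidean_space \<Rightarrow> 'a \<Rightarrow> ennreal) \<Rightarrow> real \<Rightarrow> bool" where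
  "SSM \<phi> c \<longleftrightarrow> (\<exists>\<alpha>>0. \<exists>\<beta>>0. \<forall>\<Lambda>\<in>sets borel. bounded \<Lambda> \<longrightarrow>
     (\<forall>lam\<in>activities \<Lambda> c. \<forall>lam'\<in>activities \<Lambda> c. \<forall>B\<in>sets borel. bounded B \<longrightarrow>
        tv_dist (distr (gibbs \<phi> \<Lambda> lam) (config_space \<Lambda>) (\<lambda>\<eta>. \<eta> \<inter> B))
                (distr (gibbs \<phi> \<Lambda> lam') (config_space \<Lambda>) (\<lambda>\<eta>. \<eta> \<inter> B))
          \<le> \<alpha> * measure lborel B * exp (- \<beta> * setdist B {x \<in> \<Lambda>. lam x \<noteq> lam' x})))"

definition lambda_SSM :: "('a::euclidean_space \<Rightarrow> 'a \<Rightarrow> ennreal) \<Rightarrow> ereal" where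
  "lambda_SSM \<phi> = Sup {ereal c | c. 0 \<le> c \<and> (\<forall>c'. 0 \<le> c' \<and> c' < c \<longrightarrow> SSM \<phi> c')}"

text \<open>Local finiteness is required surely, so that the arrival times up to any \<open>t\<close> can be listed
  in increasing order. The rate is relative to Lebesgue measure.\<close>

definition poisson_point_process ::
  "'w measure \<Rightarrow> 'b::euclidean_space set \<Rightarrow> real \<Rightarrow> ('w \<Rightarrow> 'b set) \<Rightarrow> bool" where
  "poisson_point_process M S c X \<longleftrightarrow>
     prob_space M \<and>
     (\<forall>\<omega>\<in>space M. X \<omega> \<subseteq> S \<and> (\<forall>K. bounded K \<longrightarrow> finite (X \<omega> \<inter> K))) \<and>
     (\<forall>B\<in>sets borel. bounded B \<and> B \<subseteq> S \<longrightarrow>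
        (\<lambda>\<omega>. card (X \<omega> \<inter> B)) \<in> measurable M (count_space UNIV) \<and>
        (\<forall>k. measure M {\<omega> \<in> space M. card (X \<omega> \<inter> B) = k} =
              (c * measure lborel B) ^ k / fact k * exp (- (c * measure lborel B)))) \<and>
     (\<forall>n (B :: nat \<Rightarrow> 'b set). (\<forall>i<n. B i \<in> sets borel \<and> bounded (B i) \<and> B i \<subseteq> S) \<and>
        disjoint_family_on B {..<n} \<longrightarrow>
        prob_space.indep_vars M (\<lambda>_. count_space UNIV) (\<lambda>i \<omega>. card (X \<omega> \<inter> B i)) {..<n})"

definition one_point_density ::
  "('a::euclidean_space \<Rightarrow> 'a \<Rightarrow> ennreal) \<Rightarrow> 'a set \<Rightarrow> ('a \<Rightarrow> real) \<Rightarrow> 'a \<Rightarrow> real" where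
  "one_point_density \<phi> \<Lambda> lam x =
     lam x * partition_function \<phi> \<Lambda> (\<lambda>y. lam y * exp_neg (\<phi> x y)) / partition_function \<phi> \<Lambda> lam"

text \<open>One update of \<open>A\<close> at the arrival time \<open>s\<close>. Almost surely exactly one point \<open>(x, s, l)\<close>
  of \<open>X\<close> has this time; in the null event of a tie all tied points are tested simultaneously.\<close>

definition nf_step ::
  "('a::euclidean_space \<Rightarrow> 'a \<Rightarrow> ennreal) \<Rightarrow> 'a set \<Rightarrow> ('a \<Rightarrow> real) \<Rightarrow> real \<Rightarrow>
     ('a \<times> real \<times> real) set \<Rightarrow> real \<Rightarrow> 'a set \<Rightarrow> 'a set" where
  "nf_step \<phi> \<Lambda> lam c X s A = A \<union> {x. \<exists>l. (x, s, l) \<in> X \<and>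
     l \<le> one_point_density \<phi> \<Lambda> (\<lambda>z. exp (- s) * lam z * exp_neg (\<Sum>y\<in>A. \<phi> y z)) x / c}"

text \<open>The set \<open>A(t)\<close>: the updates at the arrival times up to \<open>t\<close>, in increasing order.\<close>

definition nf_pinned ::
  "('a::euclidean_space \<Rightarrow> 'a \<Rightarrow> ennreal) \<Rightarrow> 'a set \<Rightarrow> ('a \<Rightarrow> real) \<Rightarrow> real \<Rightarrow>
     ('a \<times> real \<times> real) set \<Rightarrow> real \<Rightarrow> 'a set" where
  "nf_pinned \<phi> \<Lambda> lam c X t =
     fold (nf_step \<phi> \<Lambda> lam c X) (sorted_list_of_set {s. s \<le> t \<and> (\<exists>x l. (x, s, l) \<in> X)}) {}"

definition nf_localization ::
  "('a::euclidean_space \<Rightarrow> 'a \<Rightarrow> ennreal) \<Rightarrow> 'a set \<Rightarrow> ('a \<Rightarrow> real) \<Rightarrow> real \<Rightarrow>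
     ('a \<times> real \<times> real) set \<Rightarrow> real \<Rightarrow> 'a set measure" where
  "nf_localization \<phi> \<Lambda> lam c X t =
     pinned_gibbs \<phi> \<Lambda> (tilt (- t) (pin \<phi> (nf_pinned \<phi> \<Lambda> lam c X t) ({}, lam)))"

end

theory Submission
  imports Defs
begin

text \<open>Write \<open>V(s)\<close> for the expected variance of \<open>f\<close> under \<open>\<nu>\<^sub>s\<close>. Between arrivals the activity decays
  like \<open>e\<^sup>-\<^sup>s\<close>, and a point \<open>x\<close> is pinned at rate \<open>\<iota>(x)\<close>, the one-point density of \<open>\<nu>\<^sub>s\<close>. By the
  Georgii--Nguyen--Zessin equation the drift of the variance and the compensator of its jumps add up
  to \<open>- \<integral> \<iota> g\<^sup>2\<close>, where \<open>g x\<close> is the change of the mean of \<open>f\<close> caused by pinning \<open>x\<close>; with the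
  Mecke equation for the driving Poisson process this gives \<open>V' = - E \<integral> \<iota> g\<^sup>2\<close> in integrated form.
  Moreover \<open>\<integral> \<iota> g\<^sup>2\<close> is the covariance of \<open>\<eta>(g)\<close> and \<open>f\<close>, while the influence form of \<open>g\<close> is the
  variance of \<open>\<eta>(g)\<close>, so Cauchy--Schwarz yields \<open>\<integral> \<iota> g\<^sup>2 \<le> C Var f\<close> and Gronwall concludes.\<close>

section \<open>Measurability on configuration spaces\<close>

text \<open>Everything random is reduced to integrals over one kind of measure. Cutting the driving
  process to the window \<open>W\<close> of arrivals up to \<open>t\<close> makes it a finite
  configuration whose law has a density with respect to \<open>lebesgue_poisson\<close>, as have all
  the Gibbs measures; one Mecke equation, derived from the series definition, then serves both, and
  no martingale calculus enters. The price is that the pinned set, given as a fold over sorted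
  arrival times, must become a measurable function of a configuration; hence the measurability rules
  for random finite sets and the sort-free recursion \<open>acc_eq\<close>. Mecke applies to the
  jumps because a point is judged by strictly earlier points, so removing it does not alter its own
  jump. Two analytic points shape the rest: the drift of the variance is found by expanding in
  powers of \<open>exp (- s)\<close>, graded by the number of points, and Gronwall has to work with
  a rate known only to be non-increasing in time, which leads to an Euler scheme instead of a
  differential inequality.\<close>

locale region =
  fixes \<Lambda> :: "'a::euclidean_space set"
  assumes region_borel: "\<Lambda> \<in> sets borel" and region_bounded: "bounded \<Lambda>"
begin

abbreviation "L \<equiv> restrict_space lborel \<Lambda>"
abbreviation "CS \<equiv> config_space \<Lambda>"
abbreviation "LP \<equiv> lebesgue_poisson \<Lambda>"

lemma space_L [simp]: "space L = \<Lambda>"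
  by (simp add: space_restrict_space)

lemma sets_L: "sets L = sets (restrict_space borel \<Lambda>)"
  by (simp add: sets_restrict_space)

lemma sets_L_eq: "B \<in> sets L \<longleftrightarrow> B \<in> sets borel \<and> B \<subseteq> \<Lambda>"
  using region_borel by (auto simp: sets_restrict_space_iff)

lemma id_L_borel [measurable]: "(\<lambda>x. x) \<in> measurable L borel"
  by (simp add: measurable_restrict_space1)

lemma config_space_generators:
  "{{\<eta> \<in> configs \<Lambda>. card (\<eta> \<inter> B) = k} | B k. B \<in> sets borel} \<subseteq> Pow (configs \<Lambda>)"
  by auto

lemma space_config_space [simp]: "space CS = configs \<Lambda>"
  unfolding config_space_def using config_space_generators by (rule space_measure_of)

lemma sets_config_space:
  "sets CS = sigma_sets (configs \<Lambda>) {{\<eta> \<in> configs \<Lambda>. card (\<eta> \<inter> B) = k} | B k. B \<in> sets borel}"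
  unfolding config_space_def using config_space_generators by (rule sets_measure_of)

lemma configsD: "\<eta> \<in> configs \<Lambda> \<Longrightarrow> finite \<eta>" "\<eta> \<in> configs \<Lambda> \<Longrightarrow> x \<in> \<eta> \<Longrightarrow> x \<in> \<Lambda>"
  by (auto simp: configs_def)

lemma measurable_card_Int:
  assumes "B \<in> sets borel" shows "(\<lambda>\<eta>. card (\<eta> \<inter> B)) \<in> measurable CS (count_space UNIV)"
  unfolding measurable_count_space_eq2_countable
proof safe
  fix k :: nat
  have "(\<lambda>\<eta>. card (\<eta> \<inter> B)) -` {k} \<inter> space CS = {\<eta> \<in> configs \<Lambda>. card (\<eta> \<inter> B) = k}"
    by auto
  also have "\<dots> \<in> sets CS"
    unfolding sets_config_space using assms by (intro sigma_sets.Basic) auto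
  finally show "(\<lambda>\<eta>. card (\<eta> \<inter> B)) -` {k} \<inter> space CS \<in> sets CS" .
qed auto

lemma measurable_card_Int' [measurable (raw)]:
  assumes "\<xi> \<in> measurable Q CS" "B \<in> sets borel"
  shows "(\<lambda>q. card (\<xi> q \<inter> B)) \<in> measurable Q (count_space UNIV)"
  using measurable_comp[OF assms(1) measurable_card_Int[OF assms(2)]] by (simp add: comp_def)

text \<open>Counts in Borel subsets of \<open>\<Lambda>\<close> suffice, because a configuration
  meets \<open>B\<close> and \<open>B \<inter> \<Lambda>\<close> in the same points.\<close>

lemma measurable_configI:
  assumes "\<And>q. q \<in> space Q \<Longrightarrow> \<xi> q \<in> configs \<Lambda>"
    and "\<And>B. B \<in> sets borel \<Longrightarrow> B \<subseteq> \<Lambda> \<Longrightarrow> (\<lambda>q. card (\<xi> q \<inter> B)) \<in> measurable Q (count_space UNIV)"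
  shows "\<xi> \<in> measurable Q CS"
  unfolding config_space_def
proof (rule measurable_measure_of)
  show "\<xi> \<in> space Q \<rightarrow> configs \<Lambda>" using assms(1) by auto
  fix E assume "E \<in> {{\<eta> \<in> configs \<Lambda>. card (\<eta> \<inter> B) = k} | B k. B \<in> sets borel}"
  then obtain B k where E: "E = {\<eta> \<in> configs \<Lambda>. card (\<eta> \<inter> B) = k}" and B: "B \<in> sets borel" by auto
  have "(\<lambda>q. card (\<xi> q \<inter> (B \<inter> \<Lambda>))) -` {k} \<inter> space Q \<in> sets Q"
    using assms(2)[of "B \<inter> \<Lambda>"] B region_borel by (auto intro: measurable_sets)
  also have "(\<lambda>q. card (\<xi> q \<inter> (B \<inter> \<Lambda>))) -` {k} \<inter> space Q = \<xi> -` E \<inter> space Q"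
  proof -
    have "\<xi> q \<inter> (B \<inter> \<Lambda>) = \<xi> q \<inter> B" if "q \<in> space Q" for q
      using assms(1)[OF that] by (auto simp: configs_def)
    then show ?thesis using assms(1) by (auto simp: E)
  qed
  finally show "\<xi> -` E \<inter> space Q \<in> sets Q" .
qed (use config_space_generators in auto)

text \<open>Monotone class argument in \<open>F\<close>, starting from indicators of rectangles.\<close>

lemma measurable_sum_config_nn:
  fixes F :: "'q \<times> 'a \<Rightarrow> ennreal"
  assumes \<xi>: "\<xi> \<in> measurable Q CS" and F: "F \<in> borel_measurable (Q \<Otimes>\<^sub>M L)"
  shows "(\<lambda>q. \<Sum>x\<in>\<xi> q. F (q, x)) \<in> borel_measurable Q"
proof -
  have cfg: "finite (\<xi> q)" "x \<in> \<xi> q \<Longrightarrow> x \<in> \<Lambda>" if "q \<in> space Q" for q x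
    using measurable_space[OF \<xi> that] by (auto simp: configs_def)
  show ?thesis using F
  proof (induction F rule: borel_measurable_induct)
    case (cong F G)
    have "(\<Sum>x\<in>\<xi> q. F (q, x)) = (\<Sum>x\<in>\<xi> q. G (q, x))" if "q \<in> space Q" for q
      using cfg[OF that] that cong(3) by (intro sum.cong) (auto simp: space_pair_measure)
    then show ?case using cong(4) by (simp cong: measurable_cong)
  next
    case (set A)
    have "A \<in> sigma_sets (space Q \<times> space L) {a \<times> b |a b. a \<in> sets Q \<and> b \<in> sets L}"
      using set by (simp add: sets_pair_measure)
    with Int_stable_pair_measure_generator[of Q L] pair_measure_closed[of Q L] show ?case
    proof (induction rule: sigma_sets_induct_disjoint)
      case (basic A)
      then obtain a b where ab: "A = a \<times> b" "a \<in> sets Q" "b \<in> sets L" by auto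
      have "(\<Sum>x\<in>\<xi> q. indicator A (q, x)) = (indicator a q * of_nat (card (\<xi> q \<inter> b)) :: ennreal)"
        if "q \<in> space Q" for q
        using cfg[OF that] by (simp add: ab indicator_times sum_distrib_left[symmetric])
          (simp add: indicator_def sum.If_cases Int_def)
      moreover have "b \<in> sets borel" using ab sets_L_eq by auto
      ultimately show ?case using ab \<xi> by (simp cong: measurable_cong)
    next
      case empty then show ?case by simp
    next
      case (compl A)
      have A: "A \<subseteq> space Q \<times> space L"
        using compl(1) by (metis sets.sets_into_space sets_pair_measure space_pair_measure)
      have "(\<Sum>x\<in>\<xi> q. indicator (space Q \<times> space L - A) (q, x)) =
          (of_nat (card (\<xi> q \<inter> \<Lambda>)) - (\<Sum>x\<in>\<xi> q. indicator A (q, x)) :: ennreal)"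
        if q: "q \<in> space Q" for q
      proof -
        have "(\<Sum>x\<in>\<xi> q. indicator (space Q \<times> space L - A) (q, x)) + (\<Sum>x\<in>\<xi> q. indicator A (q, x) :: ennreal)
            = (\<Sum>x\<in>\<xi> q. 1)"
          unfolding sum.distrib[symmetric] using cfg[OF q] q by (intro sum.cong) (auto simp: indicator_def)
        also have "\<dots> = of_nat (card (\<xi> q \<inter> \<Lambda>))"
        proof -
          have "\<xi> q \<inter> \<Lambda> = \<xi> q" using cfg[OF q] by auto
          then show ?thesis by simp
        qed
        finally have eq: "(\<Sum>x\<in>\<xi> q. indicator (space Q \<times> space L - A) (q, x)) + (\<Sum>x\<in>\<xi> q. indicator A (q, x) :: ennreal)
            = of_nat (card (\<xi> q \<inter> \<Lambda>))" .
        \<comment> \<open>Subtraction in \<open>ennreal\<close> needs a finite subtrahend; this one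
          is bounded by the number of points.\<close>
        have "(\<Sum>x\<in>\<xi> q. indicator A (q, x) :: ennreal) \<noteq> \<top>"
          using eq by (metis ennreal_add_eq_top ennreal_of_nat_neq_top)
        then show ?thesis using eq by (metis ennreal_add_diff_cancel_right infinity_ennreal_def)
      qed
      then show ?case using compl(2) \<xi> region_borel
        by (simp cong: measurable_cong)
    next
      case (union A)
      have "(\<Sum>x\<in>\<xi> q. indicator (\<Union>i. A i) (q, x)) = (\<Sum>i. \<Sum>x\<in>\<xi> q. indicator (A i) (q, x) :: ennreal)" for q
        using union(1) by (subst suminf_sum) (auto simp: suminf_indicator)
      then show ?case using union(3) by simp
    qed
  next
    case (mult F c) then show ?case by (simp add: sum_distrib_left[symmetric])
  next
    case (add F G) then show ?case by (simp add: sum.distrib)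
  next
    case (seq F)
    have "(\<Sum>x\<in>\<xi> q. (SUP i. F i) (q, x)) = (SUP i. \<Sum>x\<in>\<xi> q. F i (q, x))" for q
      unfolding SUP_apply
    proof (rule ennreal_SUP_sum[symmetric])
      fix x show "incseq (\<lambda>i. F i (q, x))" using seq(3) by (auto simp: mono_def le_fun_def)
    qed
    then show ?case using seq.IH by simp
  qed
qed

lemma measurable_sum_config:
  fixes F :: "'q \<Rightarrow> 'a \<Rightarrow> real"
  assumes \<xi>: "\<xi> \<in> measurable Q CS" and F: "(\<lambda>p. F (fst p) (snd p)) \<in> borel_measurable (Q \<Otimes>\<^sub>M L)"
  shows "(\<lambda>q. \<Sum>x\<in>\<xi> q. F q x) \<in> borel_measurable Q"
proof -
  \<comment> \<open>Positive and negative parts have finite sums, so both can be computed in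
    \<open>ennreal\<close> and brought back to the reals.\<close>
  have 1: "(\<Sum>x\<in>S. g x) = enn2real (\<Sum>x\<in>S. ennreal (max 0 (g x))) - enn2real (\<Sum>x\<in>S. ennreal (max 0 (- g x)))"
    for S :: "'a set" and g :: "'a \<Rightarrow> real"
    by (simp add: sum_ennreal sum_subtractf[symmetric] enn2real_ennreal sum_nonneg del: ennreal_max_0 ennreal_max_0')
      (intro sum.cong, auto)
  have "(\<lambda>q. \<Sum>x\<in>\<xi> q. (\<lambda>p. ennreal (max 0 (F (fst p) (snd p)))) (q, x)) \<in> borel_measurable Q"
    "(\<lambda>q. \<Sum>x\<in>\<xi> q. (\<lambda>p. ennreal (max 0 (- F (fst p) (snd p)))) (q, x)) \<in> borel_measurable Q"
    using F by (intro measurable_sum_config_nn[OF \<xi>]; measurable)+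
  then show ?thesis by (subst 1) simp
qed

lemma measurable_sum_config_ennreal:
  fixes F :: "'q \<Rightarrow> 'a \<Rightarrow> ennreal"
  assumes \<xi>: "\<xi> \<in> measurable Q CS" and F: "(\<lambda>p. F (fst p) (snd p)) \<in> borel_measurable (Q \<Otimes>\<^sub>M L)"
  shows "(\<lambda>q. \<Sum>x\<in>\<xi> q. F q x) \<in> borel_measurable Q"
  using measurable_sum_config_nn[OF assms] by simp

text \<open>Counting is summing an indicator; the floor brings the real-valued sum back to a
  discrete one.\<close>

lemma measurable_card_filter:
  assumes \<xi>: "\<xi> \<in> measurable Q CS"
    and P: "{p \<in> space (Q \<Otimes>\<^sub>M L). P (fst p) (snd p)} \<in> sets (Q \<Otimes>\<^sub>M L)"
  shows "(\<lambda>q. card {x \<in> \<xi> q. P q x}) \<in> measurable Q (count_space UNIV)"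
proof -
  let ?F = "\<lambda>q x. (if P q x then 1 else 0) :: real"
  have "(\<lambda>q. \<Sum>x\<in>\<xi> q. ?F q x) \<in> borel_measurable Q"
    by (rule measurable_sum_config[OF \<xi>]) (use P in measurable)
  then have "(\<lambda>q. nat \<lfloor>\<Sum>x\<in>\<xi> q. ?F q x\<rfloor>) \<in> measurable Q (count_space UNIV)"
    by simp
  moreover have "nat \<lfloor>\<Sum>x\<in>\<xi> q. ?F q x\<rfloor> = card {x \<in> \<xi> q. P q x}" if "q \<in> space Q" for q
    using configsD(1)[OF measurable_space[OF \<xi> that, unfolded space_config_space]]
    by (simp add: sum.If_cases Int_def)
  ultimately show ?thesis by (simp cong: measurable_cong)
qed

text \<open>The predicate may depend on the parameter as well as on the point. With the
  configuration itself as parameter, this yields thinnings in which a point is kept according to the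
  other points.\<close>

lemma measurable_filter_config:
  assumes \<xi>: "\<xi> \<in> measurable Q CS"
    and P: "{p \<in> space (Q \<Otimes>\<^sub>M L). P (fst p) (snd p)} \<in> sets (Q \<Otimes>\<^sub>M L)"
  shows "(\<lambda>q. {x \<in> \<xi> q. P q x}) \<in> measurable Q CS"
proof (rule measurable_configI)
  fix q assume "q \<in> space Q" then show "{x \<in> \<xi> q. P q x} \<in> configs \<Lambda>"
    using measurable_space[OF \<xi>] by (auto simp: configs_def)
next
  fix B assume B [measurable]: "B \<in> sets (borel :: 'a measure)"
  have eq: "{x \<in> \<xi> q. P q x} \<inter> B = {x \<in> \<xi> q. P q x \<and> x \<in> B}" for q by auto
  have [measurable]: "snd \<in> measurable (Q \<Otimes>\<^sub>M L) (borel :: 'a measure)"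
    using measurable_comp[OF measurable_snd id_L_borel] by (simp add: comp_def)
  have "{p \<in> space (Q \<Otimes>\<^sub>M L). P (fst p) (snd p) \<and> snd p \<in> B}
      = {p \<in> space (Q \<Otimes>\<^sub>M L). P (fst p) (snd p)} \<inter> (snd -` B \<inter> space (Q \<Otimes>\<^sub>M L))" by auto
  also have "\<dots> \<in> sets (Q \<Otimes>\<^sub>M L)" by (rule sets.Int[OF P]) (rule measurable_sets, measurable)
  finally show "(\<lambda>q. card ({x \<in> \<xi> q. P q x} \<inter> B)) \<in> measurable Q (count_space UNIV)"
    unfolding eq by (intro measurable_card_filter[OF \<xi>]) simp
qed

text \<open>The diagonal is measurable, so the number of points of \<open>\<xi> q\<close> that
  coincide with \<open>y q\<close> is measurable, and membership says that this number is not
  zero.\<close>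

lemma pred_mem_config [measurable (raw)]:
  assumes \<xi>: "\<xi> \<in> measurable Q CS" and [measurable]: "y \<in> measurable Q L"
  shows "Measurable.pred Q (\<lambda>q. y q \<in> \<xi> q)"
proof -
  have "(\<lambda>q. card {x \<in> \<xi> q. y q = x}) \<in> measurable Q (count_space UNIV)"
    by (rule measurable_card_filter[OF \<xi>]) measurable
  then have "Measurable.pred Q (\<lambda>q. card {x \<in> \<xi> q. y q = x} \<noteq> 0)" by measurable
  moreover have "card {x \<in> \<xi> q. y q = x} \<noteq> 0 \<longleftrightarrow> y q \<in> \<xi> q" if "q \<in> space Q" for q
  proof -
    have "{x \<in> \<xi> q. y q = x} = (if y q \<in> \<xi> q then {y q} else {})" by auto
    then show ?thesis by simp
  qed
  ultimately show ?thesis by (simp cong: measurable_cong)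
qed

lemma measurable_union_config [measurable (raw)]:
  assumes \<xi>: "\<xi> \<in> measurable Q CS" and \<zeta>: "\<zeta> \<in> measurable Q CS"
  shows "(\<lambda>q. \<xi> q \<union> \<zeta> q) \<in> measurable Q CS"
proof (rule measurable_configI)
  fix q assume "q \<in> space Q" then show "\<xi> q \<union> \<zeta> q \<in> configs \<Lambda>"
    using measurable_space[OF \<xi>] measurable_space[OF \<zeta>] by (auto simp: configs_def)
next
  fix B assume B [measurable]: "B \<in> sets (borel :: 'a measure)"
  note \<zeta> [measurable] \<xi> [measurable]
  \<comment> \<open>Discarding the common points makes the union disjoint, so that counts
    add.\<close>
  have [measurable]: "(\<lambda>q. {x \<in> \<zeta> q. x \<notin> \<xi> q}) \<in> measurable Q CS"
    by (rule measurable_filter_config[OF \<zeta>]) measurable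
  have "(\<lambda>q. card (\<xi> q \<inter> B) + card ({x \<in> \<zeta> q. x \<notin> \<xi> q} \<inter> B)) \<in> measurable Q (count_space UNIV)"
    by measurable
  moreover have "card (\<xi> q \<inter> B) + card ({x \<in> \<zeta> q. x \<notin> \<xi> q} \<inter> B) = card ((\<xi> q \<union> \<zeta> q) \<inter> B)"
    if "q \<in> space Q" for q
  proof -
    have "finite (\<xi> q)" "finite (\<zeta> q)"
      using measurable_space[OF \<xi> that] measurable_space[OF \<zeta> that] by (auto simp: configs_def)
    then show ?thesis by (subst card_Un_disjoint[symmetric]) (auto intro: arg_cong[where f=card])
  qed
  ultimately show "(\<lambda>q. card ((\<xi> q \<union> \<zeta> q) \<inter> B)) \<in> measurable Q (count_space UNIV)"
    by (simp cong: measurable_cong)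
qed

lemma empty_config [simp]: "{} \<in> configs \<Lambda>"
  by (simp add: configs_def)

lemma measurable_singleton_config [measurable (raw)]:
  assumes [measurable]: "y \<in> measurable Q L"
  shows "(\<lambda>q. {y q}) \<in> measurable Q CS"
proof (rule measurable_configI)
  fix q assume "q \<in> space Q" then show "{y q} \<in> configs \<Lambda>"
    using measurable_space[OF assms] by (auto simp: configs_def)
next
  fix B assume [measurable]: "B \<in> sets (borel :: 'a measure)"
  have "(\<lambda>q. if y q \<in> B then 1 else 0 :: nat) \<in> measurable Q (count_space UNIV)" by measurable
  moreover have "card ({y q} \<inter> B) = (if y q \<in> B then 1 else 0)" for q by auto
  ultimately show "(\<lambda>q. card ({y q} \<inter> B)) \<in> measurable Q (count_space UNIV)" by simp
qed

lemma measurable_insert_config [measurable (raw)]: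
  assumes \<xi>: "\<xi> \<in> measurable Q CS" and y: "y \<in> measurable Q L"
  shows "(\<lambda>q. insert (y q) (\<xi> q)) \<in> measurable Q CS"
  using measurable_union_config[OF measurable_singleton_config[OF y] \<xi>] by simp

lemma measurable_remove_config [measurable (raw)]:
  assumes \<xi>: "\<xi> \<in> measurable Q CS" and [measurable]: "y \<in> measurable Q L"
  shows "(\<lambda>q. \<xi> q - {y q}) \<in> measurable Q CS"
proof -
  have "(\<lambda>q. {x \<in> \<xi> q. x \<noteq> y q}) \<in> measurable Q CS"
    by (rule measurable_filter_config[OF \<xi>]) measurable
  moreover have "{x \<in> \<xi> q. x \<noteq> y q} = \<xi> q - {y q}" for q by auto
  ultimately show ?thesis by simp
qed

lemma measurable_card_config [measurable (raw)]:
  assumes \<xi>: "\<xi> \<in> measurable Q CS"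
  shows "(\<lambda>q. card (\<xi> q)) \<in> measurable Q (count_space UNIV)"
  using measurable_card_Int'[OF \<xi>, of UNIV] by simp

text \<open>Logarithms turn the product into a sum, except where some factor vanishes.\<close>

lemma measurable_prod_config:
  fixes F :: "'q \<Rightarrow> 'a \<Rightarrow> real"
  assumes \<xi>: "\<xi> \<in> measurable Q CS"
    and F [measurable]: "(\<lambda>p. F (fst p) (snd p)) \<in> borel_measurable (Q \<Otimes>\<^sub>M L)"
    and pos: "\<And>q x. q \<in> space Q \<Longrightarrow> x \<in> \<Lambda> \<Longrightarrow> 0 \<le> F q x"
  shows "(\<lambda>q. \<Prod>x\<in>\<xi> q. F q x) \<in> borel_measurable Q"
proof -
  have [measurable]: "(\<lambda>q. card {x \<in> \<xi> q. F q x = 0}) \<in> measurable Q (count_space UNIV)"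
    by (rule measurable_card_filter[OF \<xi>]) measurable
  have [measurable]: "(\<lambda>q. \<Sum>x\<in>\<xi> q. ln (F q x)) \<in> borel_measurable Q"
    by (rule measurable_sum_config[OF \<xi>]) measurable
  have "(\<lambda>q. if card {x \<in> \<xi> q. F q x = 0} \<noteq> 0 then 0 else exp (\<Sum>x\<in>\<xi> q. ln (F q x))) \<in> borel_measurable Q"
    by measurable
  moreover have "(if card {x \<in> \<xi> q. F q x = 0} \<noteq> 0 then 0 else exp (\<Sum>x\<in>\<xi> q. ln (F q x))) = (\<Prod>x\<in>\<xi> q. F q x)"
    if q: "q \<in> space Q" for q
  proof -
    have fin: "finite (\<xi> q)" and sub: "\<xi> q \<subseteq> \<Lambda>"
      using measurable_space[OF \<xi> q] by (auto simp: configs_def)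
    show ?thesis
    proof (cases "\<exists>x\<in>\<xi> q. F q x = 0")
      case True
      then show ?thesis using fin by (auto simp: prod_zero_iff card_eq_0_iff)
    next
      case False
      then have "card {x \<in> \<xi> q. F q x = 0} = 0" by (auto simp: card_eq_0_iff)
      moreover have "exp (ln (F q x)) = F q x" if "x \<in> \<xi> q" for x
        using False that sub pos[OF q, of x] by (force simp: less_le)
      ultimately show ?thesis by (simp add: exp_sum[OF fin])
    qed
  qed
  ultimately show ?thesis by (rule measurable_cong[THEN iffD1, rotated])
qed

end

text \<open>The number of image points in \<open>B\<close> is the number of points mapped into \<open>B\<close>, each
  divided by the size of its fibre.\<close>

lemma measurable_image_config:
  fixes \<Lambda> :: "'a::euclidean_space set" and V :: "'b::euclidean_space set"
  assumes "region \<Lambda>" "region V"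
    and \<xi> [measurable]: "\<xi> \<in> measurable Q (config_space V)"
    and h [measurable]: "h \<in> measurable (restrict_space lborel V) (restrict_space lborel \<Lambda>)"
  shows "(\<lambda>q. h ` \<xi> q) \<in> measurable Q (config_space \<Lambda>)"
proof -
  interpret A: region \<Lambda> by fact
  interpret V: region V by fact
  have sp: "finite (\<xi> q)" "\<xi> q \<subseteq> V" if "q \<in> space Q" for q
    using measurable_space[OF \<xi> that] by (auto simp: configs_def)
  show ?thesis
  proof (rule A.measurable_configI)
    fix q assume "q \<in> space Q" then show "h ` \<xi> q \<in> configs \<Lambda>"
      using sp measurable_space[OF h] by (fastforce simp: configs_def)
  next
    fix B assume [measurable]: "B \<in> sets (borel :: 'a measure)"
    have [measurable]: "(\<lambda>p. card {w \<in> \<xi> (fst p). h w = h (snd p)}) \<in> measurable (Q \<Otimes>\<^sub>M V.L) (count_space UNIV)"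
    proof (rule V.measurable_card_filter)
      have [measurable]: "(\<lambda>p. h (snd p)) \<in> measurable ((Q \<Otimes>\<^sub>M V.L) \<Otimes>\<^sub>M V.L) borel"
        by (rule measurable_compose[OF _ A.id_L_borel]) measurable
      have [measurable]: "(\<lambda>p. h (snd (fst p))) \<in> measurable ((Q \<Otimes>\<^sub>M V.L) \<Otimes>\<^sub>M V.L) borel"
        by (rule measurable_compose[OF _ A.id_L_borel]) measurable
      show "{p \<in> space ((Q \<Otimes>\<^sub>M V.L) \<Otimes>\<^sub>M V.L). h (snd p) = h (snd (fst p))} \<in> sets ((Q \<Otimes>\<^sub>M V.L) \<Otimes>\<^sub>M V.L)"
        by measurable
    qed measurable
    have [measurable]: "(\<lambda>p. h (snd p)) \<in> measurable (Q \<Otimes>\<^sub>M V.L) borel"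
        by (rule measurable_compose[OF _ A.id_L_borel]) measurable
    let ?F = "\<lambda>q y. (if h y \<in> B then 1 / real (card {w \<in> \<xi> q. h w = h y}) else 0)"
    have "(\<lambda>q. \<Sum>y\<in>\<xi> q. ?F q y) \<in> borel_measurable Q"
      by (rule V.measurable_sum_config[OF \<xi>]) measurable
    then have "(\<lambda>q. nat \<lfloor>\<Sum>y\<in>\<xi> q. ?F q y\<rfloor>) \<in> measurable Q (count_space UNIV)" by simp
    moreover have "nat \<lfloor>\<Sum>y\<in>\<xi> q. ?F q y\<rfloor> = card (h ` \<xi> q \<inter> B)" if q: "q \<in> space Q" for q
    proof -
      note fin = sp(1)[OF q]
      have "(\<Sum>y\<in>\<xi> q. ?F q y) = (\<Sum>z\<in>h ` \<xi> q. \<Sum>y\<in>{y \<in> \<xi> q. h y = z}. ?F q y)"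
        using fin by (rule sum.image_gen)
      also have "\<dots> = (\<Sum>z\<in>h ` \<xi> q. if z \<in> B then 1 else 0)"
      proof (rule sum.cong)
        fix z assume z: "z \<in> h ` \<xi> q"
        \<comment> \<open>The fibre over \<open>z\<close> is finite and nonempty, so its points,
          each weighted by the inverse of its size, contribute exactly 1 when \<open>z\<close> lies
          in \<open>B\<close>.\<close>
        then have "card {y \<in> \<xi> q. h y = z} \<noteq> 0" using fin by auto
        then show "(\<Sum>y\<in>{y \<in> \<xi> q. h y = z}. ?F q y) = (if z \<in> B then 1 else 0)"
          by simp
      qed simp
      also have "\<dots> = real (card (h ` \<xi> q \<inter> B))"
        using fin by (simp add: sum.If_cases Int_def)
      finally show ?thesis by simp
    qed
    ultimately show "(\<lambda>q. card (h ` \<xi> q \<inter> B)) \<in> measurable Q (count_space UNIV)"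
      by (simp cong: measurable_cong)
  qed
qed

section \<open>The Lebesgue--Poisson measure and the Mecke equation\<close>

context region
begin

lemma emeasure_L_finite: "emeasure lborel \<Lambda> < \<infinity>"
  using region_bounded emeasure_bounded_finite by blast

lemma finite_measure_L: "finite_measure L"
  using emeasure_L_finite region_borel
  by (intro finite_measureI) (simp add: emeasure_restrict_space)

sublocale L: finite_measure L by (rule finite_measure_L)

sublocale P: product_sigma_finite "\<lambda>_::nat. L" ..

text \<open>The n-th power of this operator, evaluated at the empty configuration, is the n-th term
  of the Lebesgue-Poisson series up to the factor 1/n!. Induction on the number of points thus
  becomes iteration of an operator.\<close>

definition add_point :: "('a set \<Rightarrow> ennreal) \<Rightarrow> 'a set \<Rightarrow> ennreal" where
  "add_point F \<eta> = (\<integral>\<^sup>+y. F (insert y \<eta>) \<partial>L)"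

text \<open>The spectator variable in \<open>Q\<close> is carried along because the integrand of the
  Mecke equation depends on a marked point that is not integrated yet.\<close>

lemma measurable_add_point:
  assumes [measurable]: "(\<lambda>p. F (fst p) (snd p)) \<in> borel_measurable (Q \<Otimes>\<^sub>M CS)"
  shows "(\<lambda>p. add_point (F (fst p)) (snd p)) \<in> borel_measurable (Q \<Otimes>\<^sub>M CS)"
proof -
  have "(\<lambda>r. (fst (fst r), insert (snd r) (snd (fst r)))) \<in> measurable ((Q \<Otimes>\<^sub>M CS) \<Otimes>\<^sub>M L) (Q \<Otimes>\<^sub>M CS)"
    by measurable
  from measurable_compose[OF this assms]
  have "(\<lambda>(p, y). F (fst p) (insert y (snd p))) \<in> borel_measurable ((Q \<Otimes>\<^sub>M CS) \<Otimes>\<^sub>M L)"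
    by (simp add: split_beta)
  then show ?thesis unfolding add_point_def
    by (intro L.borel_measurable_nn_integral) auto
qed

lemma measurable_add_point_power:
  assumes "(\<lambda>p. F (fst p) (snd p)) \<in> borel_measurable (Q \<Otimes>\<^sub>M CS)"
  shows "(\<lambda>p. (add_point ^^ n) (F (fst p)) (snd p)) \<in> borel_measurable (Q \<Otimes>\<^sub>M CS)"
proof (induction n)
  case (Suc n)
  from measurable_add_point[OF this] show ?case by simp
qed (use assms in simp)

lemma measurable_section:
  assumes "(\<lambda>p. F (fst p) (snd p)) \<in> measurable (A \<Otimes>\<^sub>M B) C" "x \<in> space A"
  shows "F x \<in> measurable B C"
  using measurable_compose[OF measurable_Pair1'[OF assms(2)] assms(1)] by simp

lemma measurable_section2:
  assumes "(\<lambda>p. F (fst p) (snd p)) \<in> measurable (A \<Otimes>\<^sub>M B) C" "y \<in> space B"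
  shows "(\<lambda>x. F x y) \<in> measurable A C"
  using measurable_compose[OF measurable_Pair2'[OF assms(2)] assms(1)] by simp

lemma measurable_add_point1:
  assumes "F \<in> borel_measurable CS" shows "add_point F \<in> borel_measurable CS"
proof -
  \<comment> \<open>A one-point parameter space specialises the parametrised rule to a single
    function.\<close>
  have "(\<lambda>p. add_point F (snd p)) \<in> borel_measurable (count_space {()} \<Otimes>\<^sub>M CS)"
    by (rule measurable_add_point[where F="\<lambda>_. F", OF measurable_compose[OF measurable_snd assms]])
  from measurable_section[where F="\<lambda>_. add_point F", OF this] show ?thesis by simp
qed

lemma measurable_image_tuple:
  assumes "finite I" "I \<subseteq> J"
  shows "(\<lambda>x. x ` I) \<in> measurable (Pi\<^sub>M J (\<lambda>_::nat. L)) CS"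
  using assms
proof (induction I rule: finite_induct)
  case (insert i I)
  then have [measurable]: "(\<lambda>x. x ` I) \<in> measurable (Pi\<^sub>M J (\<lambda>_::nat. L)) CS" "i \<in> J" by auto
  show ?case unfolding image_insert by measurable
qed auto

lemma nn_integral_image_tuple:
  assumes "finite (I :: nat set)" "F \<in> borel_measurable CS"
  shows "(\<integral>\<^sup>+x. F (x ` I) \<partial>Pi\<^sub>M I (\<lambda>_. L)) = (add_point ^^ card I) F {}"
  using assms
proof (induction I arbitrary: F rule: finite_induct)
  case empty
  have "emeasure (Pi\<^sub>M {} (\<lambda>_::nat. L)) (space (Pi\<^sub>M {} (\<lambda>_. L))) = 1"
    by (simp add: space_PiM_empty emeasure_PiM_empty)
  then show ?case by simp
next
  case (insert i I)
  have im: "(x(i := y)) ` insert i I = insert y (x ` I)" for x :: "nat \<Rightarrow> 'a" and y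
  proof -
    have "(x(i := y)) ` I = x ` I" using insert(2) by (intro image_cong) auto
    then show ?thesis unfolding image_insert by simp
  qed
  have "(\<integral>\<^sup>+x. F (x ` insert i I) \<partial>Pi\<^sub>M (insert i I) (\<lambda>_. L))
      = (\<integral>\<^sup>+x. add_point F (x ` I) \<partial>Pi\<^sub>M I (\<lambda>_. L))"
  proof (subst P.product_nn_integral_insert)
    show "(\<lambda>x. F (x ` insert i I)) \<in> borel_measurable (Pi\<^sub>M (insert i I) (\<lambda>_. L))"
      using insert(1,4) by (intro measurable_compose[OF measurable_image_tuple]) auto
  qed (use insert(1,2) in \<open>simp_all only: im add_point_def\<close>, simp_all)
  also have "\<dots> = (add_point ^^ card I) (add_point F) {}"
    by (rule insert.IH) (rule measurable_add_point1[OF insert(4)])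
  also have "\<dots> = (add_point ^^ card (insert i I)) F {}"
    using insert(1,2) by (simp add: funpow_swap1)
  finally show ?case .
qed

abbreviation "tuple_law n \<equiv> distr (Pi\<^sub>M {..<n::nat} (\<lambda>_. L)) CS (\<lambda>x. x ` {..<n})"

lemma sets_LP [simp, measurable_cong]: "sets LP = sets CS"
  unfolding lebesgue_poisson_def using sets.space_closed[of CS] sets.sigma_sets_eq[of CS] by simp

lemma space_LP [simp]: "space LP = configs \<Lambda>"
  using sets_eq_imp_space_eq[OF sets_LP] by simp

lemma emeasure_LP:
  assumes "E \<in> sets CS" shows "emeasure LP E = (\<Sum>n. emeasure (tuple_law n) E / fact n)"
  unfolding lebesgue_poisson_def
proof (rule emeasure_measure_of_sigma)
  show "sigma_algebra (configs \<Lambda>) (sets CS)" using sets.sigma_algebra_axioms[of CS] by simp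
  show "positive (sets CS) (\<lambda>E. \<Sum>n. emeasure (tuple_law n) E / fact n)" by (simp add: positive_def)
  show "countably_additive (sets CS) (\<lambda>E. \<Sum>n. emeasure (tuple_law n) E / fact n)"
  proof (rule countably_additiveI)
    fix A :: "nat \<Rightarrow> 'a set set" assume A: "range A \<subseteq> sets CS" "disjoint_family A"
    \<comment> \<open>Reading the outer series as an integral over counting measure lets the two
      series be exchanged.\<close>
    have "(\<Sum>i. \<Sum>n. emeasure (tuple_law n) (A i) / fact n)
        = (\<integral>\<^sup>+i. (\<Sum>n. emeasure (tuple_law n) (A i) / fact n) \<partial>count_space UNIV)"
      by (simp add: nn_integral_count_space_nat)
    also have "\<dots> = (\<Sum>n. \<Sum>i. emeasure (tuple_law n) (A i) / fact n)"
      by (subst nn_integral_suminf) (simp_all add: nn_integral_count_space_nat)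
    also have "\<dots> = (\<Sum>n. emeasure (tuple_law n) (\<Union>i. A i) / fact n)"
      using A by (simp add: divide_ennreal_def ennreal_suminf_multc suminf_emeasure)
    finally show "(\<Sum>i. \<Sum>n. emeasure (tuple_law n) (A i) / fact n)
        = (\<Sum>n. emeasure (tuple_law n) (\<Union>i. A i) / fact n)" .
  qed
qed fact

text \<open>The measure is defined by a series on sets, and monotone classes lift the series to
  integrands. The sum over \<open>n\<close> stays an integral over counting measure so that monotone
  convergence exchanges it with the supremum.\<close>

lemma nn_integral_LP_tuple:
  assumes "F \<in> borel_measurable CS"
  shows "(\<integral>\<^sup>+\<eta>. F \<eta> \<partial>LP) = (\<integral>\<^sup>+n. (\<integral>\<^sup>+\<eta>. F \<eta> \<partial>tuple_law n) / fact n \<partial>count_space UNIV)"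
  using assms
proof (induction F rule: borel_measurable_induct)
  case (cong f g)
  have "(\<integral>\<^sup>+\<eta>. f \<eta> \<partial>LP) = (\<integral>\<^sup>+\<eta>. g \<eta> \<partial>LP)" by (rule nn_integral_cong) (use cong(3) in simp)
  moreover have "(\<integral>\<^sup>+\<eta>. f \<eta> \<partial>tuple_law n) = (\<integral>\<^sup>+\<eta>. g \<eta> \<partial>tuple_law n)" for n
    by (rule nn_integral_cong) (use cong(3) in simp)
  ultimately show ?case using cong(4) by (simp only:)
next
  case (set A) then show ?case by (simp add: emeasure_LP nn_integral_count_space_nat)
next
  case (mult u c)
  have "(\<integral>\<^sup>+\<eta>. u \<eta> \<partial>LP) = (\<integral>\<^sup>+n. (\<integral>\<^sup>+\<eta>. u \<eta> \<partial>tuple_law n) / fact n \<partial>count_space UNIV)" using mult by simp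
  then show ?case using mult(2)
    by (simp add: nn_integral_cmult divide_ennreal_def mult.assoc del: nn_integral_distr)
next
  case (add u v)
  then show ?case by (simp add: nn_integral_add divide_ennreal_def distrib_right)
next
  case (seq U)
  have inc: "incseq (\<lambda>i. \<integral>\<^sup>+\<eta>. U i \<eta> \<partial>M)" for M
    using seq(3) by (auto simp: mono_def le_fun_def intro!: nn_integral_mono)
  have "(\<integral>\<^sup>+\<eta>. (SUP i. U i) \<eta> \<partial>LP) = (SUP i. \<integral>\<^sup>+\<eta>. U i \<eta> \<partial>LP)"
    unfolding SUP_apply using seq(1,3) by (intro nn_integral_monotone_convergence_SUP) auto
  also have "\<dots> = (SUP i. \<integral>\<^sup>+n. (\<integral>\<^sup>+\<eta>. U i \<eta> \<partial>tuple_law n) / fact n \<partial>count_space UNIV)"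
    using seq.IH by simp
  also have "\<dots> = (\<integral>\<^sup>+n. (SUP i. (\<integral>\<^sup>+\<eta>. U i \<eta> \<partial>tuple_law n) / fact n) \<partial>count_space UNIV)"
    using inc by (intro nn_integral_monotone_convergence_SUP[symmetric])
      (auto simp: mono_def le_fun_def divide_ennreal_def intro!: mult_right_mono)
  also have "\<dots> = (\<integral>\<^sup>+n. (\<integral>\<^sup>+\<eta>. (SUP i. U i) \<eta> \<partial>tuple_law n) / fact n \<partial>count_space UNIV)"
  proof (rule nn_integral_cong)
    fix n
    have "(\<integral>\<^sup>+\<eta>. (SUP i. U i) \<eta> \<partial>tuple_law n) = (SUP i. \<integral>\<^sup>+\<eta>. U i \<eta> \<partial>tuple_law n)"
      unfolding SUP_apply using seq(1,3) by (intro nn_integral_monotone_convergence_SUP) auto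
    then show "(SUP i. (\<integral>\<^sup>+\<eta>. U i \<eta> \<partial>tuple_law n) / fact n) = (\<integral>\<^sup>+\<eta>. (SUP i. U i) \<eta> \<partial>tuple_law n) / fact n"
      by (simp add: divide_ennreal_def SUP_mult_right_ennreal)
  qed
  finally show ?case .
qed

lemma nn_integral_LP:
  assumes F: "F \<in> borel_measurable CS"
  shows "(\<integral>\<^sup>+\<eta>. F \<eta> \<partial>LP) = (\<Sum>n. (add_point ^^ n) F {} / fact n)"
proof -
  have "(\<integral>\<^sup>+\<eta>. F \<eta> \<partial>tuple_law n) = (add_point ^^ n) F {}" for n
    using nn_integral_image_tuple[of "{..<n}" F] F
    by (subst nn_integral_distr) (auto intro: measurable_image_tuple)
  then show ?thesis by (simp add: nn_integral_LP_tuple[OF F] nn_integral_count_space_nat)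
qed

lemma AE_L_notin: assumes "finite \<eta>" shows "AE y in L. y \<notin> \<eta>"
proof -
  have "AE y in lborel. y \<notin> \<eta>"
    using assms by (intro AE_not_in) (simp add: null_sets_def emeasure_lborel_countable countable_finite finite_imp_closed)
  then show ?thesis using region_borel by (auto simp: AE_restrict_space_iff)
qed

lemma configs_insert: "\<eta> \<in> configs \<Lambda> \<Longrightarrow> y \<in> \<Lambda> \<Longrightarrow> insert y \<eta> \<in> configs \<Lambda>"
  by (auto simp: configs_def)

lemma configs_remove: "\<eta> \<in> configs \<Lambda> \<Longrightarrow> \<eta> - A \<in> configs \<Lambda>"
  by (auto simp: configs_def)

lemma measurable_insert_const:
  "\<eta> \<in> configs \<Lambda> \<Longrightarrow> (\<lambda>y. insert y \<eta>) \<in> measurable L CS"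
  by (intro measurable_insert_config measurable_const measurable_ident_sets) auto

text \<open>Combinatorial core of the Mecke equation. After \<open>n\<close> points have been added
  to \<open>\<eta>\<close>, the marked point is either an old point or one of the \<open>n\<close>
  new ones, and by symmetry the new ones contribute \<open>n\<close> equal terms. The induction
  needs an arbitrary starting configuration although only the empty one is used in the end.\<close>

lemma add_point_power_sum_remove:
  assumes F: "(\<lambda>p. F (fst p) (snd p)) \<in> borel_measurable (L \<Otimes>\<^sub>M CS)" and "\<eta> \<in> configs \<Lambda>"
  shows "(add_point ^^ n) (\<lambda>\<eta>. \<Sum>x\<in>\<eta>. F x (\<eta> - {x})) \<eta>
    = (\<Sum>x\<in>\<eta>. (add_point ^^ n) (F x) (\<eta> - {x})) + of_nat n * (\<integral>\<^sup>+x. (add_point ^^ (n - 1)) (F x) \<eta> \<partial>L)"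
  using assms(2)
proof (induction n arbitrary: \<eta>)
  case (Suc n)
  note \<eta> = Suc.prems
  have fin: "finite \<eta>" and sub: "\<eta> \<subseteq> \<Lambda>" using \<eta> by (auto simp: configs_def)
  note meas = measurable_add_point_power[OF F]
  have ins [measurable]: "(\<lambda>y. insert y (\<eta> - A)) \<in> measurable L CS" for A
    by (rule measurable_insert_const[OF configs_remove[OF \<eta>]])
  have ins0: "(\<lambda>y. insert y \<eta>) \<in> measurable L CS" using ins[of "{}"] by simp
  have m1: "(\<lambda>y. (add_point ^^ n) (F y) \<eta>) \<in> borel_measurable L" for n
    using measurable_section2[OF meas, of \<eta>] \<eta> by simp
  have m2: "(\<lambda>y. (add_point ^^ n) (F x) (insert y (\<eta> - {x}))) \<in> borel_measurable L" if "x \<in> \<Lambda>" for x n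
    using measurable_compose[OF ins measurable_section[OF meas, of x]] that by simp
  have "(\<lambda>p. (snd p, insert (fst p) \<eta>)) \<in> measurable (L \<Otimes>\<^sub>M L) (L \<Otimes>\<^sub>M CS)"
    using measurable_compose[OF measurable_fst ins0] by measurable
  from measurable_compose[OF this meas]
  have m3: "case_prod (\<lambda>y x. (add_point ^^ n) (F x) (insert y \<eta>)) \<in> borel_measurable (L \<Otimes>\<^sub>M L)" for n
    by (simp add: split_beta)
  interpret LL: pair_sigma_finite L L ..
  have m4: "(\<lambda>y. \<integral>\<^sup>+x. (add_point ^^ n) (F x) (insert y \<eta>) \<partial>L) \<in> borel_measurable L" for n
    using m3 by (rule L.borel_measurable_nn_integral)
  let ?G = "\<lambda>\<eta>. \<Sum>x\<in>\<eta>. F x (\<eta> - {x})"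
  have "(add_point ^^ Suc n) ?G \<eta> = (\<integral>\<^sup>+y. (add_point ^^ n) ?G (insert y \<eta>) \<partial>L)"
    by (simp add: add_point_def)
  also have "\<dots> = (\<integral>\<^sup>+y. ((add_point ^^ n) (F y) \<eta> + (\<Sum>x\<in>\<eta>. (add_point ^^ n) (F x) (insert y (\<eta> - {x}))))
      + of_nat n * (\<integral>\<^sup>+x. (add_point ^^ (n - 1)) (F x) (insert y \<eta>) \<partial>L) \<partial>L)"
  proof (rule nn_integral_cong_AE)
    \<comment> \<open>Almost every new point \<open>y\<close> lies outside \<open>\<eta>\<close>, so
      the sum over \<open>insert y \<eta>\<close> splits into the term of \<open>y\<close> and the
      old terms.\<close>
    show "AE y in L. (add_point ^^ n) ?G (insert y \<eta>) =
       ((add_point ^^ n) (F y) \<eta> + (\<Sum>x\<in>\<eta>. (add_point ^^ n) (F x) (insert y (\<eta> - {x}))))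
      + of_nat n * (\<integral>\<^sup>+x. (add_point ^^ (n - 1)) (F x) (insert y \<eta>) \<partial>L)"
      using AE_L_notin[OF fin] AE_space
    proof eventually_elim
      case (elim y)
      have "(\<Sum>x\<in>insert y \<eta>. (add_point ^^ n) (F x) (insert y \<eta> - {x})) =
        (add_point ^^ n) (F y) \<eta> + (\<Sum>x\<in>\<eta>. (add_point ^^ n) (F x) (insert y (\<eta> - {x})))"
      proof -
        have "insert y \<eta> - {x} = insert y (\<eta> - {x})" if "x \<in> \<eta>" for x using elim that by auto
        then show ?thesis using elim fin by simp
      qed
      then show ?case using Suc.IH[of "insert y \<eta>"] configs_insert[OF \<eta>, of y] elim by simp
    qed
  qed
  also have "\<dots> = ((\<integral>\<^sup>+y. (add_point ^^ n) (F y) \<eta> \<partial>L) + (\<Sum>x\<in>\<eta>. (add_point ^^ Suc n) (F x) (\<eta> - {x})))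
      + of_nat n * (\<integral>\<^sup>+y. (\<integral>\<^sup>+x. (add_point ^^ (n - 1)) (F x) (insert y \<eta>) \<partial>L) \<partial>L)"
  proof -
    have b: "(\<lambda>y. \<Sum>x\<in>\<eta>. (add_point ^^ n) (F x) (insert y (\<eta> - {x}))) \<in> borel_measurable L"
      using m2 sub by (intro borel_measurable_sum) auto
    have c: "(\<lambda>y. of_nat n * (\<integral>\<^sup>+x. (add_point ^^ (n - 1)) (F x) (insert y \<eta>) \<partial>L)) \<in> borel_measurable L"
      by (rule borel_measurable_times_ennreal[OF borel_measurable_const m4])
    have "(\<integral>\<^sup>+y. (\<Sum>x\<in>\<eta>. (add_point ^^ n) (F x) (insert y (\<eta> - {x}))) \<partial>L)
        = (\<Sum>x\<in>\<eta>. (add_point ^^ Suc n) (F x) (\<eta> - {x}))"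
      using m2 sub by (subst nn_integral_sum) (auto simp: add_point_def)
    then show ?thesis
      by (simp only: nn_integral_add[OF borel_measurable_add[OF m1 b] c] nn_integral_add[OF m1 b]
          nn_integral_cmult[OF m4])
  qed
  also have "of_nat n * (\<integral>\<^sup>+y. (\<integral>\<^sup>+x. (add_point ^^ (n - 1)) (F x) (insert y \<eta>) \<partial>L) \<partial>L)
      = of_nat n * (\<integral>\<^sup>+x. (add_point ^^ n) (F x) \<eta> \<partial>L)"
  \<comment> \<open>Tonelli makes the marked point the outermost variable. For \<open>n = 0\<close>
    the truncated index \<open>n - 1\<close> is harmless because of the factor 0.\<close>
  proof (cases n)
    case (Suc m)
    have "(\<integral>\<^sup>+y. (\<integral>\<^sup>+x. (add_point ^^ m) (F x) (insert y \<eta>) \<partial>L) \<partial>L)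
       = (\<integral>\<^sup>+x. (\<integral>\<^sup>+y. (add_point ^^ m) (F x) (insert y \<eta>) \<partial>L) \<partial>L)"
      using m3[of m] by (rule LL.Fubini'[symmetric])
    then show ?thesis using Suc by (simp add: add_point_def)
  qed simp
  finally show ?case by (simp add: algebra_simps)
qed simp

lemma ennreal_suminf_Suc:
  fixes f :: "nat \<Rightarrow> ennreal" assumes "f 0 = 0" shows "(\<Sum>n. f n) = (\<Sum>n. f (Suc n))"
  using sums_Suc[of f "\<Sum>n. f (Suc n)"] assms by (simp add: sums_iff)

lemma ennreal_fact: "(fact n :: ennreal) = ennreal (fact n)"
  by (metis ennreal_of_nat_eq_real_of_nat of_nat_fact)

lemma ennreal_fact_cancel: "of_nat (Suc n) * (a::ennreal) / fact (Suc n) = a / fact n"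
proof -
  have "(of_nat (Suc n) :: ennreal) * inverse (fact (Suc n)) = ennreal (real (Suc n) * inverse (fact (Suc n)))"
    unfolding ennreal_fact ennreal_of_nat_eq_real_of_nat
    by (subst inverse_ennreal) (simp_all only: fact_gt_zero ennreal_mult'[symmetric] of_nat_0_le_iff)
  also have "real (Suc n) * inverse (fact (Suc n)) = inverse (fact n)"
    by (simp only: fact_Suc inverse_mult_distrib) (simp del: of_nat_Suc)
  also have "ennreal (inverse (fact n)) = inverse (fact n :: ennreal)"
    unfolding ennreal_fact by (rule inverse_ennreal[symmetric]) simp
  finally have "(of_nat (Suc n) :: ennreal) * inverse (fact (Suc n)) = inverse (fact n)" .
  then show ?thesis
    by (metis divide_ennreal_def mult.assoc mult.commute)
qed

lemma measurable_sum_remove: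
  fixes F :: "'a \<Rightarrow> 'a set \<Rightarrow> ennreal"
  assumes F: "(\<lambda>p. F (fst p) (snd p)) \<in> borel_measurable (L \<Otimes>\<^sub>M CS)"
  shows "(\<lambda>\<eta>. \<Sum>x\<in>\<eta>. F x (\<eta> - {x})) \<in> borel_measurable CS"
proof (rule measurable_sum_config_ennreal)
  have "(\<lambda>p. (snd p, fst p - {snd p})) \<in> measurable (CS \<Otimes>\<^sub>M L) (L \<Otimes>\<^sub>M CS)" by measurable
  from measurable_compose[OF this F]
  show "(\<lambda>p. F (snd p) (fst p - {snd p})) \<in> borel_measurable (CS \<Otimes>\<^sub>M L)" by simp
qed simp

text \<open>Started from the empty configuration there are no old points, so only the
  \<open>n\<close> equal terms of the new points survive.\<close>

lemma mecke_nn: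
  assumes F: "(\<lambda>p. F (fst p) (snd p)) \<in> borel_measurable (L \<Otimes>\<^sub>M CS)"
  shows "(\<integral>\<^sup>+\<eta>. (\<Sum>x\<in>\<eta>. F x (\<eta> - {x})) \<partial>LP) = (\<integral>\<^sup>+x. (\<integral>\<^sup>+\<eta>. F x \<eta> \<partial>LP) \<partial>L)"
proof -
  have m: "(\<lambda>x. (add_point ^^ n) (F x) {}) \<in> borel_measurable L" for n
    using measurable_section2[OF measurable_add_point_power[OF F], of "{}"] by simp
  have "(\<integral>\<^sup>+\<eta>. (\<Sum>x\<in>\<eta>. F x (\<eta> - {x})) \<partial>LP)
      = (\<Sum>n. of_nat n * (\<integral>\<^sup>+x. (add_point ^^ (n - 1)) (F x) {} \<partial>L) / fact n)"
    by (subst nn_integral_LP[OF measurable_sum_remove[OF F]])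
      (simp add: add_point_power_sum_remove[OF F])
  \<comment> \<open>The factor \<open>n\<close> cancels against n!, and shifting the index drops the
    vanishing term at 0.\<close>
  also have "\<dots> = (\<Sum>n. (\<integral>\<^sup>+x. (add_point ^^ n) (F x) {} \<partial>L) / fact n)"
    by (subst ennreal_suminf_Suc) (simp_all add: ennreal_fact_cancel del: of_nat_Suc fact_Suc)
  also have "\<dots> = (\<integral>\<^sup>+x. (\<Sum>n. (add_point ^^ n) (F x) {} / fact n) \<partial>L)"
    using m by (subst nn_integral_suminf) (auto simp: divide_ennreal_def nn_integral_multc)
  also have "\<dots> = (\<integral>\<^sup>+x. (\<integral>\<^sup>+\<eta>. F x \<eta> \<partial>LP) \<partial>L)"
    by (rule nn_integral_cong, subst nn_integral_LP) (auto intro: measurable_section[OF F])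
  finally show ?thesis .
qed

lemma void_weight_measurable:
  assumes B [measurable]: "B \<in> sets borel"
  shows "(\<lambda>\<eta>. if \<eta> \<inter> B = {} then ennreal (r ^ card \<eta>) else 0) \<in> borel_measurable CS"
proof -
  have "(\<lambda>\<eta>. if card (\<eta> \<inter> B) = 0 then ennreal (r ^ card \<eta>) else 0) \<in> borel_measurable CS" by measurable
  then show ?thesis by (rule measurable_cong[THEN iffD1, rotated]) (auto simp: configs_def)
qed

text \<open>The integrand is an eigenfunction of \<open>add_point\<close> with eigenvalue
  \<open>r * measure lborel (\<Lambda> - B)\<close>, so the series is exponential. With
  \<open>B\<close> empty this is the exponential moment behind all integrability; for general
  \<open>B\<close> it gives the void probabilities of a Poisson process.\<close>

lemma nn_integral_LP_void:
  assumes B [measurable]: "B \<in> sets borel" and r: "0 \<le> r"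
  shows "(\<integral>\<^sup>+\<eta>. (if \<eta> \<inter> B = {} then ennreal (r ^ card \<eta>) else 0) \<partial>LP) = ennreal (exp (r * measure lborel (\<Lambda> - B)))"
proof -
  let ?h = "\<lambda>\<eta>::'a set. (if \<eta> \<inter> B = {} then ennreal (r ^ card \<eta>) else 0)"
  let ?m = "measure lborel (\<Lambda> - B)"
  have [measurable]: "\<Lambda> \<in> sets borel" by (rule region_borel)
  have em: "emeasure L (\<Lambda> - B) = ennreal ?m"
  proof -
    have "emeasure lborel (\<Lambda> - B) \<le> emeasure lborel \<Lambda>" by (rule emeasure_mono) auto
    then have "emeasure lborel (\<Lambda> - B) \<noteq> \<top>" using emeasure_L_finite by auto
    then show ?thesis by (subst emeasure_restrict_space) (auto intro!: emeasure_eq_ennreal_measure)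
  qed
  have step: "add_point ?h \<eta> = ennreal (r * ?m) * ?h \<eta>" if "\<eta> \<in> configs \<Lambda>" for \<eta>
  proof -
    have fin: "finite \<eta>" using that by (simp add: configs_def)
    have "add_point ?h \<eta> = (\<integral>\<^sup>+y. ennreal r * ?h \<eta> * indicator (\<Lambda> - B) y \<partial>L)"
      unfolding add_point_def
    proof (rule nn_integral_cong_AE)
      show "AE y in L. ?h (insert y \<eta>) = ennreal r * ?h \<eta> * indicator (\<Lambda> - B) y"
        using AE_L_notin[OF fin] AE_space
        by eventually_elim (use fin r in \<open>auto simp: indicator_def ennreal_mult'\<close>)
    qed
    also have "\<dots> = ennreal r * ?h \<eta> * emeasure L (\<Lambda> - B)"
      by (rule nn_integral_cmult_indicator) (simp add: sets_L_eq)
    finally show ?thesis using r by (simp add: em ennreal_mult' mult_ac)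
  qed
  have pow: "(add_point ^^ n) ?h \<eta> = ennreal ((r * ?m) ^ n) * ?h \<eta>" if "\<eta> \<in> configs \<Lambda>" for \<eta> n
    using that
  proof (induction n arbitrary: \<eta>)
    case (Suc n)
    have "(\<lambda>y. insert y \<eta>) \<in> measurable L CS" using Suc.prems by (rule measurable_insert_const)
    then have m: "(\<lambda>y. ?h (insert y \<eta>)) \<in> borel_measurable L"
      using void_weight_measurable[OF B] by (rule measurable_compose)
    have "(add_point ^^ Suc n) ?h \<eta> = (\<integral>\<^sup>+y. ennreal ((r * ?m) ^ n) * ?h (insert y \<eta>) \<partial>L)"
      unfolding funpow.simps o_def add_point_def[of "(add_point ^^ n) ?h"]
      by (rule nn_integral_cong) (use Suc configs_insert in auto)
    also have "\<dots> = ennreal ((r * ?m) ^ n) * add_point ?h \<eta>"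
      unfolding add_point_def using m by (rule nn_integral_cmult)
    finally show ?case using step[OF Suc.prems] r by (simp add: ennreal_mult' mult_ac)
  qed simp
  have "(\<integral>\<^sup>+\<eta>. ?h \<eta> \<partial>LP) = (\<Sum>n. ennreal ((r * ?m) ^ n) / fact n)"
    by (simp add: nn_integral_LP[OF void_weight_measurable[OF B]] pow)
  also have "\<dots> = (\<Sum>n. ennreal ((r * ?m) ^ n / fact n))"
    using r by (intro suminf_cong) (simp only: ennreal_fact, intro divide_ennreal, simp_all)
  also have "\<dots> = ennreal (exp (r * ?m))"
  proof -
    have "(\<lambda>n. (r * ?m) ^ n / fact n) sums exp (r * ?m)"
      using exp_converges[of "r * ?m"] by (simp add: field_simps)
    then show ?thesis using r by (subst suminf_ennreal2) (auto simp: sums_iff)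
  qed
  finally show ?thesis .
qed

lemma nn_integral_LP_power:
  assumes "0 \<le> r" shows "(\<integral>\<^sup>+\<eta>. ennreal (r ^ card \<eta>) \<partial>LP) = ennreal (exp (r * measure lborel \<Lambda>))"
  using nn_integral_LP_void[of "{}" r] assms by simp

lemma finite_measure_LP: "finite_measure LP"
proof (rule finite_measureI)
  show "emeasure LP (space LP) \<noteq> \<infinity>"
    using nn_integral_LP_power[of 1] by simp
qed

sublocale LP: finite_measure LP by (rule finite_measure_LP)

end

section \<open>Null events, functions of exponential growth in the number of points, and the signed
  Mecke equation\<close>

context region
begin

text \<open>Mecke applied to the indicator of \<open>B\<close>: the integral of the number of points
  in \<open>B\<close> is the volume of \<open>B \<inter> \<Lambda>\<close> times the total mass,
  hence 0.\<close>

lemma AE_LP_disjoint: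
  assumes [measurable]: "B \<in> sets borel" and "emeasure lborel B = 0"
  shows "AE \<eta> in LP. \<eta> \<inter> B = {}"
proof -
  have m: "(\<lambda>p. (\<lambda>x (_ :: 'a set). indicator B x :: ennreal) (fst p) (snd p)) \<in> borel_measurable (L \<Otimes>\<^sub>M CS)"
    using measurable_compose[OF measurable_compose[OF measurable_fst id_L_borel] borel_measurable_indicator[OF assms(1)]]
    by simp
  have "emeasure L (B \<inter> \<Lambda>) = 0"
    using assms region_borel
    by (subst emeasure_restrict_space) (auto intro: emeasure_eq_0[of B lborel])
  then have "(\<integral>\<^sup>+x. indicator B x \<partial>L) = 0"
  proof -
    have "(\<integral>\<^sup>+x. indicator B x \<partial>L) = (\<integral>\<^sup>+x. indicator (B \<inter> \<Lambda>) x \<partial>L)"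
      by (rule nn_integral_cong) (auto simp: indicator_def)
    also have "\<dots> = emeasure L (B \<inter> \<Lambda>)"
      using assms region_borel by (intro nn_integral_indicator) (auto simp: sets_L_eq)
    finally show ?thesis using \<open>emeasure L (B \<inter> \<Lambda>) = 0\<close> by simp
  qed
  moreover have "(\<integral>\<^sup>+x. indicator B x * emeasure LP (space LP) \<partial>L) = (\<integral>\<^sup>+x. indicator B x \<partial>L) * emeasure LP (space LP)"
    by (rule nn_integral_multc) measurable
  ultimately have "(\<integral>\<^sup>+\<eta>. (\<Sum>x\<in>\<eta>. indicator B x) \<partial>LP) = 0"
    using mecke_nn[OF m] by simp
  then have "AE \<eta> in LP. (\<Sum>x\<in>\<eta>. indicator B x :: ennreal) = 0"
    using measurable_sum_remove[OF m] by (subst (asm) nn_integral_0_iff_AE) auto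
  then show ?thesis using AE_space
    by eventually_elim (auto simp: configs_def indicator_def split: if_splits)
qed

lemma AE_LP_notin: "AE \<eta> in LP. x \<notin> \<eta>"
  using AE_LP_disjoint[of "{x}"] by (auto elim: eventually_mono)

text \<open>An integrability class that can be checked syntactically: it contains Gibbs weights and
  bounded measurable functions, is closed under sums and products, and is integrable by the
  exponential moments of \<open>card\<close>.\<close>

definition tame :: "('a set \<Rightarrow> real) \<Rightarrow> bool" where
  "tame h \<longleftrightarrow> h \<in> borel_measurable CS \<and>
     (\<exists>K r. 0 \<le> K \<and> 1 \<le> r \<and> (\<forall>\<eta>\<in>configs \<Lambda>. \<bar>h \<eta>\<bar> \<le> K * r ^ card \<eta>))"

text \<open>The growth bound is uniform in \<open>x\<close>, so integrating out the configuration
  leaves a bounded function on \<open>\<Lambda>\<close>.\<close>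

definition tame2 :: "('a \<Rightarrow> 'a set \<Rightarrow> real) \<Rightarrow> bool" where
  "tame2 F \<longleftrightarrow> (\<lambda>p. F (fst p) (snd p)) \<in> borel_measurable (L \<Otimes>\<^sub>M CS) \<and>
     (\<exists>K r. 0 \<le> K \<and> 1 \<le> r \<and> (\<forall>x\<in>\<Lambda>. \<forall>\<eta>\<in>configs \<Lambda>. \<bar>F x \<eta>\<bar> \<le> K * r ^ card \<eta>))"

lemma tameI:
  assumes "h \<in> borel_measurable CS" "0 \<le> K" "1 \<le> r" "\<And>\<eta>. \<eta> \<in> configs \<Lambda> \<Longrightarrow> \<bar>h \<eta>\<bar> \<le> K * r ^ card \<eta>"
  shows "tame h" using assms unfolding tame_def by blast

lemma tame2I:
  assumes "(\<lambda>p. F (fst p) (snd p)) \<in> borel_measurable (L \<Otimes>\<^sub>M CS)" "0 \<le> K" "1 \<le> r"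
    "\<And>x \<eta>. x \<in> \<Lambda> \<Longrightarrow> \<eta> \<in> configs \<Lambda> \<Longrightarrow> \<bar>F x \<eta>\<bar> \<le> K * r ^ card \<eta>"
  shows "tame2 F" using assms unfolding tame2_def by blast

lemma tameE:
  assumes "tame h"
  obtains K r where "h \<in> borel_measurable CS" "0 \<le> K" "1 \<le> r" "\<And>\<eta>. \<eta> \<in> configs \<Lambda> \<Longrightarrow> \<bar>h \<eta>\<bar> \<le> K * r ^ card \<eta>"
  using assms unfolding tame_def by blast

lemma tame2E:
  assumes "tame2 F"
  obtains K r where "(\<lambda>p. F (fst p) (snd p)) \<in> borel_measurable (L \<Otimes>\<^sub>M CS)" "0 \<le> K" "1 \<le> r"
    "\<And>x \<eta>. x \<in> \<Lambda> \<Longrightarrow> \<eta> \<in> configs \<Lambda> \<Longrightarrow> \<bar>F x \<eta>\<bar> \<le> K * r ^ card \<eta>"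
  using assms unfolding tame2_def by blast

lemma tame_measurable: "tame h \<Longrightarrow> h \<in> borel_measurable CS"
  by (simp add: tame_def)

lemma tame2_measurable: "tame2 F \<Longrightarrow> (\<lambda>p. F (fst p) (snd p)) \<in> borel_measurable (L \<Otimes>\<^sub>M CS)"
  by (simp add: tame2_def)

lemma tame_bounded:
  assumes "h \<in> borel_measurable CS" "\<And>\<eta>. \<eta> \<in> configs \<Lambda> \<Longrightarrow> \<bar>h \<eta>\<bar> \<le> K"
  shows "tame h"
  \<comment> \<open>The bound at the empty configuration shows that \<open>K\<close> is
    nonnegative.\<close>
  by (rule tameI[of h K 1]) (use assms order_trans[OF abs_ge_zero assms(2)[OF empty_config]] in auto)

lemma tame_const: "tame (\<lambda>_. a)"
  by (rule tame_bounded[of _ "\<bar>a\<bar>"]) auto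

lemma tame_card: "tame (\<lambda>\<eta>. real (card \<eta>))"
proof (rule tameI[of _ 1 2])
  have "real n \<le> 2 ^ n" for n using of_nat_less_two_power[of n, where 'a=real] by simp
  then show "\<bar>real (card \<eta>)\<bar> \<le> 1 * 2 ^ card \<eta>" for \<eta> :: "'a set" by simp
qed measurable

lemma growth_add:
  fixes K r K' r' :: real
  assumes "0 \<le> K" "1 \<le> r" "0 \<le> K'" "1 \<le> r'" "\<bar>a\<bar> \<le> K * r ^ n" "\<bar>b\<bar> \<le> K' * r' ^ n"
  shows "\<bar>a + b\<bar> \<le> (K + K') * (r * r') ^ n"
proof -
  have "1 \<le> r ^ n" "1 \<le> r' ^ n" using assms by (auto simp: one_le_power)
  then have "r ^ n \<le> r ^ n * r' ^ n" "r' ^ n \<le> r ^ n * r' ^ n"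
    by (auto intro: mult_left_mono[of 1 "r' ^ n" "r ^ n", simplified] mult_right_mono[of 1 "r ^ n" "r' ^ n", simplified])
  then have "K * r ^ n \<le> K * (r * r') ^ n" "K' * r' ^ n \<le> K' * (r * r') ^ n"
    using assms by (auto simp: power_mult_distrib intro: mult_left_mono)
  then show ?thesis using assms by (simp add: distrib_right)
qed

lemma growth_mult:
  fixes K r K' r' :: real
  assumes "0 \<le> K" "1 \<le> r" "0 \<le> K'" "1 \<le> r'" "\<bar>a\<bar> \<le> K * r ^ n" "\<bar>b\<bar> \<le> K' * r' ^ n"
  shows "\<bar>a * b\<bar> \<le> (K * K') * (r * r') ^ n"
proof -
  have "\<bar>a\<bar> * \<bar>b\<bar> \<le> (K * r ^ n) * (K' * r' ^ n)" using assms by (intro mult_mono) auto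
  then show ?thesis by (simp add: abs_mult power_mult_distrib mult_ac)
qed

lemma one_le_mult: "1 \<le> (r::real) \<Longrightarrow> 1 \<le> r' \<Longrightarrow> 1 \<le> r * r'"
  using mult_mono[of 1 r 1 r'] by simp

lemma tame_add: assumes "tame h" "tame k" shows "tame (\<lambda>\<eta>. h \<eta> + k \<eta>)"
  using assms(1)
proof (rule tameE)
  fix K r assume 1: "h \<in> borel_measurable CS" "0 \<le> K" "1 \<le> r" "\<And>\<eta>. \<eta> \<in> configs \<Lambda> \<Longrightarrow> \<bar>h \<eta>\<bar> \<le> K * r ^ card \<eta>"
  from assms(2) show ?thesis
  proof (rule tameE)
    fix K' r' assume 2: "k \<in> borel_measurable CS" "0 \<le> K'" "1 \<le> r'" "\<And>\<eta>. \<eta> \<in> configs \<Lambda> \<Longrightarrow> \<bar>k \<eta>\<bar> \<le> K' * r' ^ card \<eta>"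
    show ?thesis using 1 2 by (intro tameI[of _ "K + K'" "r * r'"] growth_add one_le_mult) auto
  qed
qed

lemma tame_mult: assumes "tame h" "tame k" shows "tame (\<lambda>\<eta>. h \<eta> * k \<eta>)"
  using assms(1)
proof (rule tameE)
  fix K r assume 1: "h \<in> borel_measurable CS" "0 \<le> K" "1 \<le> r" "\<And>\<eta>. \<eta> \<in> configs \<Lambda> \<Longrightarrow> \<bar>h \<eta>\<bar> \<le> K * r ^ card \<eta>"
  from assms(2) show ?thesis
  proof (rule tameE)
    fix K' r' assume 2: "k \<in> borel_measurable CS" "0 \<le> K'" "1 \<le> r'" "\<And>\<eta>. \<eta> \<in> configs \<Lambda> \<Longrightarrow> \<bar>k \<eta>\<bar> \<le> K' * r' ^ card \<eta>"
    show ?thesis using 1 2 by (intro tameI[of _ "K * K'" "r * r'"] growth_mult one_le_mult) auto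
  qed
qed

lemma tame_uminus: "tame h \<Longrightarrow> tame (\<lambda>\<eta>. - h \<eta>)"
  using tame_mult[OF tame_const[of "-1"], of h] by simp

lemma tame_diff: "tame h \<Longrightarrow> tame k \<Longrightarrow> tame (\<lambda>\<eta>. h \<eta> - k \<eta>)"
  using tame_add[OF _ tame_uminus, of h k] by simp

lemma tame_power2: "tame h \<Longrightarrow> tame (\<lambda>\<eta>. (h \<eta>)\<^sup>2)"
  unfolding power2_eq_square by (rule tame_mult)

lemma tame2_add: assumes "tame2 h" "tame2 k" shows "tame2 (\<lambda>x \<eta>. h x \<eta> + k x \<eta>)"
  using assms(1)
proof (rule tame2E)
  fix K r assume 1: "(\<lambda>p. h (fst p) (snd p)) \<in> borel_measurable (L \<Otimes>\<^sub>M CS)" "0 \<le> K" "1 \<le> r"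
    "\<And>x \<eta>. x \<in> \<Lambda> \<Longrightarrow> \<eta> \<in> configs \<Lambda> \<Longrightarrow> \<bar>h x \<eta>\<bar> \<le> K * r ^ card \<eta>"
  from assms(2) show ?thesis
  proof (rule tame2E)
    fix K' r' assume 2: "(\<lambda>p. k (fst p) (snd p)) \<in> borel_measurable (L \<Otimes>\<^sub>M CS)" "0 \<le> K'" "1 \<le> r'"
      "\<And>x \<eta>. x \<in> \<Lambda> \<Longrightarrow> \<eta> \<in> configs \<Lambda> \<Longrightarrow> \<bar>k x \<eta>\<bar> \<le> K' * r' ^ card \<eta>"
    show ?thesis using 1 2 by (intro tame2I[of _ "K + K'" "r * r'"] growth_add one_le_mult) auto
  qed
qed

lemma tame2_mult: assumes "tame2 h" "tame2 k" shows "tame2 (\<lambda>x \<eta>. h x \<eta> * k x \<eta>)"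
  using assms(1)
proof (rule tame2E)
  fix K r assume 1: "(\<lambda>p. h (fst p) (snd p)) \<in> borel_measurable (L \<Otimes>\<^sub>M CS)" "0 \<le> K" "1 \<le> r"
    "\<And>x \<eta>. x \<in> \<Lambda> \<Longrightarrow> \<eta> \<in> configs \<Lambda> \<Longrightarrow> \<bar>h x \<eta>\<bar> \<le> K * r ^ card \<eta>"
  from assms(2) show ?thesis
  proof (rule tame2E)
    fix K' r' assume 2: "(\<lambda>p. k (fst p) (snd p)) \<in> borel_measurable (L \<Otimes>\<^sub>M CS)" "0 \<le> K'" "1 \<le> r'"
      "\<And>x \<eta>. x \<in> \<Lambda> \<Longrightarrow> \<eta> \<in> configs \<Lambda> \<Longrightarrow> \<bar>k x \<eta>\<bar> \<le> K' * r' ^ card \<eta>"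
    show ?thesis using 1 2 by (intro tame2I[of _ "K * K'" "r * r'"] growth_mult one_le_mult) auto
  qed
qed

lemma tame2_fun:
  assumes "g \<in> borel_measurable L" "\<And>x. x \<in> \<Lambda> \<Longrightarrow> \<bar>g x\<bar> \<le> K"
  shows "tame2 (\<lambda>x _. g x)"
  using assms by (intro tame2I[of _ "max 0 K" 1]) (auto simp: max.coboundedI2 intro: measurable_compose[OF measurable_fst])

lemma tame2_config: assumes "tame h" shows "tame2 (\<lambda>_. h)"
  using assms by (rule tameE) (intro tame2I, auto intro: measurable_compose[OF measurable_snd])

lemma tame2_const: "tame2 (\<lambda>_ _. a)"
  by (rule tame2_config[OF tame_const])

lemma tame2_diff: assumes "tame2 h" "tame2 k" shows "tame2 (\<lambda>x \<eta>. h x \<eta> - k x \<eta>)"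
  using tame2_add[OF assms(1) tame2_mult[OF tame2_const[of "-1"] assms(2)]] by simp

lemma tame2_power2: "tame2 h \<Longrightarrow> tame2 (\<lambda>x \<eta>. (h x \<eta>)\<^sup>2)"
  unfolding power2_eq_square by (rule tame2_mult)

lemma tame2_insert: assumes "tame h" shows "tame2 (\<lambda>x \<eta>. h (insert x \<eta>))"
  using assms
proof (rule tameE)
  fix K r assume 1: "h \<in> borel_measurable CS" "0 \<le> K" "1 \<le> r" "\<And>\<eta>. \<eta> \<in> configs \<Lambda> \<Longrightarrow> \<bar>h \<eta>\<bar> \<le> K * r ^ card \<eta>"
  show ?thesis
  proof (rule tame2I[of _ "K * r" r])
    have "(\<lambda>p. insert (fst p) (snd p)) \<in> measurable (L \<Otimes>\<^sub>M CS) CS" by measurable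
    then show "(\<lambda>p. h (insert (fst p) (snd p))) \<in> borel_measurable (L \<Otimes>\<^sub>M CS)"
      using 1(1) by (rule measurable_compose)
    fix x \<eta> assume x: "x \<in> \<Lambda>" "\<eta> \<in> configs \<Lambda>"
    have "card (insert x \<eta>) \<le> Suc (card \<eta>)" by (rule card_insert_le_m1) auto
    then have "r ^ card (insert x \<eta>) \<le> r * r ^ card \<eta>"
      using 1(3) power_increasing[of "card (insert x \<eta>)" "Suc (card \<eta>)" r] by simp
    then have "K * r ^ card (insert x \<eta>) \<le> K * (r * r ^ card \<eta>)" using 1(2) by (rule mult_left_mono)
    then show "\<bar>h (insert x \<eta>)\<bar> \<le> K * r * r ^ card \<eta>"
      using 1(4)[OF configs_insert[OF x(2,1)]] by (simp add: mult.assoc)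
  qed (use 1 in auto)
qed

lemma tame2_section: assumes "tame2 F" "x \<in> \<Lambda>" shows "tame (F x)"
  using assms(1)
proof (rule tame2E)
  fix K r assume 1: "(\<lambda>p. F (fst p) (snd p)) \<in> borel_measurable (L \<Otimes>\<^sub>M CS)" "0 \<le> K" "1 \<le> r"
    "\<And>x \<eta>. x \<in> \<Lambda> \<Longrightarrow> \<eta> \<in> configs \<Lambda> \<Longrightarrow> \<bar>F x \<eta>\<bar> \<le> K * r ^ card \<eta>"
  have "F x \<in> borel_measurable CS"
    by (rule measurable_section[OF 1(1)]) (simp add: assms)
  then show ?thesis using 1(2,3) 1(4)[OF assms(2)] by (rule tameI)
qed

lemmas tame_intros = tame_const tame_card tame_add tame_mult tame_diff tame_uminus tame_power2
  tame2_const tame2_add tame2_mult tame2_diff tame2_power2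

lemma tame_integrable: assumes "tame h" shows "integrable LP h"
  using assms
proof (rule tameE)
  fix K r assume 1: "h \<in> borel_measurable CS" "0 \<le> K" "1 \<le> r" "\<And>\<eta>. \<eta> \<in> configs \<Lambda> \<Longrightarrow> \<bar>h \<eta>\<bar> \<le> K * r ^ card \<eta>"
  have "integrable LP (\<lambda>\<eta>. r ^ card \<eta>)"
    using 1 nn_integral_LP_power[of r]
    by (intro integrableI_nonneg) (auto simp del: ennreal_power)
  then have "integrable LP (\<lambda>\<eta>. K * r ^ card \<eta>)" by simp
  then show ?thesis
    by (rule Bochner_Integration.integrable_bound) (use 1 in \<open>auto intro!: AE_I2 simp: abs_mult\<close>)
qed

lemma tame_sum_remove: assumes "tame2 F" shows "tame (\<lambda>\<eta>. \<Sum>x\<in>\<eta>. F x (\<eta> - {x}))"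
  using assms
proof (rule tame2E)
  fix K r assume 1: "(\<lambda>p. F (fst p) (snd p)) \<in> borel_measurable (L \<Otimes>\<^sub>M CS)" "0 \<le> K" "1 \<le> r"
    "\<And>x \<eta>. x \<in> \<Lambda> \<Longrightarrow> \<eta> \<in> configs \<Lambda> \<Longrightarrow> \<bar>F x \<eta>\<bar> \<le> K * r ^ card \<eta>"
  \<comment> \<open>The additional factor 2 per point pays for the number of summands, since
    \<open>card \<eta> \<le> 2 ^ card \<eta>\<close>.\<close>
  show ?thesis
  proof (rule tameI[of _ K "2 * r"])
    have "(\<lambda>p. (snd p, fst p - {snd p})) \<in> measurable (CS \<Otimes>\<^sub>M L) (L \<Otimes>\<^sub>M CS)" by measurable
    from measurable_compose[OF this 1(1)]
    show "(\<lambda>\<eta>. \<Sum>x\<in>\<eta>. F x (\<eta> - {x})) \<in> borel_measurable CS"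
      by (intro measurable_sum_config) simp_all
    fix \<eta> assume \<eta>: "\<eta> \<in> configs \<Lambda>"
    have "\<bar>\<Sum>x\<in>\<eta>. F x (\<eta> - {x})\<bar> \<le> (\<Sum>x\<in>\<eta>. \<bar>F x (\<eta> - {x})\<bar>)" by (rule sum_abs)
    also have "\<dots> \<le> (\<Sum>x\<in>\<eta>. K * r ^ card \<eta>)"
    proof (rule sum_mono)
      fix x assume x: "x \<in> \<eta>"
      have "\<bar>F x (\<eta> - {x})\<bar> \<le> K * r ^ card (\<eta> - {x})"
        using \<eta> x configs_remove[OF \<eta>] by (intro 1(4)) (auto simp: configs_def)
      also have "\<dots> \<le> K * r ^ card \<eta>"
        using 1 \<eta> by (intro mult_left_mono power_increasing card_mono) (auto simp: configs_def)
      finally show "\<bar>F x (\<eta> - {x})\<bar> \<le> K * r ^ card \<eta>" .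
    qed
    also have "\<dots> = real (card \<eta>) * (K * r ^ card \<eta>)" by simp
    also have "\<dots> \<le> 2 ^ card \<eta> * (K * r ^ card \<eta>)"
      using 1 of_nat_less_two_power[of "card \<eta>", where 'a=real] by (intro mult_right_mono) auto
    finally show "\<bar>\<Sum>x\<in>\<eta>. F x (\<eta> - {x})\<bar> \<le> K * (2 * r) ^ card \<eta>"
      by (simp add: power_mult_distrib mult_ac)
  qed (use 1 in auto)
qed

lemma tame2_integral_measurable:
  assumes "tame2 F" shows "(\<lambda>x. \<integral>\<eta>. F x \<eta> \<partial>LP) \<in> borel_measurable L"
  using tame2_measurable[OF assms]
  by (intro LP.borel_measurable_lebesgue_integral) (simp add: split_beta cong: measurable_cong_sets)

lemma tame2_integral_bound:
  assumes "tame2 F" obtains B where "\<And>x. x \<in> \<Lambda> \<Longrightarrow> \<bar>\<integral>\<eta>. F x \<eta> \<partial>LP\<bar> \<le> B"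
  using assms
proof (rule tame2E)
  fix K r assume 1: "(\<lambda>p. F (fst p) (snd p)) \<in> borel_measurable (L \<Otimes>\<^sub>M CS)" "0 \<le> K" "1 \<le> r"
    "\<And>x \<eta>. x \<in> \<Lambda> \<Longrightarrow> \<eta> \<in> configs \<Lambda> \<Longrightarrow> \<bar>F x \<eta>\<bar> \<le> K * r ^ card \<eta>"
  have i: "integrable LP (\<lambda>\<eta>. K * r ^ card \<eta>)"
    using 1 by (intro tame_integrable tameI[of _ K r]) (auto simp: abs_mult)
  show ?thesis
  proof (rule that[of "\<integral>\<eta>. K * r ^ card \<eta> \<partial>LP"])
    fix x assume x: "x \<in> \<Lambda>"
    have "\<bar>\<integral>\<eta>. F x \<eta> \<partial>LP\<bar> \<le> (\<integral>\<eta>. \<bar>F x \<eta>\<bar> \<partial>LP)" by (rule integral_abs_bound)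
    also have "\<dots> \<le> (\<integral>\<eta>. K * r ^ card \<eta> \<partial>LP)"
      using tame_integrable[OF tame2_section[OF assms x]] i 1(4) x by (intro integral_mono) auto
    finally show "\<bar>\<integral>\<eta>. F x \<eta> \<partial>LP\<bar> \<le> (\<integral>\<eta>. K * r ^ card \<eta> \<partial>LP)" .
  qed
qed

lemma integrable_L_bounded:
  fixes g :: "'a \<Rightarrow> real"
  assumes "g \<in> borel_measurable L" "\<And>x. x \<in> \<Lambda> \<Longrightarrow> \<bar>g x\<bar> \<le> B"
  shows "integrable L g"
  using assms by (intro L.integrable_const_bound[of _ B]) auto

lemma tame2_integrable: assumes "tame2 F" shows "integrable L (\<lambda>x. \<integral>\<eta>. F x \<eta> \<partial>LP)"
  using assms by (rule tame2_integral_bound) (intro integrable_L_bounded tame2_integral_measurable assms)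

lemma mecke_nonneg:
  assumes F: "tame2 F" and pos: "\<And>x \<eta>. 0 \<le> F x \<eta>"
  shows "(\<integral>\<eta>. (\<Sum>x\<in>\<eta>. F x (\<eta> - {x})) \<partial>LP) = (\<integral>x. (\<integral>\<eta>. F x \<eta> \<partial>LP) \<partial>L)"
proof -
  have m: "(\<lambda>p. ennreal (F (fst p) (snd p))) \<in> borel_measurable (L \<Otimes>\<^sub>M CS)"
    using tame2_measurable[OF F] by simp
  have "(\<integral>\<eta>. (\<Sum>x\<in>\<eta>. F x (\<eta> - {x})) \<partial>LP) = enn2real (\<integral>\<^sup>+\<eta>. ennreal (\<Sum>x\<in>\<eta>. F x (\<eta> - {x})) \<partial>LP)"
    using tame_measurable[OF tame_sum_remove[OF F]] pos
    by (intro integral_eq_nn_integral) (auto simp: sum_nonneg cong: measurable_cong_sets)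
  also have "(\<integral>\<^sup>+\<eta>. ennreal (\<Sum>x\<in>\<eta>. F x (\<eta> - {x})) \<partial>LP) = (\<integral>\<^sup>+x. (\<integral>\<^sup>+\<eta>. ennreal (F x \<eta>) \<partial>LP) \<partial>L)"
    using mecke_nn[of "\<lambda>x \<eta>. ennreal (F x \<eta>)", OF m] pos by (simp add: sum_ennreal)
  also have "\<dots> = (\<integral>\<^sup>+x. ennreal (\<integral>\<eta>. F x \<eta> \<partial>LP) \<partial>L)"
    using tame_integrable[OF tame2_section[OF F]] pos
    by (intro nn_integral_cong nn_integral_eq_integral) auto
  also have "enn2real \<dots> = (\<integral>x. (\<integral>\<eta>. F x \<eta> \<partial>LP) \<partial>L)"
    using tame2_integral_measurable[OF F] pos by (intro integral_eq_nn_integral[symmetric]) auto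
  finally show ?thesis .
qed

lemma tame2_max0: assumes "tame2 F" shows "tame2 (\<lambda>x \<eta>. max 0 (F x \<eta>))"
  using assms
proof (rule tame2E)
  fix K r assume 1: "(\<lambda>p. F (fst p) (snd p)) \<in> borel_measurable (L \<Otimes>\<^sub>M CS)" "0 \<le> K" "1 \<le> r"
    "\<And>x \<eta>. x \<in> \<Lambda> \<Longrightarrow> \<eta> \<in> configs \<Lambda> \<Longrightarrow> \<bar>F x \<eta>\<bar> \<le> K * r ^ card \<eta>"
  show ?thesis
  proof (rule tame2I[of _ K r])
    fix x \<eta> assume "x \<in> \<Lambda>" "\<eta> \<in> configs \<Lambda>"
    then show "\<bar>max 0 (F x \<eta>)\<bar> \<le> K * r ^ card \<eta>" using 1(4)[of x \<eta>] by auto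
  qed (use 1(1-3) in auto)
qed

text \<open>The positive and negative parts of a tame integrand are tame again, so both sides are
  differences of finite integrals.\<close>

lemma mecke:
  assumes F: "tame2 F"
  shows "(\<integral>\<eta>. (\<Sum>x\<in>\<eta>. F x (\<eta> - {x})) \<partial>LP) = (\<integral>x. (\<integral>\<eta>. F x \<eta> \<partial>LP) \<partial>L)"
proof -
  let ?P = "\<lambda>x \<eta>. max 0 (F x \<eta>)" and ?N = "\<lambda>x \<eta>. max 0 (- F x \<eta>)"
  have P: "tame2 ?P" by (rule tame2_max0[OF F])
  have N: "tame2 ?N" using tame2_max0[OF tame2_diff[OF tame2_const[of 0] F]] by simp
  have eq: "F x \<eta> = ?P x \<eta> - ?N x \<eta>" for x \<eta> by auto
  have "(\<integral>\<eta>. (\<Sum>x\<in>\<eta>. F x (\<eta> - {x})) \<partial>LP)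
      = (\<integral>\<eta>. (\<Sum>x\<in>\<eta>. ?P x (\<eta> - {x})) - (\<Sum>x\<in>\<eta>. ?N x (\<eta> - {x})) \<partial>LP)"
    unfolding sum_subtractf[symmetric] by (intro Bochner_Integration.integral_cong refl sum.cong eq)
  also have "\<dots> = (\<integral>\<eta>. (\<Sum>x\<in>\<eta>. ?P x (\<eta> - {x})) \<partial>LP) - (\<integral>\<eta>. (\<Sum>x\<in>\<eta>. ?N x (\<eta> - {x})) \<partial>LP)"
    by (rule Bochner_Integration.integral_diff[OF tame_integrable[OF tame_sum_remove[OF P]] tame_integrable[OF tame_sum_remove[OF N]]])
  also have "\<dots> = (\<integral>x. (\<integral>\<eta>. ?P x \<eta> \<partial>LP) \<partial>L) - (\<integral>x. (\<integral>\<eta>. ?N x \<eta> \<partial>LP) \<partial>L)"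
    by (simp only: mecke_nonneg[OF P max.cobounded1] mecke_nonneg[OF N max.cobounded1])
  also have "\<dots> = (\<integral>x. (\<integral>\<eta>. ?P x \<eta> \<partial>LP) - (\<integral>\<eta>. ?N x \<eta> \<partial>LP) \<partial>L)"
    by (rule Bochner_Integration.integral_diff[symmetric, OF tame2_integrable[OF P] tame2_integrable[OF N]])
  also have "\<dots> = (\<integral>x. (\<integral>\<eta>. F x \<eta> \<partial>LP) \<partial>L)"
  proof (rule Bochner_Integration.integral_cong[OF refl])
    fix x assume "x \<in> space L"
    then have "(\<integral>\<eta>. ?P x \<eta> \<partial>LP) - (\<integral>\<eta>. ?N x \<eta> \<partial>LP) = (\<integral>\<eta>. ?P x \<eta> - ?N x \<eta> \<partial>LP)"
      using tame_integrable[OF tame2_section[OF P]] tame_integrable[OF tame2_section[OF N]]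
      by (intro Bochner_Integration.integral_diff[symmetric]) auto
    then show "(\<integral>\<eta>. ?P x \<eta> \<partial>LP) - (\<integral>\<eta>. ?N x \<eta> \<partial>LP) = (\<integral>\<eta>. F x \<eta> \<partial>LP)"
      by (simp only: eq[symmetric])
  qed
  finally show ?thesis .
qed

end

section \<open>Gibbs measures\<close>

lemma exp_neg_zero [simp]: "exp_neg 0 = 1"
  by (simp add: exp_neg_def)

lemma exp_neg_bounds: "0 \<le> exp_neg r" "exp_neg r \<le> 1"
  by (auto simp: exp_neg_def)

lemma exp_neg_add: "exp_neg (a + b) = exp_neg a * exp_neg b"
  by (cases a; cases b) (auto simp: exp_neg_def exp_add[symmetric] ennreal_plus[symmetric] simp del: ennreal_plus)

lemma exp_neg_sum: "exp_neg (\<Sum>x\<in>A. g x) = (\<Prod>x\<in>A. exp_neg (g x))"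
  by (induction A rule: infinite_finite_induct) (auto simp: exp_neg_add)

lemma measurable_exp_neg [measurable]: "exp_neg \<in> borel_measurable borel"
  unfolding exp_neg_def[abs_def] by measurable

text \<open>This is the second component of \<open>pin \<phi> A ({}, lam)\<close>, detached from the
  set so that pinning can be iterated point by point.\<close>

definition pinned_act :: "('a \<Rightarrow> 'a \<Rightarrow> ennreal) \<Rightarrow> ('a \<Rightarrow> real) \<Rightarrow> 'a set \<Rightarrow> 'a \<Rightarrow> real" where
  "pinned_act \<phi> lam A = (\<lambda>y. lam y * exp_neg (\<Sum>x\<in>A. \<phi> x y))"

lemma pinned_act_insert:
  "finite A \<Longrightarrow> x \<notin> A \<Longrightarrow> pinned_act \<phi> lam (insert x A) = pinned_act \<phi> (pinned_act \<phi> lam A) {x}"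
  by (auto simp: pinned_act_def exp_neg_add mult_ac)

lemma pinned_act_empty [simp]: "pinned_act \<phi> lam {} = lam"
  by (simp add: pinned_act_def)

lemma energy_insert:
  assumes "finite \<eta>" "x \<notin> \<eta>" "\<And>x y. \<phi> x y = \<phi> y x"
  shows "energy \<phi> (insert x \<eta>) = energy \<phi> \<eta> + (\<Sum>y\<in>\<eta>. \<phi> x y)"
proof -
  have "(\<Sum>z\<in>insert x \<eta>. \<Sum>y\<in>insert x \<eta> - {z}. \<phi> z y)
      = (\<Sum>y\<in>\<eta>. \<phi> x y) + (\<Sum>z\<in>\<eta>. \<phi> z x + (\<Sum>y\<in>\<eta> - {z}. \<phi> z y))"
  proof -
    have "(\<Sum>y\<in>insert x \<eta> - {z}. \<phi> z y) = \<phi> z x + (\<Sum>y\<in>\<eta> - {z}. \<phi> z y)" if "z \<in> \<eta>" for z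
    proof -
      have "insert x \<eta> - {z} = insert x (\<eta> - {z})" using that assms by auto
      then show ?thesis using assms by simp
    qed
    moreover have "insert x \<eta> - {x} = \<eta>" using assms by auto
    ultimately show ?thesis using assms by simp
  qed
  \<comment> \<open>Every pair containing \<open>x\<close> occurs in both orders; the division by 2
    in \<open>energy\<close> undoes this.\<close>
  also have "\<dots> = (\<Sum>z\<in>\<eta>. \<Sum>y\<in>\<eta> - {z}. \<phi> z y) + 2 * (\<Sum>y\<in>\<eta>. \<phi> x y)"
    using assms(3) by (simp add: sum.distrib mult_2 ac_simps)
  finally show ?thesis
    unfolding energy_def by (simp add: add_divide_distrib_ennreal mult.commute[of 2] ennreal_mult_divide_eq)
qed

text \<open>The interaction of the new point with \<open>\<eta>\<close> factorises over
  \<open>\<eta>\<close> and is absorbed into the activity. This identity turns Mecke into the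
  Georgii-Nguyen-Zessin equation.\<close>

lemma gibbs_weight_insert:
  assumes "finite \<eta>" "x \<notin> \<eta>" "\<And>x y. \<phi> x y = \<phi> y x"
  shows "gibbs_weight \<phi> lam (insert x \<eta>) = lam x * gibbs_weight \<phi> (pinned_act \<phi> lam {x}) \<eta>"
  using assms
  by (simp add: gibbs_weight_def energy_insert exp_neg_add pinned_act_def prod.distrib exp_neg_sum)

locale gibbs_region = region \<Lambda> for \<Lambda> :: "'a::euclidean_space set" +
  fixes \<phi> :: "'a \<Rightarrow> 'a \<Rightarrow> ennreal"
  assumes potential: "repulsive_finite_range \<phi>"
begin

lemma phi_sym: "\<phi> x y = \<phi> y x"
  using potential by (simp add: repulsive_finite_range_def)

lemma phi_measurable: "(\<lambda>p. \<phi> (fst p) (snd p)) \<in> borel_measurable (borel \<Otimes>\<^sub>M borel)"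
  using potential unfolding repulsive_finite_range_def by (simp only: case_prod_beta')

lemma phi_measurable' [measurable (raw)]:
  assumes "f \<in> borel_measurable Q" "g \<in> borel_measurable Q"
  shows "(\<lambda>q. \<phi> (f q) (g q)) \<in> borel_measurable Q"
  using measurable_compose[OF measurable_Pair[OF assms] phi_measurable] by simp

abbreviation "gw \<equiv> gibbs_weight \<phi>"
abbreviation "Z \<equiv> partition_function \<phi> \<Lambda>"
abbreviation "\<iota> \<equiv> one_point_density \<phi> \<Lambda>"
abbreviation "act \<equiv> activities \<Lambda>"
abbreviation "pact \<equiv> pinned_act \<phi>"

lemma measurable_L_iff: "lam \<in> borel_measurable (restrict_space borel \<Lambda>) \<longleftrightarrow> lam \<in> borel_measurable L"
  by (simp add: measurable_cong_sets[OF sets_L refl])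

lemma act_measurable: "lam \<in> act c \<Longrightarrow> lam \<in> borel_measurable L"
  by (simp add: activities_def measurable_L_iff)

lemma actD: "lam \<in> act c \<Longrightarrow> x \<in> \<Lambda> \<Longrightarrow> 0 \<le> lam x" "lam \<in> act c \<Longrightarrow> x \<in> \<Lambda> \<Longrightarrow> lam x \<le> c"
  by (auto simp: activities_def)

lemma actI:
  "lam \<in> borel_measurable L \<Longrightarrow> (\<And>x. x \<in> \<Lambda> \<Longrightarrow> 0 \<le> lam x) \<Longrightarrow> (\<And>x. x \<in> \<Lambda> \<Longrightarrow> lam x \<le> c) \<Longrightarrow> lam \<in> act c"
  by (simp add: activities_def measurable_L_iff)

lemma sum_phi_measurable:
  assumes "\<xi> \<in> measurable Q CS" and [measurable]: "y \<in> measurable Q L"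
  shows "(\<lambda>q. \<Sum>x\<in>\<xi> q. \<phi> x (y q)) \<in> borel_measurable Q"
proof (rule measurable_sum_config_ennreal[OF assms(1)])
  have "(\<lambda>p. snd p) \<in> measurable (Q \<Otimes>\<^sub>M L) borel" "(\<lambda>p. y (fst p)) \<in> measurable (Q \<Otimes>\<^sub>M L) borel"
    by (rule measurable_compose[OF _ id_L_borel], measurable)+
  then show "(\<lambda>p. \<phi> (snd p) (y (fst p))) \<in> borel_measurable (Q \<Otimes>\<^sub>M L)"
    by (rule phi_measurable')
qed

lemma pact_act: assumes "lam \<in> act c" "A \<in> configs \<Lambda>" shows "pact lam A \<in> act c"
proof (rule actI)
  have "(\<lambda>y. \<Sum>x\<in>A. \<phi> x y) \<in> borel_measurable L"
    using assms(2) by (intro sum_phi_measurable[where y="\<lambda>y. y"]) auto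
  then have "(\<lambda>y. exp_neg (\<Sum>x\<in>A. \<phi> x y)) \<in> borel_measurable L" by measurable
  then show "pact lam A \<in> borel_measurable L"
    unfolding pinned_act_def using act_measurable[OF assms(1)] by measurable
  fix x assume x: "x \<in> \<Lambda>"
  show "0 \<le> pact lam A x" using actD[OF assms(1) x] exp_neg_bounds by (simp add: pinned_act_def)
  have "lam x * exp_neg (\<Sum>y\<in>A. \<phi> y x) \<le> c * 1"
    using actD[OF assms(1) x] exp_neg_bounds by (intro mult_mono) auto
  then show "pact lam A x \<le> c" by (simp add: pinned_act_def)
qed

lemma singleton_config [simp]: "x \<in> \<Lambda> \<Longrightarrow> {x} \<in> configs \<Lambda>"
  by (simp add: configs_def)

lemma pact1_act: "lam \<in> act c \<Longrightarrow> x \<in> \<Lambda> \<Longrightarrow> pact lam {x} \<in> act c"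
  by (simp add: pact_act)

text \<open>The activity carries the parameter because it later varies with the time and with the
  random pinned set.\<close>

lemma weight_measurable:
  assumes \<xi>: "\<xi> \<in> measurable Q CS"
    and m: "(\<lambda>p. lam (fst p) (snd p)) \<in> borel_measurable (Q \<Otimes>\<^sub>M L)"
    and pos: "\<And>q x. q \<in> space Q \<Longrightarrow> x \<in> \<Lambda> \<Longrightarrow> 0 \<le> lam q x"
  shows "(\<lambda>q. gw (lam q) (\<xi> q)) \<in> borel_measurable Q"
proof -
  have [measurable]: "(\<lambda>q. \<Prod>x\<in>\<xi> q. lam q x) \<in> borel_measurable Q"
    by (rule measurable_prod_config[OF \<xi> m pos])
  have "(\<lambda>p. \<Sum>y\<in>\<xi> (fst p) - {snd p}. \<phi> y (snd p)) \<in> borel_measurable (Q \<Otimes>\<^sub>M L)"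
    by (intro sum_phi_measurable measurable_remove_config measurable_compose[OF measurable_fst \<xi>] measurable_snd)
  then have "(\<lambda>p. \<Sum>y\<in>\<xi> (fst p) - {snd p}. \<phi> (snd p) y) \<in> borel_measurable (Q \<Otimes>\<^sub>M L)"
    by (subst phi_sym)
  then have [measurable]: "(\<lambda>q. energy \<phi> (\<xi> q)) \<in> borel_measurable Q"
    unfolding energy_def
    by (intro borel_measurable_divide_ennreal measurable_sum_config_ennreal[OF \<xi>]) simp_all
  show ?thesis unfolding gibbs_weight_def by measurable
qed

lemma weight_nonneg: "lam \<in> act c \<Longrightarrow> \<eta> \<in> configs \<Lambda> \<Longrightarrow> 0 \<le> gw lam \<eta>"
  unfolding gibbs_weight_def
  by (intro mult_nonneg_nonneg prod_nonneg exp_neg_bounds) (auto simp: configs_def dest: actD)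

lemma weight_le: assumes "lam \<in> act c" "\<eta> \<in> configs \<Lambda>" shows "gw lam \<eta> \<le> c ^ card \<eta>"
proof -
  have "(\<Prod>x\<in>\<eta>. lam x) \<le> (\<Prod>x\<in>\<eta>. c)"
    using assms by (intro prod_mono) (auto simp: configs_def dest: actD)
  moreover have "0 \<le> (\<Prod>x\<in>\<eta>. lam x)"
    using assms by (intro prod_nonneg) (auto simp: configs_def dest: actD)
  ultimately have "(\<Prod>x\<in>\<eta>. lam x) * exp_neg (energy \<phi> \<eta>) \<le> c ^ card \<eta> * 1"
    using exp_neg_bounds by (intro mult_mono) auto
  then show ?thesis by (simp add: gibbs_weight_def)
qed

text \<open>On configurations \<open>0 ^ card \<eta>\<close> is the indicator of the empty one,
  whose Gibbs weight is 1. Integrated, this gives the lower bound 1 for the partition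
  function.\<close>

lemma weight_ge: assumes "lam \<in> act c" "\<eta> \<in> configs \<Lambda>" shows "0 ^ card \<eta> \<le> gw lam \<eta>"
proof (cases "\<eta> = {}")
  case True then show ?thesis by (simp add: gibbs_weight_def energy_def)
next
  case False
  then have "card \<eta> \<noteq> 0" using assms by (auto simp: configs_def)
  then show ?thesis using weight_nonneg[OF assms] by (simp add: power_0_left)
qed

lemma weight_measurable1: "lam \<in> act c \<Longrightarrow> gw lam \<in> borel_measurable CS"
  using act_measurable actD
  by (intro weight_measurable[where \<xi>="\<lambda>x. x" and lam="\<lambda>_. lam"])
    (auto intro: measurable_compose[OF measurable_snd])

lemma tame_weight: assumes "lam \<in> act c" shows "tame (gw lam)"
proof (rule tameI[of _ 1 "max 1 c"])
  fix \<eta> assume \<eta>: "\<eta> \<in> configs \<Lambda>"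
  have "c ^ card \<eta> \<le> max 1 c ^ card \<eta>"
  proof (cases "\<eta> = {}")
    case False
    then obtain x where "x \<in> \<Lambda>" using \<eta> by (auto simp: configs_def)
    then have "0 \<le> c" using actD[OF assms] by (meson order_trans)
    then show ?thesis by (intro power_mono) auto
  qed simp
  then show "\<bar>gw lam \<eta>\<bar> \<le> 1 * max 1 c ^ card \<eta>"
    using weight_nonneg[OF assms \<eta>] weight_le[OF assms \<eta>] by simp
qed (auto intro: weight_measurable1 assms)

lemma partition_ge_1: assumes "lam \<in> act c" shows "1 \<le> Z lam"
proof -
  have "(\<integral>\<eta>. 0 ^ card \<eta> \<partial>LP) = (1::real)"
    using nn_integral_LP_power[of 0] by (subst integral_eq_nn_integral) auto
  moreover have "(\<integral>\<eta>. 0 ^ card \<eta> \<partial>LP) \<le> Z lam"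
    unfolding partition_function_def
    using weight_ge[OF assms]
    by (intro integral_mono tame_integrable tame_weight[OF assms] tame_bounded[of _ 1])
      (auto simp: power_0_left)
  ultimately show ?thesis by simp
qed

lemma partition_pos: "lam \<in> act c \<Longrightarrow> 0 < Z lam"
  using partition_ge_1 by fastforce

text \<open>The Gibbs expectation written on the fixed measure \<open>LP\<close>, so that different
  activities, and their dependence on time, are compared under one integral.\<close>

definition Ex :: "('a \<Rightarrow> real) \<Rightarrow> ('a set \<Rightarrow> real) \<Rightarrow> real" where
  "Ex lam h = (\<integral>\<eta>. h \<eta> * gw lam \<eta> \<partial>LP) / Z lam"

lemma integral_gibbs:
  assumes "lam \<in> act c" "h \<in> borel_measurable CS"
  shows "(\<integral>\<eta>. h \<eta> \<partial>gibbs \<phi> \<Lambda> lam) = Ex lam h"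
proof -
  have "(\<integral>\<eta>. h \<eta> \<partial>gibbs \<phi> \<Lambda> lam) = (\<integral>\<eta>. (gw lam \<eta> / Z lam) *\<^sub>R h \<eta> \<partial>LP)"
    unfolding gibbs_def
    using assms weight_measurable1[OF assms(1)] weight_nonneg[OF assms(1)] partition_pos[OF assms(1)]
    by (intro integral_density) (auto cong: measurable_cong_sets intro!: AE_I2)
  also have "\<dots> = (\<integral>\<eta>. h \<eta> * gw lam \<eta> / Z lam \<partial>LP)" by (simp add: mult.commute)
  finally show ?thesis by (simp add: Ex_def)
qed

lemma Ex_add: "lam \<in> act c \<Longrightarrow> tame h \<Longrightarrow> tame k \<Longrightarrow> Ex lam (\<lambda>\<eta>. h \<eta> + k \<eta>) = Ex lam h + Ex lam k"
  unfolding Ex_def by (simp add: distrib_right tame_integrable tame_intros tame_weight add_divide_distrib)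

lemma Ex_diff: "lam \<in> act c \<Longrightarrow> tame h \<Longrightarrow> tame k \<Longrightarrow> Ex lam (\<lambda>\<eta>. h \<eta> - k \<eta>) = Ex lam h - Ex lam k"
  unfolding Ex_def by (simp add: left_diff_distrib tame_integrable tame_intros tame_weight diff_divide_distrib)

lemma Ex_cmult: "Ex lam (\<lambda>\<eta>. a * h \<eta>) = a * Ex lam h"
  unfolding Ex_def by (simp add: mult.assoc)

lemma Ex_const: "lam \<in> act c \<Longrightarrow> Ex lam (\<lambda>_. a) = a"
  unfolding Ex_def using partition_pos[of lam c] by (simp add: partition_function_def)

lemma Ex_cong: "(\<And>\<eta>. \<eta> \<in> configs \<Lambda> \<Longrightarrow> h \<eta> = k \<eta>) \<Longrightarrow> Ex lam h = Ex lam k"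
  unfolding Ex_def by (intro arg_cong2[where f="(/)"] Bochner_Integration.integral_cong) auto

lemma Ex_cong_AE:
  assumes "lam \<in> act c" "h \<in> borel_measurable CS" "k \<in> borel_measurable CS" "AE \<eta> in LP. h \<eta> = k \<eta>"
  shows "Ex lam h = Ex lam k"
  unfolding Ex_def using assms weight_measurable1[OF assms(1)]
  by (intro arg_cong2[where f="(/)"] integral_cong_AE) auto

lemma Ex_mono:
  assumes "lam \<in> act c" "tame h" "tame k" "\<And>\<eta>. \<eta> \<in> configs \<Lambda> \<Longrightarrow> h \<eta> \<le> k \<eta>"
  shows "Ex lam h \<le> Ex lam k"
  unfolding Ex_def
  using assms partition_pos[OF assms(1)] weight_nonneg[OF assms(1)]
  by (intro divide_right_mono integral_mono tame_integrable tame_mult tame_weight[OF assms(1)] mult_right_mono) auto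

lemma Ex_nonneg:
  assumes "lam \<in> act c" "tame h" "\<And>\<eta>. \<eta> \<in> configs \<Lambda> \<Longrightarrow> 0 \<le> h \<eta>"
  shows "0 \<le> Ex lam h"
  using Ex_mono[OF assms(1) tame_const[of 0] assms(2,3)] by (simp add: Ex_const[OF assms(1)])

lemma Ex_abs_le:
  assumes "lam \<in> act c" "tame h" "\<And>\<eta>. \<eta> \<in> configs \<Lambda> \<Longrightarrow> \<bar>h \<eta>\<bar> \<le> B"
  shows "\<bar>Ex lam h\<bar> \<le> B"
proof -
  have "Ex lam h \<le> B"
    using Ex_mono[OF assms(1,2) tame_const[of B]] assms(3) by (auto simp: Ex_const[OF assms(1)] abs_le_iff)
  moreover have "- B \<le> Ex lam h"
    using Ex_mono[OF assms(1) tame_const[of "-B"] assms(2)] assms(3) by (force simp: Ex_const[OF assms(1)] abs_le_iff)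
  ultimately show ?thesis by simp
qed

lemma weight_pact_le:
  assumes "lam \<in> act c" "\<eta> \<in> configs \<Lambda>" shows "gw (pact lam A) \<eta> \<le> gw lam \<eta>"
  unfolding gibbs_weight_def pinned_act_def
  using assms exp_neg_bounds
  by (intro mult_right_mono prod_mono) (auto simp: configs_def dest: actD intro!: mult_left_le)

lemma partition_pact_le:
  assumes "lam \<in> act c" "A \<in> configs \<Lambda>" shows "Z (pact lam A) \<le> Z lam"
  unfolding partition_function_def
  using assms weight_pact_le
  by (intro integral_mono tame_integrable tame_weight[OF assms(1)] tame_weight[OF pact_act[OF assms]]) auto

lemma iota_eq: "\<iota> lam x = lam x * Z (pact lam {x}) / Z lam"
  by (simp add: one_point_density_def pinned_act_def)

text \<open>Repulsion can only lower weights, so pinning does not increase the partition function.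
  The bound by \<open>c\<close> is what makes \<open>\<iota> lam x / c\<close> an acceptance
  probability.\<close>

lemma iota_bounds:
  assumes "lam \<in> act c" "x \<in> \<Lambda>" shows "0 \<le> \<iota> lam x" "\<iota> lam x \<le> lam x" "\<iota> lam x \<le> c"
proof -
  have p: "0 < Z lam" "0 < Z (pact lam {x})" "Z (pact lam {x}) \<le> Z lam"
    using partition_pos[OF assms(1)] partition_pos[OF pact1_act[OF assms]] partition_pact_le[of lam c "{x}"] assms by auto
  then show "0 \<le> \<iota> lam x" using actD[OF assms] by (simp add: iota_eq)
  have "lam x * Z (pact lam {x}) \<le> lam x * Z lam" using p actD[OF assms] by (intro mult_left_mono) auto
  then show "\<iota> lam x \<le> lam x" using p by (simp add: iota_eq field_simps)
  then show "\<iota> lam x \<le> c" using actD[OF assms] by simp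
qed

lemma weight_insert_tame2: "lam \<in> act c \<Longrightarrow> tame2 (\<lambda>x \<eta>. gw lam (insert x \<eta>))"
  by (intro tame2_insert tame_weight)

text \<open>Almost every configuration avoids the fixed point \<open>x\<close>, so the weight of
  \<open>insert x \<eta>\<close> factorises; normalising by the two partition functions produces the
  one-point density.\<close>

lemma integral_weight_insert:
  assumes lam: "lam \<in> act c" and x: "x \<in> \<Lambda>" and h: "h \<in> borel_measurable CS"
  shows "(\<integral>\<eta>. h \<eta> * gw lam (insert x \<eta>) \<partial>LP) / Z lam = \<iota> lam x * Ex (pact lam {x}) h"
proof -
  have "(\<integral>\<eta>. h \<eta> * gw lam (insert x \<eta>) \<partial>LP) = (\<integral>\<eta>. lam x * (h \<eta> * gw (pact lam {x}) \<eta>) \<partial>LP)"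
  proof (rule integral_cong_AE)
    show "AE \<eta> in LP. h \<eta> * gw lam (insert x \<eta>) = lam x * (h \<eta> * gw (pact lam {x}) \<eta>)"
      using AE_LP_notin[of x] AE_space
      by eventually_elim (auto simp: configs_def gibbs_weight_insert phi_sym)
  qed (use h tame_measurable[OF tame2_section[OF weight_insert_tame2[OF lam] x]]
        weight_measurable1[OF pact1_act[OF lam x]] in auto)
  also have "\<dots> = lam x * (\<integral>\<eta>. h \<eta> * gw (pact lam {x}) \<eta> \<partial>LP)" by simp
  finally show ?thesis using partition_pos[OF pact1_act[OF lam x]] by (simp add: Ex_def iota_eq)
qed

text \<open>The Georgii-Nguyen-Zessin equation. It is Mecke for \<open>F x \<eta>\<close> times the
  weight of \<open>insert x \<eta>\<close>: removing \<open>x\<close> and inserting it again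
  restores the weight of the original configuration.\<close>

lemma gnz:
  assumes lam: "lam \<in> act c" and F: "tame2 F"
  shows "Ex lam (\<lambda>\<eta>. \<Sum>x\<in>\<eta>. F x (\<eta> - {x})) = (\<integral>x. \<iota> lam x * Ex (pact lam {x}) (F x) \<partial>L)"
proof -
  let ?G = "\<lambda>x \<eta>. F x \<eta> * gw lam (insert x \<eta>)"
  have G: "tame2 ?G" by (intro tame2_mult F weight_insert_tame2[OF lam])
  have "(\<integral>\<eta>. (\<Sum>x\<in>\<eta>. F x (\<eta> - {x})) * gw lam \<eta> \<partial>LP) = (\<integral>\<eta>. (\<Sum>x\<in>\<eta>. ?G x (\<eta> - {x})) \<partial>LP)"
    by (intro Bochner_Integration.integral_cong refl) (auto simp: sum_distrib_right insert_absorb intro!: sum.cong)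
  also have "\<dots> = (\<integral>x. (\<integral>\<eta>. ?G x \<eta> \<partial>LP) \<partial>L)" by (rule mecke[OF G])
  finally have "Ex lam (\<lambda>\<eta>. \<Sum>x\<in>\<eta>. F x (\<eta> - {x})) = (\<integral>x. (\<integral>\<eta>. ?G x \<eta> \<partial>LP) / Z lam \<partial>L)"
    by (simp add: Ex_def)
  also have "\<dots> = (\<integral>x. \<iota> lam x * Ex (pact lam {x}) (F x) \<partial>L)"
    using integral_weight_insert[OF lam _ tame_measurable[OF tame2_section[OF F]]]
    by (intro Bochner_Integration.integral_cong refl) auto
  finally show ?thesis .
qed

lemma Ex_pact_measurable:
  assumes lam: "lam \<in> act c" and F: "tame2 F"
  shows "(\<lambda>x. \<iota> lam x * Ex (pact lam {x}) (F x)) \<in> borel_measurable L"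
proof -
  have G: "tame2 (\<lambda>x \<eta>. F x \<eta> * gw lam (insert x \<eta>))" by (intro tame2_mult F weight_insert_tame2[OF lam])
  have "(\<lambda>x. (\<integral>\<eta>. F x \<eta> * gw lam (insert x \<eta>) \<partial>LP) / Z lam) \<in> borel_measurable L"
    using tame2_integral_measurable[OF G] by simp
  then show ?thesis
    by (rule measurable_cong[THEN iffD1, rotated])
      (simp add: integral_weight_insert[OF lam _ tame_measurable[OF tame2_section[OF F]]])
qed

lemma Ex_pact_integrable:
  assumes lam: "lam \<in> act c" and F: "tame2 F"
  shows "integrable L (\<lambda>x. \<iota> lam x * Ex (pact lam {x}) (F x))"
proof -
  have G: "tame2 (\<lambda>x \<eta>. F x \<eta> * gw lam (insert x \<eta>))" by (intro tame2_mult F weight_insert_tame2[OF lam])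
  have "integrable L (\<lambda>x. (\<integral>\<eta>. F x \<eta> * gw lam (insert x \<eta>) \<partial>LP) / Z lam)"
    using tame2_integrable[OF G] by simp
  then show ?thesis
    by (rule Bochner_Integration.integrable_cong[THEN iffD1, OF refl, rotated])
      (simp add: integral_weight_insert[OF lam _ tame_measurable[OF tame2_section[OF F]]])
qed

lemma iota_measurable: assumes "lam \<in> act c" shows "\<iota> lam \<in> borel_measurable L"
  using Ex_pact_measurable[OF assms tame2_const[of 1]]
  by (rule measurable_cong[THEN iffD1, rotated]) (simp add: Ex_const[OF pact1_act[OF assms]])

lemma Ex_card: assumes "lam \<in> act c" shows "Ex lam (\<lambda>\<eta>. real (card \<eta>)) = (\<integral>x. \<iota> lam x \<partial>L)"
proof -
  have "Ex lam (\<lambda>\<eta>. real (card \<eta>)) = (\<integral>x. \<iota> lam x * Ex (pact lam {x}) (\<lambda>_. 1) \<partial>L)"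
    using gnz[OF assms tame2_const[of 1]] by simp
  also have "\<dots> = (\<integral>x. \<iota> lam x \<partial>L)"
    by (intro Bochner_Integration.integral_cong refl) (simp add: Ex_const[OF pact1_act[OF assms]])
  finally show ?thesis .
qed

lemma measure_L: "measure L (space L) = measure lborel \<Lambda>"
  using region_borel by (simp add: measure_restrict_space)

lemma Ex_card_le: assumes "lam \<in> act c" shows "Ex lam (\<lambda>\<eta>. real (card \<eta>)) \<le> c * measure lborel \<Lambda>"
proof -
  have "(\<integral>x. \<iota> lam x \<partial>L) \<le> (\<integral>x. c \<partial>L)"
    using iota_bounds[OF assms]
    by (intro integral_mono integrable_L_bounded[of _ c] iota_measurable[OF assms] L.integrable_const) auto
  then show ?thesis unfolding Ex_card[OF assms] by (simp add: measure_L[simplified] mult.commute)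
qed

end

section \<open>The influence constant\<close>

context gibbs_region
begin

lemma pact_joint_measurable:
  assumes lam: "lam \<in> borel_measurable L" and \<xi>: "\<xi> \<in> measurable Q CS"
  shows "(\<lambda>p. pact lam (\<xi> (fst p)) (snd p)) \<in> borel_measurable (Q \<Otimes>\<^sub>M L)"
proof -
  have "(\<lambda>p. \<Sum>x\<in>\<xi> (fst p). \<phi> x (snd p)) \<in> borel_measurable (Q \<Otimes>\<^sub>M L)"
    by (intro sum_phi_measurable measurable_compose[OF measurable_fst \<xi>] measurable_snd)
  then have [measurable]: "(\<lambda>p. exp_neg (\<Sum>x\<in>\<xi> (fst p). \<phi> x (snd p))) \<in> borel_measurable (Q \<Otimes>\<^sub>M L)"
    by (rule measurable_compose[OF _ measurable_exp_neg])
  have [measurable]: "(\<lambda>p. lam (snd p)) \<in> borel_measurable (Q \<Otimes>\<^sub>M L)"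
    by (rule measurable_compose[OF measurable_snd lam])
  show ?thesis unfolding pinned_act_def by measurable
qed

lemma integral_weight_param_measurable:
  assumes m: "(\<lambda>p. l (fst p) (snd p)) \<in> borel_measurable (Q \<Otimes>\<^sub>M L)"
    and pos: "\<And>q x. q \<in> space Q \<Longrightarrow> x \<in> \<Lambda> \<Longrightarrow> 0 \<le> l q x"
    and h: "(\<lambda>p. h (fst p) (snd p)) \<in> borel_measurable (Q \<Otimes>\<^sub>M CS)"
  shows "(\<lambda>q. \<integral>\<eta>. h q \<eta> * gw (l q) \<eta> \<partial>LP) \<in> borel_measurable Q"
proof -
  have "(\<lambda>p. gw (l (fst p)) (snd p)) \<in> borel_measurable (Q \<Otimes>\<^sub>M CS)"
  proof (rule weight_measurable)
    have "(\<lambda>p. (fst (fst p), snd p)) \<in> measurable ((Q \<Otimes>\<^sub>M CS) \<Otimes>\<^sub>M L) (Q \<Otimes>\<^sub>M L)" by measurable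
    from measurable_compose[OF this m]
    show "(\<lambda>p. l (fst (fst p)) (snd p)) \<in> borel_measurable ((Q \<Otimes>\<^sub>M CS) \<Otimes>\<^sub>M L)" by simp
  qed (use pos in \<open>auto simp: space_pair_measure\<close>)
  from borel_measurable_times[OF h this]
  have "(\<lambda>(q, \<eta>). h q \<eta> * gw (l q) \<eta>) \<in> borel_measurable (Q \<Otimes>\<^sub>M LP)"
    by (simp add: split_beta' cong: measurable_cong_sets)
  then show ?thesis by (rule LP.borel_measurable_lebesgue_integral)
qed

lemma Z_param_measurable:
  assumes m: "(\<lambda>p. l (fst p) (snd p)) \<in> borel_measurable (Q \<Otimes>\<^sub>M L)"
    and pos: "\<And>q x. q \<in> space Q \<Longrightarrow> x \<in> \<Lambda> \<Longrightarrow> 0 \<le> l q x"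
  shows "(\<lambda>q. Z (l q)) \<in> borel_measurable Q"
  using integral_weight_param_measurable[OF assms, of "\<lambda>_ _. 1"] by (simp add: partition_function_def)

lemma Ex_param_measurable:
  assumes m: "(\<lambda>p. l (fst p) (snd p)) \<in> borel_measurable (Q \<Otimes>\<^sub>M L)"
    and pos: "\<And>q x. q \<in> space Q \<Longrightarrow> x \<in> \<Lambda> \<Longrightarrow> 0 \<le> l q x"
    and h: "(\<lambda>p. h (fst p) (snd p)) \<in> borel_measurable (Q \<Otimes>\<^sub>M CS)"
  shows "(\<lambda>q. Ex (l q) (h q)) \<in> borel_measurable Q"
  unfolding Ex_def by (intro borel_measurable_divide integral_weight_param_measurable Z_param_measurable assms)

lemma Ex_pact1_measurable:
  assumes lam: "lam \<in> act c" and F: "tame2 F"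
  shows "(\<lambda>x. Ex (pact lam {x}) (F x)) \<in> borel_measurable L"
proof (rule Ex_param_measurable[OF _ _ tame2_measurable[OF F]])
  show "(\<lambda>p. pact lam {fst p} (snd p)) \<in> borel_measurable (L \<Otimes>\<^sub>M L)"
    using pact_joint_measurable[OF act_measurable[OF lam], of "\<lambda>x. {x}" L] by simp
  show "0 \<le> pact lam {q} x" if "q \<in> space L" "x \<in> \<Lambda>" for q x
    using actD(1)[OF pact1_act[OF lam]] that by simp
qed

lemma sets_gibbs [simp, measurable_cong]: "sets (gibbs \<phi> \<Lambda> lam) = sets CS"
  by (simp add: gibbs_def)

lemma gibbs_integrable:
  assumes "lam \<in> act c" "tame h" shows "integrable (gibbs \<phi> \<Lambda> lam) h"
proof -
  have "integrable LP (\<lambda>\<eta>. (gw lam \<eta> / Z lam) *\<^sub>R h \<eta>)"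
    using tame_integrable[OF tame_mult[OF tame_mult[OF tame_weight[OF assms(1)] tame_const[of "1 / Z lam"]] assms(2)]]
    by simp
  then show ?thesis
    unfolding gibbs_def
    using assms weight_measurable1[OF assms(1)] weight_nonneg[OF assms(1)] partition_pos[OF assms(1)] tame_measurable[OF assms(2)]
    by (subst integrable_density) (auto cong: measurable_cong_sets intro!: AE_I2)
qed

lemma tame_sum_fun:
  assumes "g \<in> borel_measurable L" "\<And>x. x \<in> \<Lambda> \<Longrightarrow> \<bar>g x\<bar> \<le> K"
  shows "tame (\<lambda>\<eta>. \<Sum>x\<in>\<eta>. g x)"
  using tame_sum_remove[OF tame2_fun[OF assms]] .

lemma Ex_sum_fun:
  assumes "lam \<in> act c" "g \<in> borel_measurable L" "\<And>x. x \<in> \<Lambda> \<Longrightarrow> \<bar>g x\<bar> \<le> K"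
  shows "Ex lam (\<lambda>\<eta>. \<Sum>x\<in>\<eta>. g x) = (\<integral>x. \<iota> lam x * g x \<partial>L)"
proof -
  have "Ex lam (\<lambda>\<eta>. \<Sum>x\<in>\<eta>. g x) = (\<integral>x. \<iota> lam x * Ex (pact lam {x}) (\<lambda>_. g x) \<partial>L)"
    using gnz[OF assms(1) tame2_fun[OF assms(2,3)]] .
  also have "\<dots> = (\<integral>x. \<iota> lam x * g x \<partial>L)"
    by (intro Bochner_Integration.integral_cong refl) (simp add: Ex_const[OF pact1_act[OF assms(1)]])
  finally show ?thesis .
qed

text \<open>The equation of Georgii, Nguyen and Zessin for the indicator of \<open>B\<close>
  identifies the density, and inner products with respect to the intensity become Lebesgue
  integrals.\<close>

lemma intensity_eq:
  assumes lam: "lam \<in> act c"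
  shows "intensity \<phi> \<Lambda> lam = density L (\<lambda>x. ennreal (\<iota> lam x))"
proof -
  note [measurable] = iota_measurable[OF lam]
  have eq: "(\<integral>\<^sup>+\<eta>. of_nat (card (\<eta> \<inter> B)) \<partial>gibbs \<phi> \<Lambda> lam) = emeasure (density L (\<lambda>x. ennreal (\<iota> lam x))) B"
    if B: "B \<in> sets L" for B
  proof -
    have Bb [measurable]: "B \<in> sets borel" using B by (simp add: sets_L_eq)
    have "tame (\<lambda>\<eta>. real (card (\<eta> \<inter> B)))"
    proof (rule tameI[of _ 1 2])
      fix \<eta> assume "\<eta> \<in> configs \<Lambda>"
      then have "real (card (\<eta> \<inter> B)) \<le> real (card \<eta>)" by (auto simp: configs_def intro: card_mono)
      also have "\<dots> \<le> 2 ^ card \<eta>" using of_nat_less_two_power[of "card \<eta>", where 'a=real] by simp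
      finally show "\<bar>real (card (\<eta> \<inter> B))\<bar> \<le> 1 * 2 ^ card \<eta>" by simp
    qed measurable
    note t = this
    have "(\<integral>\<^sup>+\<eta>. of_nat (card (\<eta> \<inter> B)) \<partial>gibbs \<phi> \<Lambda> lam) = ennreal (\<integral>\<eta>. real (card (\<eta> \<inter> B)) \<partial>gibbs \<phi> \<Lambda> lam)"
      using gibbs_integrable[OF lam t]
      by (subst nn_integral_eq_integral[symmetric]) (auto simp: ennreal_of_nat_eq_real_of_nat)
    also have "(\<integral>\<eta>. real (card (\<eta> \<inter> B)) \<partial>gibbs \<phi> \<Lambda> lam) = Ex lam (\<lambda>\<eta>. \<Sum>x\<in>\<eta>. indicator B x)"
      unfolding integral_gibbs[OF lam tame_measurable[OF t]]
      by (rule Ex_cong) (auto simp: configs_def indicator_def sum.If_cases Int_def)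
    also have "\<dots> = (\<integral>x. \<iota> lam x * indicator B x \<partial>L)"
      by (rule Ex_sum_fun[OF lam, of _ 1]) (use B in \<open>auto simp: indicator_def\<close>)
    also have "ennreal \<dots> = (\<integral>\<^sup>+x. ennreal (\<iota> lam x * indicator B x) \<partial>L)"
      using iota_bounds[OF lam] B
      by (intro nn_integral_eq_integral[symmetric] integrable_L_bounded[of _ c] AE_I2)
        (auto simp: indicator_def intro: order_trans)
    also have "\<dots> = emeasure (density L (\<lambda>x. ennreal (\<iota> lam x))) B"
      using B by (subst emeasure_density) (auto simp: indicator_def intro!: nn_integral_cong)
    finally show ?thesis .
  qed
  have "intensity \<phi> \<Lambda> lam = measure_of \<Lambda> (sets L) (emeasure (density L (\<lambda>x. ennreal (\<iota> lam x))))"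
    unfolding intensity_def sets_L[symmetric]
    using sets.space_closed[of L] sets.sigma_sets_eq[of L] eq by (intro measure_of_eq) auto
  also have "\<dots> = density L (\<lambda>x. ennreal (\<iota> lam x))"
    using measure_of_of_measure[of "density L (\<lambda>x. ennreal (\<iota> lam x))"] by simp
  finally show ?thesis .
qed

lemma pinned_gibbs_integral:
  assumes "lam \<in> act c" "A \<in> configs \<Lambda>" "h \<in> borel_measurable CS"
  shows "(\<integral>\<eta>. h \<eta> \<partial>pinned_gibbs \<phi> \<Lambda> (A, lam)) = Ex lam (\<lambda>\<eta>. h (\<eta> \<union> A))"
proof -
  have m: "(\<lambda>\<eta>. \<eta> \<union> A) \<in> measurable CS CS"
    by (intro measurable_union_config measurable_const measurable_ident_sets) (use assms in auto)
  then have "(\<integral>\<eta>. h \<eta> \<partial>pinned_gibbs \<phi> \<Lambda> (A, lam)) = (\<integral>\<eta>. h (\<eta> \<union> A) \<partial>gibbs \<phi> \<Lambda> lam)"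
    unfolding pinned_gibbs_def using assms(3) by (simp, intro integral_distr) (auto cong: measurable_cong_sets)
  also have "\<dots> = Ex lam (\<lambda>\<eta>. h (\<eta> \<union> A))"
    by (rule integral_gibbs[OF assms(1) measurable_compose[OF m assms(3)]])
  finally show ?thesis .
qed

text \<open>The separate summand \<open>f x\<close> is the contribution of the pinned point itself,
  which almost surely does not occur among the other points.\<close>

lemma influence_eq:
  assumes lam: "lam \<in> act c" and f: "f \<in> borel_measurable L" "\<And>x. x \<in> \<Lambda> \<Longrightarrow> \<bar>f x\<bar> \<le> K" and x: "x \<in> \<Lambda>"
  shows "influence \<phi> \<Lambda> lam f x =
    f x + Ex (pact lam {x}) (\<lambda>\<eta>. \<Sum>y\<in>\<eta>. f y) - Ex lam (\<lambda>\<eta>. \<Sum>y\<in>\<eta>. f y)"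
proof -
  note tf = tame_sum_fun[OF f]
  have "(\<integral>\<eta>. (\<Sum>y\<in>\<eta>. f y) \<partial>pinned_gibbs \<phi> \<Lambda> (pin \<phi> {x} ({}, lam)))
      = Ex (pact lam {x}) (\<lambda>\<eta>. \<Sum>y\<in>\<eta> \<union> {x}. f y)"
    using pinned_gibbs_integral[OF pact1_act[OF lam x] _ tame_measurable[OF tf], of "{x}"] x
    by (simp add: pin_def pinned_act_def)
  also have "\<dots> = Ex (pact lam {x}) (\<lambda>\<eta>. f x + (\<Sum>y\<in>\<eta>. f y))"
  proof (rule Ex_cong_AE[OF pact1_act[OF lam x]])
    show "AE \<eta> in LP. (\<Sum>y\<in>\<eta> \<union> {x}. f y) = f x + (\<Sum>y\<in>\<eta>. f y)"
      using AE_LP_notin[of x] AE_space by eventually_elim (auto simp: configs_def)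
    show "(\<lambda>\<eta>. \<Sum>y\<in>\<eta> \<union> {x}. f y) \<in> borel_measurable CS"
      using tame_measurable[OF tame2_section[OF tame2_insert[OF tf] x]] by simp
  qed (use tame_measurable[OF tf] in simp)
  also have "\<dots> = f x + Ex (pact lam {x}) (\<lambda>\<eta>. \<Sum>y\<in>\<eta>. f y)"
    using Ex_add[OF pact1_act[OF lam x] tame_const tf] by (simp add: Ex_const[OF pact1_act[OF lam x]])
  finally show ?thesis
    by (simp add: influence_def integral_gibbs[OF lam tame_measurable[OF tf]])
qed

lemma tame2_pair_sum:
  assumes f: "f \<in> borel_measurable L" "\<And>x. x \<in> \<Lambda> \<Longrightarrow> \<bar>f x\<bar> \<le> K"
  shows "tame2 (\<lambda>x \<eta>. f x * (f x + (\<Sum>y\<in>\<eta>. f y)))"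
  by (intro tame2_mult tame2_add tame2_fun[OF f] tame2_config tame_sum_fun[OF f])

text \<open>Expanding the square of the linear statistic into pairs, the diagonal comes from the
  pinned point and the off-diagonal part from the remaining points; \<open>gnz\<close> reassembles
  both into the second moment, so the influence form is a variance.\<close>

lemma inner_int_influence:
  assumes lam: "lam \<in> act c" and f: "f \<in> borel_measurable L" "\<And>x. x \<in> \<Lambda> \<Longrightarrow> \<bar>f x\<bar> \<le> K"
  shows "inner_int (intensity \<phi> \<Lambda> lam) f (influence \<phi> \<Lambda> lam f)
    = Ex lam (\<lambda>\<eta>. (\<Sum>x\<in>\<eta>. f x)\<^sup>2) - (Ex lam (\<lambda>\<eta>. \<Sum>x\<in>\<eta>. f x))\<^sup>2"
proof -
  note tf = tame_sum_fun[OF f]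
  let ?m = "Ex lam (\<lambda>\<eta>. \<Sum>x\<in>\<eta>. f x)"
  let ?F = "\<lambda>x \<eta>. f x * (f x + (\<Sum>y\<in>\<eta>. f y))"
  note F = tame2_pair_sum[OF f]
  have infl: "f x * influence \<phi> \<Lambda> lam f x = Ex (pact lam {x}) (?F x) - ?m * f x" if x: "x \<in> \<Lambda>" for x
  proof -
    have "Ex (pact lam {x}) (?F x) = f x * (f x + Ex (pact lam {x}) (\<lambda>\<eta>. \<Sum>y\<in>\<eta>. f y))"
      by (simp add: Ex_cmult Ex_add[OF pact1_act[OF lam x] tame_const tf] Ex_const[OF pact1_act[OF lam x]])
    note e = this
    have i: "influence \<phi> \<Lambda> lam f x = f x + Ex (pact lam {x}) (\<lambda>\<eta>. \<Sum>y\<in>\<eta>. f y) - ?m"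
      by (rule influence_eq[OF lam f x])
    show ?thesis unfolding e i by (simp only: algebra_simps)
  qed
  have m1: "(\<lambda>x. f x * influence \<phi> \<Lambda> lam f x) \<in> borel_measurable L"
  proof (rule measurable_cong[THEN iffD2])
    show "(\<lambda>x. Ex (pact lam {x}) (?F x) - ?m * f x) \<in> borel_measurable L"
      using f(1) Ex_pact1_measurable[OF lam F] by measurable
  qed (use infl in simp)
  have "inner_int (intensity \<phi> \<Lambda> lam) f (influence \<phi> \<Lambda> lam f) = (\<integral>x. \<iota> lam x * (f x * influence \<phi> \<Lambda> lam f x) \<partial>L)"
    unfolding inner_int_def intensity_eq[OF lam]
    using iota_bounds[OF lam] by (subst integral_density[OF m1 iota_measurable[OF lam]]) auto
  also have "\<dots> = (\<integral>x. \<iota> lam x * Ex (pact lam {x}) (?F x) - ?m * (\<iota> lam x * f x) \<partial>L)"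
    by (intro Bochner_Integration.integral_cong refl) (simp add: infl algebra_simps)
  also have "\<dots> = (\<integral>x. \<iota> lam x * Ex (pact lam {x}) (?F x) \<partial>L) - ?m * (\<integral>x. \<iota> lam x * f x \<partial>L)"
  proof (subst Bochner_Integration.integral_diff)
    have "integrable L (\<lambda>x. \<iota> lam x * Ex (pact lam {x}) (\<lambda>_. f x))"
      by (rule Ex_pact_integrable[OF lam tame2_fun[OF f]])
    then have "integrable L (\<lambda>x. \<iota> lam x * f x)"
      by (rule Bochner_Integration.integrable_cong[THEN iffD1, OF refl, rotated])
        (simp add: Ex_const[OF pact1_act[OF lam]])
    then show "integrable L (\<lambda>x. ?m * (\<iota> lam x * f x))" by simp
  qed (use Ex_pact_integrable[OF lam F] in auto)
  also have "(\<integral>x. \<iota> lam x * f x \<partial>L) = ?m" by (rule Ex_sum_fun[OF lam f, symmetric])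
  also have "(\<integral>x. \<iota> lam x * Ex (pact lam {x}) (?F x) \<partial>L) = Ex lam (\<lambda>\<eta>. \<Sum>x\<in>\<eta>. ?F x (\<eta> - {x}))"
    by (rule gnz[OF lam F, symmetric])
  also have "\<dots> = Ex lam (\<lambda>\<eta>. (\<Sum>x\<in>\<eta>. f x)\<^sup>2)"
  proof (rule Ex_cong)
    fix \<eta> assume "\<eta> \<in> configs \<Lambda>"
    then have fin: "finite \<eta>" by (simp add: configs_def)
    have "f x + (\<Sum>y\<in>\<eta> - {x}. f y) = (\<Sum>y\<in>\<eta>. f y)" if "x \<in> \<eta>" for x
      using that fin by (simp add: sum.remove)
    then show "(\<Sum>x\<in>\<eta>. ?F x (\<eta> - {x})) = (\<Sum>x\<in>\<eta>. f x)\<^sup>2"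
      by (simp add: power2_eq_square sum_distrib_right)
  qed
  finally show ?thesis by (simp add: power2_eq_square)
qed

lemma inner_int_self:
  assumes lam: "lam \<in> act c" and f: "f \<in> borel_measurable L" "\<And>x. x \<in> \<Lambda> \<Longrightarrow> \<bar>f x\<bar> \<le> K"
  shows "inner_int (intensity \<phi> \<Lambda> lam) f f = (\<integral>x. \<iota> lam x * (f x)\<^sup>2 \<partial>L)"
  unfolding inner_int_def intensity_eq[OF lam]
  using iota_bounds[OF lam] f(1)
  by (subst integral_density[OF _ iota_measurable[OF lam]]) (auto simp: power2_eq_square)

lemma square_bound:
  fixes f :: "'b \<Rightarrow> real"
  assumes "\<And>x. x \<in> S \<Longrightarrow> \<bar>f x\<bar> \<le> K" "x \<in> S" shows "\<bar>(f x)\<^sup>2\<bar> \<le> K\<^sup>2"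
  using assms by (metis abs_ge_zero abs_power2 power2_abs power_mono)

text \<open>Cauchy--Schwarz inside each configuration reduces the second moment to \<open>E[|\<eta>| \<Sum>f\<^sup>2]\<close>.\<close>

lemma sum_fun_second_moment:
  assumes lam: "lam \<in> act c" and f: "f \<in> borel_measurable L" "\<And>x. x \<in> \<Lambda> \<Longrightarrow> \<bar>f x\<bar> \<le> K"
  shows "Ex lam (\<lambda>\<eta>. (\<Sum>x\<in>\<eta>. f x)\<^sup>2) \<le> (1 + c * measure lborel \<Lambda>) * (\<integral>x. \<iota> lam x * (f x)\<^sup>2 \<partial>L)"
proof -
  have f2: "(\<lambda>x. (f x)\<^sup>2) \<in> borel_measurable L" using f(1) by measurable
  note b2 = square_bound[where f=f and S=\<Lambda>, OF f(2)]
  \<comment> \<open>The summand 1 restores the point \<open>x\<close>, which is absent from the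
    configuration at which \<open>?F x\<close> is evaluated.\<close>
  let ?F = "\<lambda>x \<eta>. (f x)\<^sup>2 * (1 + real (card \<eta>))"
  have F: "tame2 ?F"
    by (intro tame2_mult tame2_add tame2_const tame2_config tame_card tame2_fun[OF f2 b2])
  have "Ex lam (\<lambda>\<eta>. (\<Sum>x\<in>\<eta>. f x)\<^sup>2) \<le> Ex lam (\<lambda>\<eta>. \<Sum>x\<in>\<eta>. ?F x (\<eta> - {x}))"
  proof (rule Ex_mono[OF lam])
    fix \<eta> assume \<eta>: "\<eta> \<in> configs \<Lambda>"
    then have fin: "finite \<eta>" by (simp add: configs_def)
    have "(\<Sum>x\<in>\<eta>. f x)\<^sup>2 \<le> real (card \<eta>) * (\<Sum>x\<in>\<eta>. (f x)\<^sup>2)"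
      using sum_squared_le_sum_of_squares[of f \<eta>] fin by (simp add: mult.commute)
    also have "\<dots> = (\<Sum>x\<in>\<eta>. ?F x (\<eta> - {x}))"
      unfolding sum_distrib_left
    proof (rule sum.cong[OF refl])
      fix x assume "x \<in> \<eta>"
      then have "card \<eta> = Suc (card (\<eta> - {x}))" using fin by (metis card_Suc_Diff1)
      then show "real (card \<eta>) * (f x)\<^sup>2 = ?F x (\<eta> - {x})" by simp
    qed
    finally show "(\<Sum>x\<in>\<eta>. f x)\<^sup>2 \<le> (\<Sum>x\<in>\<eta>. ?F x (\<eta> - {x}))" .
  qed (rule tame_power2, rule tame_sum_fun[OF f], assumption, rule tame_sum_remove[OF F])
  also have "\<dots> = (\<integral>x. \<iota> lam x * Ex (pact lam {x}) (?F x) \<partial>L)" by (rule gnz[OF lam F])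
  also have "\<dots> \<le> (\<integral>x. (1 + c * measure lborel \<Lambda>) * (\<iota> lam x * (f x)\<^sup>2) \<partial>L)"
  proof (rule integral_mono)
    show "integrable L (\<lambda>x. \<iota> lam x * Ex (pact lam {x}) (?F x))" by (rule Ex_pact_integrable[OF lam F])
    have "integrable L (\<lambda>x. \<iota> lam x * Ex (pact lam {x}) (\<lambda>_. (f x)\<^sup>2))"
      by (rule Ex_pact_integrable[OF lam tame2_fun[OF f2 b2]])
    then have "integrable L (\<lambda>x. \<iota> lam x * (f x)\<^sup>2)"
      by (rule Bochner_Integration.integrable_cong[THEN iffD1, OF refl, rotated])
        (simp add: Ex_const[OF pact1_act[OF lam]])
    then show "integrable L (\<lambda>x. (1 + c * measure lborel \<Lambda>) * (\<iota> lam x * (f x)\<^sup>2))" by simp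
    fix x assume "x \<in> space L"
    then have x: "x \<in> \<Lambda>" by simp
    note lamx = pact1_act[OF lam x]
    have "Ex (pact lam {x}) (?F x) = (f x)\<^sup>2 * (1 + Ex (pact lam {x}) (\<lambda>\<eta>. real (card \<eta>)))"
      by (simp add: Ex_cmult Ex_add[OF lamx tame_const tame_card] Ex_const[OF lamx])
    also have "\<dots> \<le> (f x)\<^sup>2 * (1 + c * measure lborel \<Lambda>)"
      using Ex_card_le[OF lamx] by (intro mult_left_mono) auto
    finally have "\<iota> lam x * Ex (pact lam {x}) (?F x) \<le> \<iota> lam x * ((f x)\<^sup>2 * (1 + c * measure lborel \<Lambda>))"
      using iota_bounds[OF lam x] by (intro mult_left_mono)
    then show "\<iota> lam x * Ex (pact lam {x}) (?F x) \<le> (1 + c * measure lborel \<Lambda>) * (\<iota> lam x * (f x)\<^sup>2)"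
      by (simp add: mult_ac)
  qed
  finally show ?thesis by simp
qed

text \<open>The set under the infimum in \<open>influence_const\<close>; whether that infimum is
  meaningful depends on its being nonempty and bounded below, which are separate arguments.\<close>

definition admissible :: "real \<Rightarrow> real set" where
  "admissible c = {C. \<forall>lam\<in>act c. \<forall>f\<in>borel_measurable (restrict_space borel \<Lambda>). bounded (f ` \<Lambda>) \<longrightarrow>
       inner_int (intensity \<phi> \<Lambda> lam) f (influence \<phi> \<Lambda> lam f) \<le> C * inner_int (intensity \<phi> \<Lambda> lam) f f}"

lemma influence_const_admissible: "influence_const \<phi> \<Lambda> c = Inf (admissible c)"
  by (simp add: influence_const_def admissible_def)

text \<open>Makes the set nonempty. A variance is at most a second moment; in the constant, 1
  accounts for the point itself and \<open>c * measure lborel \<Lambda>\<close> bounds the mean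
  number of other points.\<close>

lemma admissible_bound: "1 + c * measure lborel \<Lambda> \<in> admissible c"
  unfolding admissible_def
proof (safe)
  fix lam and f :: "'a \<Rightarrow> real" assume lam: "lam \<in> act c" and f: "f \<in> borel_measurable (restrict_space borel \<Lambda>)" "bounded (f ` \<Lambda>)"
  obtain K where K: "\<And>x. x \<in> \<Lambda> \<Longrightarrow> \<bar>f x\<bar> \<le> K" using f(2) by (auto simp: bounded_iff)
  have f1: "f \<in> borel_measurable L" using f(1) by (simp add: measurable_L_iff)
  show "inner_int (intensity \<phi> \<Lambda> lam) f (influence \<phi> \<Lambda> lam f)
      \<le> (1 + c * measure lborel \<Lambda>) * inner_int (intensity \<phi> \<Lambda> lam) f f"
  proof -
    have "Ex lam (\<lambda>\<eta>. (\<Sum>x\<in>\<eta>. f x)\<^sup>2) \<le> (1 + c * measure lborel \<Lambda>) * (\<integral>x. \<iota> lam x * (f x)\<^sup>2 \<partial>L)"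
      by (rule sum_fun_second_moment[OF lam f1 K])
    moreover have "0 \<le> (Ex lam (\<lambda>\<eta>. \<Sum>x\<in>\<eta>. f x))\<^sup>2" by simp
    moreover have i: "inner_int (intensity \<phi> \<Lambda> lam) f (influence \<phi> \<Lambda> lam f)
        = Ex lam (\<lambda>\<eta>. (\<Sum>x\<in>\<eta>. f x)\<^sup>2) - (Ex lam (\<lambda>\<eta>. \<Sum>x\<in>\<eta>. f x))\<^sup>2"
      by (rule inner_int_influence[OF lam f1 K])
    moreover have j: "inner_int (intensity \<phi> \<Lambda> lam) f f = (\<integral>x. \<iota> lam x * (f x)\<^sup>2 \<partial>L)"
      by (rule inner_int_self[OF lam f1 K])
    ultimately show ?thesis unfolding i j by linarith
  qed
qed

text \<open>Being admissible is a closed condition, so the infimum inherits it: divided by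
  \<open>?b\<close>, the inequality says that a fixed number is a lower bound of the set. If
  \<open>?b\<close> is 0, any admissible constant already gives that \<open>?a\<close> is at most
  0.\<close>

lemma influence_const_ineq:
  assumes lam: "lam \<in> act c" and f: "f \<in> borel_measurable L" "\<And>x. x \<in> \<Lambda> \<Longrightarrow> \<bar>f x\<bar> \<le> K"
  shows "Ex lam (\<lambda>\<eta>. (\<Sum>x\<in>\<eta>. f x)\<^sup>2) - (Ex lam (\<lambda>\<eta>. \<Sum>x\<in>\<eta>. f x))\<^sup>2
    \<le> influence_const \<phi> \<Lambda> c * (\<integral>x. \<iota> lam x * (f x)\<^sup>2 \<partial>L)" (is "?a \<le> _ * ?b")
proof -
  have bdd: "bounded (f ` \<Lambda>)" using f(2) unfolding bounded_iff real_norm_def by blast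
  have adm: "?a \<le> C * ?b" if "C \<in> admissible c" for C
  proof -
    have "f \<in> borel_measurable (restrict_space borel \<Lambda>)" using f(1) by (simp only: measurable_L_iff)
    with that lam bdd
    have "inner_int (intensity \<phi> \<Lambda> lam) f (influence \<phi> \<Lambda> lam f) \<le> C * inner_int (intensity \<phi> \<Lambda> lam) f f"
      unfolding admissible_def by blast
    then show ?thesis by (simp only: inner_int_influence[OF lam f] inner_int_self[OF lam f])
  qed
  have "0 \<le> ?b" by (intro Bochner_Integration.integral_nonneg_AE AE_I2) (simp add: iota_bounds[OF lam])
  then consider "?b = 0" | "0 < ?b" by fastforce
  then show ?thesis
  proof cases
    case 1 then show ?thesis using adm[OF admissible_bound] by (metis mult_zero_right)
  next
    case 2
    have "?a / ?b \<le> influence_const \<phi> \<Lambda> c"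
      unfolding influence_const_admissible
      by (rule cInf_greatest) (use admissible_bound adm 2 in \<open>auto simp: divide_le_eq\<close>)
    then show ?thesis using 2 by (simp add: divide_le_eq)
  qed
qed

lemma Ex_variance_nonneg:
  assumes lam: "lam \<in> act c" and h: "tame h"
  shows "Ex lam (\<lambda>\<eta>. (h \<eta> - Ex lam h)\<^sup>2) = Ex lam (\<lambda>\<eta>. (h \<eta>)\<^sup>2) - (Ex lam h)\<^sup>2"
    and "0 \<le> Ex lam (\<lambda>\<eta>. (h \<eta>)\<^sup>2) - (Ex lam h)\<^sup>2"
proof -
  let ?m = "Ex lam h"
  have "Ex lam (\<lambda>\<eta>. (h \<eta> - ?m)\<^sup>2) = Ex lam (\<lambda>\<eta>. ((h \<eta>)\<^sup>2 - (2 * ?m) * h \<eta>) + ?m\<^sup>2)"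
    by (simp add: power2_diff algebra_simps)
  also have "\<dots> = Ex lam (\<lambda>\<eta>. (h \<eta>)\<^sup>2) - (2 * ?m) * ?m + ?m\<^sup>2"
    by (subst Ex_add[OF lam], (intro tame_intros h)+, subst Ex_diff[OF lam], (intro tame_intros h)+)
      (simp only: Ex_cmult Ex_const[OF lam])
  finally show *: "Ex lam (\<lambda>\<eta>. (h \<eta> - ?m)\<^sup>2) = Ex lam (\<lambda>\<eta>. (h \<eta>)\<^sup>2) - ?m\<^sup>2"
    by (simp add: power2_eq_square)
  have "0 \<le> Ex lam (\<lambda>\<eta>. (h \<eta> - ?m)\<^sup>2)" by (rule Ex_nonneg[OF lam]) (intro tame_intros h, simp)
  then show "0 \<le> Ex lam (\<lambda>\<eta>. (h \<eta>)\<^sup>2) - ?m\<^sup>2" using * by simp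
qed

lemma const_act: "0 \<le> c \<Longrightarrow> (\<lambda>_. c) \<in> act c"
  by (intro actI) auto

text \<open>Test with constant activity \<open>c\<close> and \<open>f = 1\<close>: the influence
  form is the variance of the number of points, while the norm is positive because the one-point
  density is at least \<open>c / Z\<close> on a region of positive volume.\<close>

lemma admissible_nonneg:
  assumes c: "0 < c" and vol: "0 < measure lborel \<Lambda>" and C: "C \<in> admissible c"
  shows "0 \<le> C"
proof -
  let ?l = "\<lambda>_::'a. c"
  have l: "?l \<in> act c" using c by (simp add: const_act)
  have k: "c / Z ?l \<le> \<iota> ?l x" if x: "x \<in> \<Lambda>" for x
  proof -
    have "1 \<le> Z (pact ?l {x})" by (rule partition_ge_1[OF pact1_act[OF l x]])
    then have "c * 1 \<le> c * Z (pact ?l {x})" using c by (intro mult_left_mono) auto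
    then show ?thesis using partition_pos[OF l] by (simp add: iota_eq divide_right_mono)
  qed
  have "(\<integral>x. c / Z ?l \<partial>L) \<le> (\<integral>x. \<iota> ?l x * (1::real)\<^sup>2 \<partial>L)"
    using k iota_bounds[OF l] iota_measurable[OF l]
    by (intro integral_mono integrable_L_bounded[of _ c] L.integrable_const) auto
  moreover have "0 < (\<integral>x. c / Z ?l \<partial>L)"
    using c vol partition_pos[OF l] by (simp add: measure_L[simplified])
  ultimately have pos: "0 < (\<integral>x. \<iota> ?l x * (1::real)\<^sup>2 \<partial>L)" by linarith
  have b: "\<And>x. x \<in> \<Lambda> \<Longrightarrow> \<bar>1::real\<bar> \<le> 1" by simp
  have "0 \<le> Ex ?l (\<lambda>\<eta>. (\<Sum>x\<in>\<eta>. 1)\<^sup>2) - (Ex ?l (\<lambda>\<eta>. \<Sum>x\<in>\<eta>. 1))\<^sup>2"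
    by (rule Ex_variance_nonneg(2)[OF l tame_sum_fun[of _ 1]]) auto
  also have "\<dots> = inner_int (intensity \<phi> \<Lambda> ?l) (\<lambda>_. 1) (influence \<phi> \<Lambda> ?l (\<lambda>_. 1))"
    by (rule inner_int_influence[OF l _ b, symmetric]) auto
  also have "\<dots> \<le> C * inner_int (intensity \<phi> \<Lambda> ?l) (\<lambda>_. 1) (\<lambda>_. 1)"
  proof -
    have "bounded ((\<lambda>_. 1::real) ` \<Lambda>)" by (auto simp: bounded_iff)
    then show ?thesis using C l borel_measurable_const[of 1 "restrict_space borel \<Lambda>"]
      unfolding admissible_def by blast
  qed
  also have "\<dots> = C * (\<integral>x. \<iota> ?l x * (1::real)\<^sup>2 \<partial>L)"
    by (subst inner_int_self[OF l _ b]) auto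
  finally show ?thesis using pos by (simp add: zero_le_mult_iff)
qed

lemma influence_const_nonneg:
  "0 < c \<Longrightarrow> 0 < measure lborel \<Lambda> \<Longrightarrow> 0 \<le> influence_const \<phi> \<Lambda> c"
  unfolding influence_const_admissible
  using admissible_bound by (intro cInf_greatest) (auto intro: admissible_nonneg)

text \<open>A larger bound admits more activities and hence fewer constants; the lower bound 0
  legitimises the comparison of infima. Along the process it makes the rate non-increasing in
  time.\<close>

lemma influence_const_mono:
  assumes "0 < c" "0 < measure lborel \<Lambda>" "c \<le> c'"
  shows "influence_const \<phi> \<Lambda> c \<le> influence_const \<phi> \<Lambda> c'"
  unfolding influence_const_admissible
proof (rule cInf_superset_mono)
  show "admissible c' \<noteq> {}" using admissible_bound by blast
  show "bdd_below (admissible c)" using admissible_nonneg[OF assms(1,2)] by (intro bdd_belowI) auto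
  have "act c \<subseteq> act c'" using assms(3) by (auto simp: activities_def intro: order_trans)
  then show "admissible c' \<subseteq> admissible c" unfolding admissible_def by blast
qed

text \<open>For a linear statistic of \<open>h\<close> this is the influence operator applied to
  \<open>h\<close>; here it is extended to arbitrary observables.\<close>

definition shift :: "('a \<Rightarrow> real) \<Rightarrow> ('a set \<Rightarrow> real) \<Rightarrow> 'a \<Rightarrow> real" where
  "shift lam f x = Ex (pact lam {x}) (\<lambda>\<eta>. f (insert x \<eta>)) - Ex lam f"

lemma shift_measurable: "lam \<in> act c \<Longrightarrow> tame f \<Longrightarrow> shift lam f \<in> borel_measurable L"
  unfolding shift_def[abs_def] using Ex_pact1_measurable[OF _ tame2_insert] by measurable

lemma shift_bound:
  assumes "lam \<in> act c" "tame f" "\<And>\<eta>. \<eta> \<in> configs \<Lambda> \<Longrightarrow> \<bar>f \<eta>\<bar> \<le> B" "x \<in> \<Lambda>"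
  shows "\<bar>shift lam f x\<bar> \<le> 2 * B"
proof -
  have "\<bar>Ex lam f\<bar> \<le> B" by (rule Ex_abs_le[OF assms(1-3)])
  moreover have "\<bar>Ex (pact lam {x}) (\<lambda>\<eta>. f (insert x \<eta>))\<bar> \<le> B"
    using assms by (intro Ex_abs_le[OF pact1_act] tame2_section[OF tame2_insert] assms(3) configs_insert) auto
  ultimately show ?thesis unfolding shift_def by linarith
qed

text \<open>The mean shift \<open>g\<close> satisfies \<open>\<integral>\<iota> g\<^sup>2 = Cov(\<eta>(g), f)\<close>, and \<open>Var (\<eta>(g)) \<le> C \<integral>\<iota> g\<^sup>2\<close>;
  Cauchy--Schwarz, in the form \<open>0 \<le> Var (f - \<theta> \<eta>(g))\<close>, gives \<open>\<integral>\<iota> g\<^sup>2 \<le> C Var f\<close>.\<close>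

lemma shift_dirichlet_le:
  assumes c: "0 < c" and vol: "0 < measure lborel \<Lambda>" and lam: "lam \<in> act c"
    and f: "f \<in> borel_measurable CS" "\<And>\<eta>. \<eta> \<in> configs \<Lambda> \<Longrightarrow> \<bar>f \<eta>\<bar> \<le> B"
  shows "(\<integral>x. \<iota> lam x * (shift lam f x)\<^sup>2 \<partial>L)
    \<le> influence_const \<phi> \<Lambda> c * (Ex lam (\<lambda>\<eta>. (f \<eta>)\<^sup>2) - (Ex lam f)\<^sup>2)" (is "?b \<le> ?C * ?V")
proof -
  have tf: "tame f" by (rule tame_bounded[OF f])
  let ?g = "shift lam f" and ?m = "Ex lam f"
  note g = shift_measurable[OF lam tf] shift_bound[OF lam tf f(2)]
  let ?N = "\<lambda>\<eta>. \<Sum>x\<in>\<eta>. ?g x"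
  have tN: "tame ?N" by (rule tame_sum_fun[OF g])
  let ?a = "Ex lam ?N"
  \<comment> \<open>Chosen so that the expectation under pinning at \<open>x\<close> is the square
    of \<open>?g x\<close>, while the sum over removed points is \<open>?N\<close> times the centred
    \<open>f\<close>; \<open>gnz\<close> equates the two.\<close>
  let ?F = "\<lambda>x \<eta>. ?g x * (f (insert x \<eta>) - ?m)"
  have F: "tame2 ?F" by (intro tame2_mult tame2_diff tame2_fun[OF g] tame2_insert tf tame2_const)
  have "?b = (\<integral>x. \<iota> lam x * Ex (pact lam {x}) (?F x) \<partial>L)"
  proof (intro Bochner_Integration.integral_cong refl)
    fix x assume "x \<in> space L"
    then have x: "x \<in> \<Lambda>" by simp
    have "Ex (pact lam {x}) (?F x) = ?g x * ?g x"
      by (simp add: Ex_cmult Ex_diff[OF pact1_act[OF lam x] tame2_section[OF tame2_insert[OF tf] x] tame_const]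
          Ex_const[OF pact1_act[OF lam x]] shift_def)
    then show "\<iota> lam x * (?g x)\<^sup>2 = \<iota> lam x * Ex (pact lam {x}) (?F x)" by (simp add: power2_eq_square)
  qed
  also have "\<dots> = Ex lam (\<lambda>\<eta>. \<Sum>x\<in>\<eta>. ?F x (\<eta> - {x}))" by (rule gnz[OF lam F, symmetric])
  also have "\<dots> = Ex lam (\<lambda>\<eta>. f \<eta> * ?N \<eta> - ?m * ?N \<eta>)"
    by (rule Ex_cong) (simp add: insert_absorb sum_distrib_left sum_subtractf[symmetric] algebra_simps cong: sum.cong)
  also have "\<dots> = Ex lam (\<lambda>\<eta>. f \<eta> * ?N \<eta>) - ?m * ?a"
    by (subst Ex_diff[OF lam], (intro tame_intros tf tN)+) (simp only: Ex_cmult)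
  finally have b: "?b = Ex lam (\<lambda>\<eta>. f \<eta> * ?N \<eta>) - ?m * ?a" .
  have quad: "0 \<le> ?V - 2 * \<theta> * ?b + \<theta>\<^sup>2 * (?C * ?b)" for \<theta>
  proof -
    let ?h = "\<lambda>\<eta>. f \<eta> - \<theta> * ?N \<eta>"
    have th: "tame ?h" by (intro tame_intros tf tN)
    have "Ex lam (\<lambda>\<eta>. (?h \<eta>)\<^sup>2) = Ex lam (\<lambda>\<eta>. ((f \<eta>)\<^sup>2 - (2 * \<theta>) * (f \<eta> * ?N \<eta>)) + \<theta>\<^sup>2 * (?N \<eta>)\<^sup>2)"
      by (simp add: power2_diff power_mult_distrib algebra_simps)
    also have "\<dots> = Ex lam (\<lambda>\<eta>. (f \<eta>)\<^sup>2) - (2 * \<theta>) * Ex lam (\<lambda>\<eta>. f \<eta> * ?N \<eta>) + \<theta>\<^sup>2 * Ex lam (\<lambda>\<eta>. (?N \<eta>)\<^sup>2)"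
      by (subst Ex_add[OF lam], (intro tame_intros tf tN)+, subst Ex_diff[OF lam], (intro tame_intros tf tN)+)
        (simp only: Ex_cmult)
    finally have 1: "Ex lam (\<lambda>\<eta>. (?h \<eta>)\<^sup>2)
      = Ex lam (\<lambda>\<eta>. (f \<eta>)\<^sup>2) - (2 * \<theta>) * Ex lam (\<lambda>\<eta>. f \<eta> * ?N \<eta>) + \<theta>\<^sup>2 * Ex lam (\<lambda>\<eta>. (?N \<eta>)\<^sup>2)" .
    have 2: "Ex lam ?h = ?m - \<theta> * ?a"
      by (subst Ex_diff[OF lam], (intro tame_intros tf tN)+) (simp only: Ex_cmult)
    have "0 \<le> Ex lam (\<lambda>\<eta>. (?h \<eta>)\<^sup>2) - (Ex lam ?h)\<^sup>2" by (rule Ex_variance_nonneg(2)[OF lam th])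
    also have "\<dots> = ?V - 2 * \<theta> * ?b + \<theta>\<^sup>2 * (Ex lam (\<lambda>\<eta>. (?N \<eta>)\<^sup>2) - ?a\<^sup>2)"
      unfolding 1 2 b by (simp add: power2_eq_square algebra_simps)
    also have "\<dots> \<le> ?V - 2 * \<theta> * ?b + \<theta>\<^sup>2 * (?C * ?b)"
      using influence_const_ineq[OF lam g] by (intro add_left_mono mult_left_mono) auto
    finally show ?thesis .
  qed
  have C0: "0 \<le> ?C" by (rule influence_const_nonneg[OF c vol])
  show ?thesis
  proof (cases "?C = 0")
    case False
    then have "0 < ?C" using C0 by simp
    \<comment> \<open>The value \<open>1 / ?C\<close> minimises the quadratic in \<theta>.\<close>
    moreover have "?V - 2 * (1 / ?C) * ?b + (1 / ?C)\<^sup>2 * (?C * ?b) = ?V - ?b / ?C"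
      using False by (simp add: power2_eq_square)
    ultimately have "?b / ?C \<le> ?V" "0 < ?C" using quad[of "1 / ?C"] by linarith+
    then show ?thesis by (simp only: pos_divide_le_eq mult.commute)
  next
    case True
    have "?b \<le> 0"
    proof (rule ccontr)
      assume "\<not> ?b \<le> 0"
      \<comment> \<open>With \<open>?C = 0\<close> the quadratic term is gone, and this \<theta>
        gives the remaining linear expression the value -1.\<close>
      then show False using quad[of "(?V + 1) / (2 * ?b)"] True by simp
    qed
    then show ?thesis using True by simp
  qed
qed

text \<open>Evaluates the mean change of the variance when points are pinned at rate \<iota>. Second
  moments about the old mean are transported by \<open>gnz\<close> and acquire the factor
  \<open>card \<eta>\<close>; recentring at the new mean costs the squared shift. The terms
  containing \<open>card\<close> are those that tilting will cancel.\<close>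

lemma variance_jump_integral:
  assumes lam: "lam \<in> act c"
    and f: "f \<in> borel_measurable CS" "\<And>\<eta>. \<eta> \<in> configs \<Lambda> \<Longrightarrow> \<bar>f \<eta>\<bar> \<le> B"
  defines "V \<equiv> Ex lam (\<lambda>\<eta>. (f \<eta>)\<^sup>2) - (Ex lam f)\<^sup>2"
  shows "(\<integral>x. \<iota> lam x * ((Ex (pact lam {x}) (\<lambda>\<eta>. (f (insert x \<eta>))\<^sup>2) - (Ex (pact lam {x}) (\<lambda>\<eta>. f (insert x \<eta>)))\<^sup>2) - V) \<partial>L)
    = Ex lam (\<lambda>\<eta>. real (card \<eta>) * (f \<eta> - Ex lam f)\<^sup>2) - (\<integral>x. \<iota> lam x * (shift lam f x)\<^sup>2 \<partial>L)
      - Ex lam (\<lambda>\<eta>. real (card \<eta>)) * V"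
proof -
  have tf: "tame f" by (rule tame_bounded[OF f])
  let ?m = "Ex lam f"
  let ?F = "\<lambda>x \<eta>. (f (insert x \<eta>) - ?m)\<^sup>2"
  have F: "tame2 ?F" by (intro tame2_power2 tame2_diff tame2_insert tf tame2_const)
  have g2: "integrable L (\<lambda>x. \<iota> lam x * (shift lam f x)\<^sup>2)"
  proof -
    have "integrable L (\<lambda>x. \<iota> lam x * Ex (pact lam {x}) (\<lambda>_. (shift lam f x)\<^sup>2))"
      by (intro Ex_pact_integrable[OF lam] tame2_power2 tame2_fun[OF shift_measurable[OF lam tf] shift_bound[OF lam tf f(2)]])
    then show ?thesis
      by (rule Bochner_Integration.integrable_cong[THEN iffD1, OF refl, rotated])
        (simp add: Ex_const[OF pact1_act[OF lam]])
  qed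
  have iV: "integrable L (\<lambda>x. V * \<iota> lam x)"
    using iota_bounds[OF lam] by (intro integrable_mult_right integrable_L_bounded[of _ c] iota_measurable[OF lam]) auto
  have "(\<integral>x. \<iota> lam x * ((Ex (pact lam {x}) (\<lambda>\<eta>. (f (insert x \<eta>))\<^sup>2) - (Ex (pact lam {x}) (\<lambda>\<eta>. f (insert x \<eta>)))\<^sup>2) - V) \<partial>L)
     = (\<integral>x. \<iota> lam x * Ex (pact lam {x}) (?F x) - \<iota> lam x * (shift lam f x)\<^sup>2 - V * \<iota> lam x \<partial>L)"
  proof (intro Bochner_Integration.integral_cong refl)
    fix x assume "x \<in> space L"
    then have x: "x \<in> \<Lambda>" by simp
    note lx = pact1_act[OF lam x]
    have tx: "tame (\<lambda>\<eta>. f (insert x \<eta>))" by (rule tame2_section[OF tame2_insert[OF tf] x])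
    let ?m' = "Ex (pact lam {x}) (\<lambda>\<eta>. f (insert x \<eta>))"
    \<comment> \<open>Second moment about the old mean = variance about the new mean + squared
      shift.\<close>
    have "Ex (pact lam {x}) (?F x) = Ex (pact lam {x}) (\<lambda>\<eta>. ((f (insert x \<eta>))\<^sup>2 - (2 * ?m) * f (insert x \<eta>)) + ?m\<^sup>2)"
      by (simp add: power2_diff algebra_simps)
    also have "\<dots> = Ex (pact lam {x}) (\<lambda>\<eta>. (f (insert x \<eta>))\<^sup>2) - (2 * ?m) * ?m' + ?m\<^sup>2"
      by (subst Ex_add[OF lx], (intro tame_intros tx)+, subst Ex_diff[OF lx], (intro tame_intros tx)+)
        (simp only: Ex_cmult Ex_const[OF lx])
    finally have "Ex (pact lam {x}) (\<lambda>\<eta>. (f (insert x \<eta>))\<^sup>2) - ?m'\<^sup>2 = Ex (pact lam {x}) (?F x) - (shift lam f x)\<^sup>2"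
      unfolding shift_def by (simp add: power2_eq_square algebra_simps)
    note e = this
    show "\<iota> lam x * ((Ex (pact lam {x}) (\<lambda>\<eta>. (f (insert x \<eta>))\<^sup>2) - ?m'\<^sup>2) - V)
        = \<iota> lam x * Ex (pact lam {x}) (?F x) - \<iota> lam x * (shift lam f x)\<^sup>2 - V * \<iota> lam x"
      unfolding e by (simp only: algebra_simps)
  qed
  also have "\<dots> = (\<integral>x. \<iota> lam x * Ex (pact lam {x}) (?F x) \<partial>L) - (\<integral>x. \<iota> lam x * (shift lam f x)\<^sup>2 \<partial>L) - (\<integral>x. V * \<iota> lam x \<partial>L)"
    by (simp only: Bochner_Integration.integral_diff[OF Bochner_Integration.integrable_diff[OF Ex_pact_integrable[OF lam F] g2] iV]
        Bochner_Integration.integral_diff[OF Ex_pact_integrable[OF lam F] g2])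
  also have "(\<integral>x. \<iota> lam x * Ex (pact lam {x}) (?F x) \<partial>L) = Ex lam (\<lambda>\<eta>. \<Sum>x\<in>\<eta>. ?F x (\<eta> - {x}))"
    by (rule gnz[OF lam F, symmetric])
  also have "\<dots> = Ex lam (\<lambda>\<eta>. real (card \<eta>) * (f \<eta> - ?m)\<^sup>2)"
    by (rule Ex_cong) (simp add: insert_absorb cong: sum.cong)
  finally show ?thesis by (simp add: Ex_card[OF lam] mult.commute)
qed

end

section \<open>Time derivative of the localized variance\<close>

lemma set_integral_abs_le:
  fixes h :: "real \<Rightarrow> real"
  assumes h: "h \<in> borel_measurable borel" "\<And>s. s \<in> {r<..u} \<Longrightarrow> \<bar>h s\<bar> \<le> B" and ru: "r \<le> u" and B: "0 \<le> B"
  shows "set_integrable lborel {r<..u} h" "\<bar>LINT s:{r<..u}|lborel. h s\<bar> \<le> B * (u - r)"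
proof -
  have em: "emeasure lborel {r<..u} = ennreal (u - r)"
    using ru by simp
  show i: "set_integrable lborel {r<..u} h" unfolding set_integrable_def
    by (rule integrableI_bounded_set_indicator[where B=B]) (use h em in auto)
  have "\<bar>LINT s:{r<..u}|lborel. h s\<bar> \<le> (\<integral>s. \<bar>indicator {r<..u} s *\<^sub>R h s\<bar> \<partial>lborel)"
    unfolding set_lebesgue_integral_def by (rule integral_abs_bound)
  also have "\<dots> \<le> (\<integral>s. indicator {r<..u} s * B \<partial>lborel)"
  proof (rule Bochner_Integration.integral_mono')
    show "integrable lborel (\<lambda>s. indicator {r<..u} s * B)"
      by (intro integrable_mult_left integrable_real_indicator) (simp_all add: em)
  qed (use h(2) B in \<open>auto simp: indicator_def\<close>)
  also have "\<dots> = B * (u - r)" using ru by simp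
  finally show "\<bar>LINT s:{r<..u}|lborel. h s\<bar> \<le> B * (u - r)" .
qed

context region
begin

lemma tame_power_card: "tame (\<lambda>\<eta>. u ^ card \<eta>)"
proof (rule tameI[of _ 1 "max 1 \<bar>u\<bar>"])
  show "\<bar>u ^ card \<eta>\<bar> \<le> 1 * max 1 \<bar>u\<bar> ^ card \<eta>" for \<eta> :: "'a set"
    by (simp add: power_abs power_mono)
qed auto

text \<open>Grouping configurations by their number of points makes the integral a power series in
  \<open>u\<close> that converges everywhere; the full integrand dominates the partial sums. Time
  derivatives then come from termwise differentiation.\<close>

lemma integral_power_card_sums:
  assumes k: "tame k"
  shows "(\<lambda>n. (\<integral>\<eta>. (if card \<eta> = n then k \<eta> else 0) \<partial>LP) * u ^ n) sums (\<integral>\<eta>. u ^ card \<eta> * k \<eta> \<partial>LP)"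
proof -
  note tame_measurable[OF k, measurable]
  have i: "integrable LP (\<lambda>\<eta>. u ^ card \<eta> * k \<eta>)" by (intro tame_integrable tame_mult tame_power_card k)
  have in1: "integrable LP (\<lambda>\<eta>. (if card \<eta> = n then k \<eta> else 0) * u ^ n)" for n
    by (rule Bochner_Integration.integrable_bound[OF i]) (auto intro!: AE_I2 simp: abs_mult mult.commute)
  have eq: "(\<Sum>n<N. (\<integral>\<eta>. (if card \<eta> = n then k \<eta> else 0) \<partial>LP) * u ^ n)
      = (\<integral>\<eta>. (if card \<eta> < N then u ^ card \<eta> * k \<eta> else 0) \<partial>LP)" for N
  proof -
    have "(\<Sum>n<N. (\<integral>\<eta>. (if card \<eta> = n then k \<eta> else 0) \<partial>LP) * u ^ n)
       = (\<integral>\<eta>. (\<Sum>n<N. (if card \<eta> = n then k \<eta> else 0) * u ^ n) \<partial>LP)"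
      using in1 by (subst Bochner_Integration.integral_sum) auto
    also have "\<dots> = (\<integral>\<eta>. (if card \<eta> < N then u ^ card \<eta> * k \<eta> else 0) \<partial>LP)"
    proof (intro Bochner_Integration.integral_cong refl)
      fix \<eta> :: "'a set"
      have "(\<Sum>n<N. (if card \<eta> = n then k \<eta> else 0) * u ^ n) = (\<Sum>n<N. if card \<eta> = n then k \<eta> * u ^ n else 0)"
        by (intro sum.cong) auto
      then show "(\<Sum>n<N. (if card \<eta> = n then k \<eta> else 0) * u ^ n) = (if card \<eta> < N then u ^ card \<eta> * k \<eta> else 0)"
        by (simp add: sum.delta' mult.commute)
    qed
    finally show ?thesis .
  qed
  have "(\<lambda>N. \<integral>\<eta>. (if card \<eta> < N then u ^ card \<eta> * k \<eta> else 0) \<partial>LP) \<longlonglongrightarrow> (\<integral>\<eta>. u ^ card \<eta> * k \<eta> \<partial>LP)"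
  proof (rule integral_dominated_convergence[where w="\<lambda>\<eta>. \<bar>u ^ card \<eta> * k \<eta>\<bar>"])
    show "AE \<eta> in LP. (\<lambda>N. if card \<eta> < N then u ^ card \<eta> * k \<eta> else 0) \<longlonglongrightarrow> u ^ card \<eta> * k \<eta>"
    proof (rule AE_I2)
      fix \<eta> :: "'a set"
      have "eventually (\<lambda>N. (if card \<eta> < N then u ^ card \<eta> * k \<eta> else 0) = u ^ card \<eta> * k \<eta>) sequentially"
        using eventually_gt_at_top[of "card \<eta>"] by eventually_elim simp
      then show "(\<lambda>N. if card \<eta> < N then u ^ card \<eta> * k \<eta> else 0) \<longlonglongrightarrow> u ^ card \<eta> * k \<eta>"
        by (rule tendsto_eventually)
    qed
  qed (use i in auto)
  then show ?thesis unfolding sums_def eq .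
qed

text \<open>Tilting by time \<open>s\<close> multiplies the weight by the power
  \<open>card \<eta>\<close> of \<open>u = exp (- s)\<close>, so the chain rule applies to an
  everywhere convergent power series in \<open>u\<close>.\<close>

lemma deriv_integral_exp_card:
  assumes k: "tame k"
  shows "((\<lambda>s. \<integral>\<eta>. exp (- s) ^ card \<eta> * k \<eta> \<partial>LP) has_real_derivative
      - (\<integral>\<eta>. exp (- s) ^ card \<eta> * (real (card \<eta>) * k \<eta>) \<partial>LP)) (at s)"
proof -
  define q where "q n = (\<integral>\<eta>. (if card \<eta> = n then k \<eta> else 0) \<partial>LP)" for n
  define F where "F u = (\<integral>\<eta>. u ^ card \<eta> * k \<eta> \<partial>LP)" for u
  have sums: "(\<lambda>n. q n * u ^ n) sums F u" for u
    unfolding q_def F_def by (rule integral_power_card_sums[OF k])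
  then have F: "F = (\<lambda>u. \<Sum>n. q n * u ^ n)" by (auto simp: sums_iff)
  have "summable (\<lambda>n. q n * u ^ n)" for u using sums by (auto simp: sums_iff)
  then have D: "DERIV F u :> (\<Sum>n. diffs q n * u ^ n)" for u
    unfolding F by (rule termdiffs_strong_converges_everywhere)
  \<comment> \<open>Multiplying the derived series by \<open>u\<close> restores the exponent, so the
    n-th coefficient becomes n times \<open>q n\<close>, which belongs to the integrand weighted by
    \<open>card\<close>.\<close>
  have d: "u * (\<Sum>n. diffs q n * u ^ n) = (\<integral>\<eta>. u ^ card \<eta> * (real (card \<eta>) * k \<eta>) \<partial>LP)" for u
  proof -
    have "summable (\<lambda>n. diffs q n * u ^ n)"
      by (rule termdiff_converges_all) (use sums in \<open>auto simp: sums_iff\<close>)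
    then have "(\<lambda>n. u * (diffs q n * u ^ n)) sums (u * (\<Sum>n. diffs q n * u ^ n))"
      by (intro sums_mult summable_sums)
    then have "(\<lambda>n. real (Suc n) * q (Suc n) * u ^ Suc n) sums (u * (\<Sum>n. diffs q n * u ^ n))"
      by (simp add: diffs_def mult_ac)
    then have 1: "(\<lambda>n. real n * q n * u ^ n) sums (u * (\<Sum>n. diffs q n * u ^ n))"
      by (subst (asm) sums_Suc_iff) simp
    have "(\<integral>\<eta>. (if card \<eta> = n then real (card \<eta>) * k \<eta> else 0) \<partial>LP) = real n * q n" for n
    proof -
      have "(\<integral>\<eta>. (if card \<eta> = n then real (card \<eta>) * k \<eta> else 0) \<partial>LP) = (\<integral>\<eta>. real n * (if card \<eta> = n then k \<eta> else 0) \<partial>LP)"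
        by (intro Bochner_Integration.integral_cong) auto
      then show ?thesis by (simp add: q_def)
    qed
    then have "(\<lambda>n. real n * q n * u ^ n) sums (\<integral>\<eta>. u ^ card \<eta> * (real (card \<eta>) * k \<eta>) \<partial>LP)"
      using integral_power_card_sums[OF tame_mult[OF tame_card k], of u] by simp
    with 1 show ?thesis by (rule sums_unique2)
  qed
  have "((\<lambda>s. exp (- s)) has_real_derivative - exp (- s)) (at s)"
    by (auto intro!: derivative_eq_intros)
  from DERIV_chain2[OF D this]
  have "((\<lambda>s. F (exp (- s))) has_real_derivative (\<Sum>n. diffs q n * exp (- s) ^ n) * - exp (- s)) (at s)" .
  moreover have "(\<Sum>n. diffs q n * exp (- s) ^ n) * - exp (- s)
      = - (\<integral>\<eta>. exp (- s) ^ card \<eta> * (real (card \<eta>) * k \<eta>) \<partial>LP)"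
    using d[of "exp (- s)"] by (simp add: mult.commute)
  ultimately show ?thesis by (simp only: F_def)
qed

end

definition scaled :: "real \<Rightarrow> ('a \<Rightarrow> real) \<Rightarrow> 'a \<Rightarrow> real" where
  "scaled s lam = (\<lambda>z. exp (- s) * lam z)"

lemma gibbs_weight_scaled: "gibbs_weight \<phi> (scaled s lam) \<eta> = exp (- s) ^ card \<eta> * gibbs_weight \<phi> lam \<eta>"
  by (simp add: gibbs_weight_def scaled_def prod.distrib)

context gibbs_region
begin

lemma scaled_act: "lam \<in> act c \<Longrightarrow> scaled s lam \<in> act (exp (- s) * c)"
  using act_measurable actD by (intro actI) (auto simp: scaled_def intro!: mult_left_mono)

text \<open>Quotient rule for an exponential family: the derivative is minus the covariance with the
  number of points.\<close>

lemma deriv_Ex_scaled: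
  assumes lam: "lam \<in> act c" and h: "tame h"
  shows "((\<lambda>s. Ex (scaled s lam) h) has_real_derivative
      Ex (scaled s lam) (\<lambda>\<eta>. real (card \<eta>)) * Ex (scaled s lam) h - Ex (scaled s lam) (\<lambda>\<eta>. real (card \<eta>) * h \<eta>)) (at s)"
proof -
  have D: "((\<lambda>s. \<integral>\<eta>. k \<eta> * gw (scaled s lam) \<eta> \<partial>LP) has_real_derivative
      - (\<integral>\<eta>. real (card \<eta>) * k \<eta> * gw (scaled s lam) \<eta> \<partial>LP)) (at s)" if "tame k" for k
    using deriv_integral_exp_card[OF tame_mult[OF that tame_weight[OF lam]], of s]
    by (simp add: gibbs_weight_scaled mult_ac)
  have Z0: "Z (scaled s lam) \<noteq> 0" using partition_pos[OF scaled_act[OF lam], of s] by simp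
  have DZ: "((\<lambda>s. Z (scaled s lam)) has_real_derivative - (\<integral>\<eta>. real (card \<eta>) * gw (scaled s lam) \<eta> \<partial>LP)) (at s)"
    using D[OF tame_const[of 1]] by (simp add: partition_function_def)
  show ?thesis unfolding Ex_def
    by (rule DERIV_cong[OF DERIV_divide[OF D[OF h] DZ Z0]])
      (use Z0 in \<open>simp add: field_simps\<close>)
qed

text \<open>The right-hand side is arranged in the terms of \<open>variance_jump_integral\<close>,
  with opposite signs, so that their sum reduces to the squared shift.\<close>

lemma deriv_variance_scaled:
  assumes lam: "lam \<in> act c" and f: "tame f"
  defines "E \<equiv> \<lambda>s. Ex (scaled s lam)"
  shows "((\<lambda>s. E s (\<lambda>\<eta>. (f \<eta>)\<^sup>2) - (E s f)\<^sup>2) has_real_derivative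
      E s (\<lambda>\<eta>. real (card \<eta>)) * (E s (\<lambda>\<eta>. (f \<eta>)\<^sup>2) - (E s f)\<^sup>2)
      - E s (\<lambda>\<eta>. real (card \<eta>) * (f \<eta> - E s f)\<^sup>2)) (at s)"
proof -
  let ?m = "E s f" and ?n = "\<lambda>\<eta>::'a set. real (card \<eta>)"
  note l = scaled_act[OF lam, of s]
  have "E s (\<lambda>\<eta>. ?n \<eta> * (f \<eta> - ?m)\<^sup>2)
      = E s (\<lambda>\<eta>. (?n \<eta> * (f \<eta>)\<^sup>2 - (2 * ?m) * (?n \<eta> * f \<eta>)) + ?m\<^sup>2 * ?n \<eta>)"
    by (simp add: power2_diff algebra_simps)
  also have "\<dots> = E s (\<lambda>\<eta>. ?n \<eta> * (f \<eta>)\<^sup>2) - (2 * ?m) * E s (\<lambda>\<eta>. ?n \<eta> * f \<eta>) + ?m\<^sup>2 * E s ?n"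
    unfolding E_def
    by (subst Ex_add[OF l], (intro tame_intros f)+, subst Ex_diff[OF l], (intro tame_intros f)+)
      (simp only: Ex_cmult)
  finally have eq: "E s (\<lambda>\<eta>. ?n \<eta> * (f \<eta> - ?m)\<^sup>2)
     = E s (\<lambda>\<eta>. ?n \<eta> * (f \<eta>)\<^sup>2) - (2 * ?m) * E s (\<lambda>\<eta>. ?n \<eta> * f \<eta>) + ?m\<^sup>2 * E s ?n" .
  have D1: "((\<lambda>s. E s (\<lambda>\<eta>. (f \<eta>)\<^sup>2)) has_real_derivative
      E s ?n * E s (\<lambda>\<eta>. (f \<eta>)\<^sup>2) - E s (\<lambda>\<eta>. ?n \<eta> * (f \<eta>)\<^sup>2)) (at s)"
    unfolding E_def by (rule deriv_Ex_scaled[OF lam tame_power2[OF f]])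
  have D2: "((\<lambda>s. E s f) has_real_derivative E s ?n * E s f - E s (\<lambda>\<eta>. ?n \<eta> * f \<eta>)) (at s)"
    unfolding E_def by (rule deriv_Ex_scaled[OF lam f])
  show ?thesis unfolding eq
    by (rule DERIV_cong[OF DERIV_diff[OF D1 DERIV_power[OF D2, of 2]]])
      (simp add: power2_eq_square algebra_simps)
qed

lemma scaled_pact_commute: "scaled s (pact l A) = pact (scaled s l) A"
  by (auto simp: scaled_def pinned_act_def)

end

text \<open>The localized measure with pinned set \<open>A\<close> at time \<open>s\<close> is the law of \<open>\<eta> \<union> A\<close> where \<open>\<eta>\<close> is
  Gibbs with activity \<open>loc s A\<close>; \<open>lvar\<close>, \<open>lvar'\<close> and \<open>dirichlet\<close> are its variance of \<open>f\<close>, the time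
  derivative of that variance with \<open>A\<close> kept fixed, and \<open>\<integral>\<iota> g\<^sup>2\<close> for the mean shift \<open>g\<close>.\<close>

locale localization = gibbs_region \<Lambda> \<phi> for \<Lambda> :: "'a::euclidean_space set" and \<phi> +
  fixes lam :: "'a \<Rightarrow> real" and c :: real and f :: "'a set \<Rightarrow> real"
  assumes c_pos: "0 < c" and lam: "lam \<in> activities \<Lambda> c"
    and f_measurable: "f \<in> borel_measurable (config_space \<Lambda>)"
    and f_bound: "\<And>\<eta>. \<eta> \<in> configs \<Lambda> \<Longrightarrow> \<bar>f \<eta>\<bar> \<le> 1"
begin

definition loc :: "real \<Rightarrow> 'a set \<Rightarrow> 'a \<Rightarrow> real" where
  "loc s A = (\<lambda>z. exp (- s) * lam z * exp_neg (\<Sum>y\<in>A. \<phi> y z))"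

definition fA :: "'a set \<Rightarrow> 'a set \<Rightarrow> real" where "fA A \<eta> = f (\<eta> \<union> A)"

definition lvar :: "real \<Rightarrow> 'a set \<Rightarrow> real" where
  "lvar s A = Ex (loc s A) (\<lambda>\<eta>. (fA A \<eta>)\<^sup>2) - (Ex (loc s A) (fA A))\<^sup>2"

definition lvar' :: "real \<Rightarrow> 'a set \<Rightarrow> real" where
  "lvar' s A = Ex (loc s A) (\<lambda>\<eta>. real (card \<eta>)) * lvar s A
     - Ex (loc s A) (\<lambda>\<eta>. real (card \<eta>) * (fA A \<eta> - Ex (loc s A) (fA A))\<^sup>2)"

definition dirichlet :: "real \<Rightarrow> 'a set \<Rightarrow> real" where
  "dirichlet s A = (\<integral>x. \<iota> (loc s A) x * (shift (loc s A) (fA A) x)\<^sup>2 \<partial>L)"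

lemma loc_scaled: "loc s A = scaled s (pact lam A)"
  by (auto simp: loc_def scaled_def pinned_act_def)

lemma loc_act: "A \<in> configs \<Lambda> \<Longrightarrow> loc s A \<in> act (exp (- s) * c)"
  unfolding loc_scaled by (intro scaled_act pact_act lam)

lemma loc_act_c: assumes "A \<in> configs \<Lambda>" "0 \<le> s" shows "loc s A \<in> act c"
proof -
  have "exp (- s) * c \<le> c" using assms c_pos by (simp add: mult_left_le_one_le)
  then have "act (exp (- s) * c) \<subseteq> act c" by (auto simp: activities_def intro: order_trans)
  then show ?thesis using loc_act[OF assms(1)] by blast
qed

lemma loc_insert: "A \<in> configs \<Lambda> \<Longrightarrow> x \<notin> A \<Longrightarrow> loc s (insert x A) = pact (loc s A) {x}"
  unfolding loc_scaled scaled_pact_commute by (rule pinned_act_insert) (auto simp: configs_def)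

lemma union_config: "\<eta> \<in> configs \<Lambda> \<Longrightarrow> A \<in> configs \<Lambda> \<Longrightarrow> \<eta> \<union> A \<in> configs \<Lambda>"
  by (auto simp: configs_def)

lemma fA_measurable: "A \<in> configs \<Lambda> \<Longrightarrow> fA A \<in> borel_measurable CS"
  unfolding fA_def[abs_def]
  by (rule measurable_compose[OF _ f_measurable])
    (intro measurable_union_config measurable_const measurable_ident_sets, auto)

lemma fA_bound: "A \<in> configs \<Lambda> \<Longrightarrow> \<eta> \<in> configs \<Lambda> \<Longrightarrow> \<bar>fA A \<eta>\<bar> \<le> 1"
  unfolding fA_def by (intro f_bound union_config)

lemma tame_fA: "A \<in> configs \<Lambda> \<Longrightarrow> tame (fA A)"
  by (rule tame_bounded[OF fA_measurable fA_bound])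

lemma lvar_bounds: assumes A: "A \<in> configs \<Lambda>" shows "0 \<le> lvar s A" "lvar s A \<le> 1"
proof -
  show "0 \<le> lvar s A" unfolding lvar_def by (rule Ex_variance_nonneg(2)[OF loc_act[OF A] tame_fA[OF A]])
  have "Ex (loc s A) (\<lambda>\<eta>. (fA A \<eta>)\<^sup>2) \<le> Ex (loc s A) (\<lambda>_. 1)"
    using fA_bound[OF A] by (intro Ex_mono[OF loc_act[OF A]] tame_intros tame_fA[OF A]) (simp add: abs_square_le_1)
  then have "Ex (loc s A) (\<lambda>\<eta>. (fA A \<eta>)\<^sup>2) \<le> 1" by (simp add: Ex_const[OF loc_act[OF A]])
  then show "lvar s A \<le> 1" unfolding lvar_def using zero_le_power2[of "Ex (loc s A) (fA A)"] by linarith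
qed

text \<open>The constant 5 is 1 + 4: the variance is at most 1, the squared deviation of a function
  with values in [-1,1] from its mean is at most 4, and both multiply the mean number of points. The
  bound gives integrability in time.\<close>

lemma lvar'_bound:
  assumes A: "A \<in> configs \<Lambda>" and s: "0 \<le> s" shows "\<bar>lvar' s A\<bar> \<le> 5 * (c * measure lborel \<Lambda>)"
proof -
  note l = loc_act_c[OF A s]
  let ?n = "\<lambda>\<eta>::'a set. real (card \<eta>)" and ?m = "Ex (loc s A) (fA A)"
  have n: "0 \<le> Ex (loc s A) ?n" "Ex (loc s A) ?n \<le> c * measure lborel \<Lambda>"
    using Ex_nonneg[OF l tame_card] Ex_card_le[OF l] by auto
  have t: "tame (\<lambda>\<eta>. ?n \<eta> * (fA A \<eta> - ?m)\<^sup>2)" by (intro tame_intros tame_fA[OF A])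
  have "Ex (loc s A) (\<lambda>\<eta>. ?n \<eta> * (fA A \<eta> - ?m)\<^sup>2) \<le> Ex (loc s A) (\<lambda>\<eta>. 4 * ?n \<eta>)"
  proof (rule Ex_mono[OF l t])
    fix \<eta> assume "\<eta> \<in> configs \<Lambda>"
    then have "\<bar>fA A \<eta> - ?m\<bar> \<le> 2"
      using fA_bound[OF A, of \<eta>] Ex_abs_le[OF l tame_fA[OF A], of 1] fA_bound[OF A] by fastforce
    then have "(fA A \<eta> - ?m)\<^sup>2 \<le> 2\<^sup>2" by (metis abs_ge_zero power2_abs power_mono)
    then have "?n \<eta> * (fA A \<eta> - ?m)\<^sup>2 \<le> ?n \<eta> * 4" by (intro mult_left_mono) auto
    then show "?n \<eta> * (fA A \<eta> - ?m)\<^sup>2 \<le> 4 * ?n \<eta>" by simp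
  qed (intro tame_intros)
  then have u: "Ex (loc s A) (\<lambda>\<eta>. ?n \<eta> * (fA A \<eta> - ?m)\<^sup>2) \<le> 4 * (c * measure lborel \<Lambda>)"
    using n by (simp add: Ex_cmult)
  have v: "0 \<le> Ex (loc s A) (\<lambda>\<eta>. ?n \<eta> * (fA A \<eta> - ?m)\<^sup>2)" by (rule Ex_nonneg[OF l t]) simp
  have "Ex (loc s A) ?n * lvar s A \<le> c * measure lborel \<Lambda> * 1"
    using lvar_bounds[OF A] n by (intro mult_mono) auto
  moreover have "0 \<le> Ex (loc s A) ?n * lvar s A" using lvar_bounds[OF A] n by simp
  ultimately show ?thesis using u v n unfolding lvar'_def by (simp add: abs_le_iff)
qed

lemma deriv_lvar: "A \<in> configs \<Lambda> \<Longrightarrow> ((\<lambda>s. lvar s A) has_real_derivative lvar' s A) (at s)"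
  using deriv_variance_scaled[OF pact_act[OF lam] tame_fA, of A A s]
  by (simp add: lvar_def lvar'_def loc_scaled)

lemma loc_joint_measurable:
  assumes [measurable]: "s \<in> borel_measurable Q" and \<xi>: "\<xi> \<in> measurable Q CS"
  shows "(\<lambda>p. loc (s (fst p)) (\<xi> (fst p)) (snd p)) \<in> borel_measurable (Q \<Otimes>\<^sub>M L)"
  using pact_joint_measurable[OF act_measurable[OF lam] \<xi>] unfolding loc_scaled scaled_def by measurable

lemma loc_nonneg: "A \<in> configs \<Lambda> \<Longrightarrow> x \<in> \<Lambda> \<Longrightarrow> 0 \<le> loc s A x"
  using actD(1)[OF loc_act] .

lemma Ex_loc_measurable:
  assumes s: "s \<in> borel_measurable Q" and \<xi>: "\<xi> \<in> measurable Q CS"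
    and h: "(\<lambda>p. h (fst p) (snd p)) \<in> borel_measurable (Q \<Otimes>\<^sub>M CS)"
  shows "(\<lambda>q. Ex (loc (s q) (\<xi> q)) (h q)) \<in> borel_measurable Q"
  using measurable_space[OF \<xi>]
  by (intro Ex_param_measurable loc_joint_measurable s \<xi> h loc_nonneg) auto

lemma fA_joint_measurable:
  assumes \<xi>: "\<xi> \<in> measurable Q CS"
  shows "(\<lambda>p. fA (\<xi> (fst p)) (snd p)) \<in> borel_measurable (Q \<Otimes>\<^sub>M CS)"
  unfolding fA_def
  by (rule measurable_compose[OF _ f_measurable])
    (intro measurable_union_config measurable_snd measurable_compose[OF measurable_fst \<xi>])

lemma lvar_measurable:
  assumes "s \<in> borel_measurable Q" "\<xi> \<in> measurable Q CS"
  shows "(\<lambda>q. lvar (s q) (\<xi> q)) \<in> borel_measurable Q"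
  unfolding lvar_def
  by (intro borel_measurable_diff borel_measurable_power Ex_loc_measurable fA_joint_measurable assms)

lemma lvar'_measurable:
  assumes "s \<in> borel_measurable Q" "\<xi> \<in> measurable Q CS"
  shows "(\<lambda>q. lvar' (s q) (\<xi> q)) \<in> borel_measurable Q"
proof -
  have c: "(\<lambda>p. real (card (snd p))) \<in> borel_measurable (Q \<Otimes>\<^sub>M CS)" by measurable
  have m: "(\<lambda>q. Ex (loc (s q) (\<xi> q)) (fA (\<xi> q))) \<in> borel_measurable Q"
    by (intro Ex_loc_measurable fA_joint_measurable assms)
  show ?thesis
    unfolding lvar'_def
    by (intro borel_measurable_diff borel_measurable_times lvar_measurable Ex_loc_measurable assms c
        borel_measurable_power fA_joint_measurable measurable_compose[OF measurable_fst m])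
qed

lemma iota_loc_measurable:
  assumes s: "s \<in> borel_measurable Q" and \<xi>: "\<xi> \<in> measurable Q CS" and y: "y \<in> measurable Q L"
  shows "(\<lambda>q. \<iota> (loc (s q) (\<xi> q)) (y q)) \<in> borel_measurable Q"
proof -
  have a: "\<xi> q \<in> configs \<Lambda>" "y q \<in> \<Lambda>" if "q \<in> space Q" for q
    using measurable_space[OF \<xi> that] measurable_space[OF y that] by auto
  have l: "(\<lambda>q. loc (s q) (\<xi> q) (y q)) \<in> borel_measurable Q"
    using measurable_compose[OF measurable_Pair[OF measurable_ident y] loc_joint_measurable[OF s \<xi>]] by simp
  have "(\<lambda>p. \<phi> (y (fst p)) (snd p)) \<in> borel_measurable (Q \<Otimes>\<^sub>M L)"
    by (intro phi_measurable' measurable_compose[OF measurable_snd id_L_borel]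
        measurable_compose[OF measurable_compose[OF measurable_fst y] id_L_borel])
  then have "(\<lambda>p. exp_neg (\<phi> (y (fst p)) (snd p))) \<in> borel_measurable (Q \<Otimes>\<^sub>M L)"
    by (rule measurable_compose[OF _ measurable_exp_neg])
  with loc_joint_measurable[OF s \<xi>]
  have m: "(\<lambda>p. loc (s (fst p)) (\<xi> (fst p)) (snd p) * exp_neg (\<phi> (y (fst p)) (snd p))) \<in> borel_measurable (Q \<Otimes>\<^sub>M L)"
    by (rule borel_measurable_times)
  have z: "(\<lambda>q. Z (\<lambda>z. loc (s q) (\<xi> q) z * exp_neg (\<phi> (y q) z))) \<in> borel_measurable Q"
    by (rule Z_param_measurable[OF m]) (use a loc_nonneg exp_neg_bounds in auto)
  have z': "(\<lambda>q. Z (loc (s q) (\<xi> q))) \<in> borel_measurable Q"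
    by (rule Z_param_measurable[OF loc_joint_measurable[OF s \<xi>]]) (use a loc_nonneg in auto)
  show ?thesis unfolding one_point_density_def
    by (intro borel_measurable_divide borel_measurable_times l z z')
qed

lemma dirichlet_bounds:
  assumes A: "A \<in> configs \<Lambda>" and vol: "0 < measure lborel \<Lambda>"
  shows "0 \<le> dirichlet s A" "dirichlet s A \<le> influence_const \<phi> \<Lambda> (exp (- s) * c) * lvar s A"
proof -
  show "0 \<le> dirichlet s A" unfolding dirichlet_def
    by (intro Bochner_Integration.integral_nonneg_AE AE_I2) (simp add: iota_bounds[OF loc_act[OF A]])
  show "dirichlet s A \<le> influence_const \<phi> \<Lambda> (exp (- s) * c) * lvar s A"
    unfolding dirichlet_def lvar_def
    by (rule shift_dirichlet_le[OF _ vol loc_act[OF A] fA_measurable[OF A] fA_bound[OF A]]) (use c_pos in auto)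
qed

text \<open>Inserting \<open>x\<close> into \<open>A\<close> agrees with pinning \<open>x\<close> on
  top of \<open>A\<close> when \<open>x\<close> lies outside \<open>A\<close>; as \<open>A\<close>
  is finite, this is almost every \<open>x\<close>, and \<open>variance_jump_integral\<close>
  applies.\<close>

lemma jump_rate_integral:
  assumes A: "A \<in> configs \<Lambda>"
  shows "(\<integral>x. \<iota> (loc s A) x * (lvar s (insert x A) - lvar s A) \<partial>L) = - lvar' s A - dirichlet s A"
proof -
  note l = loc_act[OF A, of s]
  let ?l = "loc s A" and ?f = "fA A"
  have fin: "finite A" using A by (simp add: configs_def)
  have mm: "(\<lambda>x. insert x A) \<in> measurable L CS" by (rule measurable_insert_const[OF A])
  have m1: "(\<lambda>x. \<iota> ?l x * (lvar s (insert x A) - lvar s A)) \<in> borel_measurable L"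
    by (intro borel_measurable_times borel_measurable_diff lvar_measurable iota_measurable[OF l] mm measurable_const) (auto simp: A)
  have m2: "(\<lambda>x. \<iota> ?l x * ((Ex (pact ?l {x}) (\<lambda>\<eta>. (?f (insert x \<eta>))\<^sup>2) - (Ex (pact ?l {x}) (\<lambda>\<eta>. ?f (insert x \<eta>)))\<^sup>2) - lvar s A)) \<in> borel_measurable L"
    by (intro borel_measurable_times borel_measurable_diff borel_measurable_power iota_measurable[OF l]
        Ex_pact1_measurable[OF l] tame2_power2 tame2_insert tame_fA[OF A]) auto
  have "(\<integral>x. \<iota> ?l x * (lvar s (insert x A) - lvar s A) \<partial>L)
     = (\<integral>x. \<iota> ?l x * ((Ex (pact ?l {x}) (\<lambda>\<eta>. (?f (insert x \<eta>))\<^sup>2) - (Ex (pact ?l {x}) (\<lambda>\<eta>. ?f (insert x \<eta>)))\<^sup>2) - lvar s A) \<partial>L)"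
  proof (rule integral_cong_AE[OF m1 m2])
    show "AE x in L. \<iota> ?l x * (lvar s (insert x A) - lvar s A) = \<iota> ?l x * ((Ex (pact ?l {x}) (\<lambda>\<eta>. (?f (insert x \<eta>))\<^sup>2) - (Ex (pact ?l {x}) (\<lambda>\<eta>. ?f (insert x \<eta>)))\<^sup>2) - lvar s A)"
      using AE_L_notin[OF fin]
    proof eventually_elim
      case (elim x)
      have "fA (insert x A) = (\<lambda>\<eta>. ?f (insert x \<eta>))" by (auto simp: fA_def)
      then show ?case using loc_insert[OF A elim] by (simp add: lvar_def)
    qed
  qed
  also have "\<dots> = - lvar' s A - dirichlet s A"
    using variance_jump_integral[OF l fA_measurable[OF A] fA_bound[OF A]]
    by (simp add: lvar_def lvar'_def dirichlet_def)
  finally show ?thesis .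
qed

lemma integrable_lvar':
  assumes A: "A \<in> configs \<Lambda>" and "0 \<le> r" "r \<le> u"
  shows "set_integrable lborel {r<..u} (\<lambda>s. lvar' s A)"
proof -
  have "(\<lambda>s. lvar' s A) \<in> borel_measurable borel"
    by (rule lvar'_measurable) (use A in auto)
  then show ?thesis
    by (rule set_integral_abs_le(1)[where B="5 * (c * measure lborel \<Lambda>)"]) (use lvar'_bound[OF A] assms c_pos in auto)
qed

lemma lvar_FTC:
  assumes A: "A \<in> configs \<Lambda>" and r: "0 \<le> r" "r \<le> u"
  shows "lvar u A - lvar r A = (LINT s:{r<..u}|lborel. lvar' s A)"
proof -
  have i: "set_integrable lborel {r<..u} (\<lambda>s. lvar' s A)" by (rule integrable_lvar'[OF A r])
  have "((\<lambda>s. lvar' s A) has_integral (lvar u A - lvar r A)) {r..u}"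
    using deriv_lvar[OF A] r(2)
    by (intro fundamental_theorem_of_calculus)
      (auto simp: has_real_derivative_iff_has_vector_derivative intro: has_vector_derivative_at_within)
  \<comment> \<open>Half-open intervals, so that consecutive inter-arrival intervals are disjoint
    and their integrals add.\<close>
  then have "((\<lambda>s. lvar' s A) has_integral (lvar u A - lvar r A)) {r<..u}"
    by (rule has_integral_spike_set_eq[THEN iffD1, rotated 2]) (auto intro: negligible_subset[of "{r}"])
  then show ?thesis
    using set_borel_integral_eq_integral(2)[OF i] by (simp add: integral_unique)
qed

end

section \<open>Poisson point processes\<close>

context region
begin

text \<open>A generator of the configuration \<sigma>-algebra that is closed under intersections, as
  the uniqueness theorem for measures requires.\<close>

definition void_events :: "'a set set set" where
  "void_events = {{\<eta> \<in> configs \<Lambda>. \<eta> \<inter> B = {}} | B. B \<in> sets borel}"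

text \<open>Induction on \<open>k\<close>: a finite set with more than \<open>k\<close> points in \<open>B\<close> has one of them
  in a basic open set that contains no other point of it.\<close>

lemma card_ge_in_void_sigma:
  "B \<in> sets borel \<Longrightarrow> {\<eta> \<in> configs \<Lambda>. k \<le> card (\<eta> \<inter> B)} \<in> sigma_sets (configs \<Lambda>) void_events"
proof (induction k arbitrary: B)
  case 0
  show ?case by (simp add: sigma_sets_top)
next
  case (Suc k)
  interpret S: sigma_algebra "configs \<Lambda>" "sigma_sets (configs \<Lambda>) void_events"
    by (rule sigma_algebra_sigma_sets) (auto simp: void_events_def)
  obtain \<U> :: "'a set set" where \<U>: "countable \<U>" "topological_basis \<U>"
    by (rule exE[OF ex_countable_basis]) (erule conjE, rule that)
  have op: "open U" if "U \<in> \<U>" for U using \<U>(2) that by (rule topological_basis_open)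
  have nonvoid: "{\<eta> \<in> configs \<Lambda>. \<eta> \<inter> (B \<inter> U) \<noteq> {}} \<in> sigma_sets (configs \<Lambda>) void_events" if "U \<in> \<U>" for U
  proof -
    have "{\<eta> \<in> configs \<Lambda>. \<eta> \<inter> (B \<inter> U) = {}} \<in> void_events"
    proof -
      have "B \<inter> U \<in> sets borel" using Suc.prems op[OF that] by simp
      then show ?thesis unfolding void_events_def by blast
    qed
    from S.compl_sets[OF sigma_sets.Basic[OF this]] show ?thesis
      by (rule back_subst[of "\<lambda>A. A \<in> sigma_sets (configs \<Lambda>) void_events"]) auto
  qed
  have "{\<eta> \<in> configs \<Lambda>. Suc k \<le> card (\<eta> \<inter> B)}
      = (\<Union>U\<in>\<U>. {\<eta> \<in> configs \<Lambda>. \<eta> \<inter> (B \<inter> U) \<noteq> {}} \<inter> {\<eta> \<in> configs \<Lambda>. k \<le> card (\<eta> \<inter> (B - U))})"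
  proof (intro equalityI subsetI)
    fix \<eta> assume "\<eta> \<in> {\<eta> \<in> configs \<Lambda>. Suc k \<le> card (\<eta> \<inter> B)}"
    then have \<eta>: "\<eta> \<in> configs \<Lambda>" "Suc k \<le> card (\<eta> \<inter> B)" by auto
    then have fin: "finite \<eta>" by (simp add: configs_def)
    have "\<eta> \<inter> B \<noteq> {}" using \<eta>(2) by (cases "\<eta> \<inter> B = {}") auto
    then obtain x where x: "x \<in> \<eta> \<inter> B" by blast
    have "open (- (\<eta> \<inter> B - {x}))" using fin by (intro open_Compl finite_imp_closed) auto
    moreover have "x \<in> - (\<eta> \<inter> B - {x})" by simp
    ultimately obtain U where U: "U \<in> \<U>" "x \<in> U" "U \<subseteq> - (\<eta> \<inter> B - {x})"
      by (rule topological_basisE[OF \<U>(2)])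
    then have "\<eta> \<inter> (B - U) = \<eta> \<inter> B - {x}" using x by auto
    then have "k \<le> card (\<eta> \<inter> (B - U))" using x \<eta>(2) fin by simp
    then show "\<eta> \<in> (\<Union>U\<in>\<U>. {\<eta> \<in> configs \<Lambda>. \<eta> \<inter> (B \<inter> U) \<noteq> {}} \<inter> {\<eta> \<in> configs \<Lambda>. k \<le> card (\<eta> \<inter> (B - U))})"
      using U(1,2) x \<eta>(1) by blast
  next
    fix \<eta> assume "\<eta> \<in> (\<Union>U\<in>\<U>. {\<eta> \<in> configs \<Lambda>. \<eta> \<inter> (B \<inter> U) \<noteq> {}} \<inter> {\<eta> \<in> configs \<Lambda>. k \<le> card (\<eta> \<inter> (B - U))})"
    then obtain U x where \<eta>: "\<eta> \<in> configs \<Lambda>" "x \<in> \<eta>" "x \<in> B" "x \<in> U" "k \<le> card (\<eta> \<inter> (B - U))" by auto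
    then have fin: "finite \<eta>" by (simp add: configs_def)
    have "Suc k \<le> card (insert x (\<eta> \<inter> (B - U)))" using \<eta> fin by simp
    also have "\<dots> \<le> card (\<eta> \<inter> B)" using \<eta> fin by (intro card_mono) auto
    finally show "\<eta> \<in> {\<eta> \<in> configs \<Lambda>. Suc k \<le> card (\<eta> \<inter> B)}" using \<eta> by simp
  qed
  also have "\<dots> \<in> sigma_sets (configs \<Lambda>) void_events"
    using \<U>(1) nonvoid Suc.IH[of "B - U" for U] Suc.prems op
    by (intro S.countable_UN' S.Int) auto
  finally show ?case .
qed

lemma sets_config_space_void: "sets CS = sigma_sets (configs \<Lambda>) void_events"
proof
  interpret S: sigma_algebra "configs \<Lambda>" "sigma_sets (configs \<Lambda>) void_events"
    by (rule sigma_algebra_sigma_sets) (auto simp: void_events_def)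
  show "sets CS \<subseteq> sigma_sets (configs \<Lambda>) void_events"
    unfolding sets_config_space
  proof (rule S.sigma_sets_subset, safe)
    fix B :: "'a set" and k assume B: "B \<in> sets borel"
    have "{\<eta> \<in> configs \<Lambda>. card (\<eta> \<inter> B) = k}
        = {\<eta> \<in> configs \<Lambda>. k \<le> card (\<eta> \<inter> B)} - {\<eta> \<in> configs \<Lambda>. Suc k \<le> card (\<eta> \<inter> B)}" by auto
    then show "{\<eta> \<in> configs \<Lambda>. card (\<eta> \<inter> B) = k} \<in> sigma_sets (configs \<Lambda>) void_events"
      using card_ge_in_void_sigma[OF B] by (simp add: S.Diff)
  qed
  show "sigma_sets (configs \<Lambda>) void_events \<subseteq> sets CS"
  proof (rule sets.sigma_sets_subset[of _ CS, simplified space_config_space])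
    show "void_events \<subseteq> sets CS"
      unfolding void_events_def
    proof safe
      fix B :: "'a set" assume "B \<in> sets borel"
      then have "{\<eta> \<in> configs \<Lambda>. card (\<eta> \<inter> B) = 0} \<in> sets CS"
        unfolding sets_config_space by (intro sigma_sets.Basic) blast
      also have "{\<eta> \<in> configs \<Lambda>. card (\<eta> \<inter> B) = 0} = {\<eta> \<in> configs \<Lambda>. \<eta> \<inter> B = {}}"
        by (auto simp: configs_def)
      finally show "{\<eta> \<in> configs \<Lambda>. \<eta> \<inter> B = {}} \<in> sets CS" .
    qed
  qed
qed

lemma void_event_measurable: "B \<in> sets borel \<Longrightarrow> {\<eta> \<in> configs \<Lambda>. \<eta> \<inter> B = {}} \<in> sets CS"
  unfolding sets_config_space_void void_events_def by (intro sigma_sets.Basic) blast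

text \<open>Renyi's theorem: avoiding \<open>A\<close> and avoiding \<open>B\<close> together means
  avoiding \<open>A \<union> B\<close>, so the void events form an intersection-stable
  generator.\<close>

lemma measure_eqI_void:
  assumes "sets M = sets CS" "sets N = sets CS" "emeasure M (configs \<Lambda>) \<noteq> \<infinity>"
    and eq: "\<And>B. B \<in> sets borel \<Longrightarrow>
      emeasure M {\<eta> \<in> configs \<Lambda>. \<eta> \<inter> B = {}} = emeasure N {\<eta> \<in> configs \<Lambda>. \<eta> \<inter> B = {}}"
  shows "M = N"
proof (rule measure_eqI_generator_eq[where E=void_events and \<Omega>="configs \<Lambda>" and A="\<lambda>_. configs \<Lambda>"])
  show "Int_stable void_events"
  proof (rule Int_stableI)
    fix a b assume "a \<in> void_events" "b \<in> void_events"
    then obtain A B where "a = {\<eta> \<in> configs \<Lambda>. \<eta> \<inter> A = {}}" "b = {\<eta> \<in> configs \<Lambda>. \<eta> \<inter> B = {}}"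
      "A \<in> sets borel" "B \<in> sets borel" unfolding void_events_def by auto
    moreover from this have "a \<inter> b = {\<eta> \<in> configs \<Lambda>. \<eta> \<inter> (A \<union> B) = {}}" by auto
    ultimately show "a \<inter> b \<in> void_events" unfolding void_events_def by blast
  qed
  show "range (\<lambda>_. configs \<Lambda>) \<subseteq> void_events"
  proof -
    have "configs \<Lambda> = {\<eta> \<in> configs \<Lambda>. \<eta> \<inter> {} = {}}" by auto
    then show ?thesis unfolding void_events_def by blast
  qed
qed (use assms sets_config_space_void in \<open>auto simp: void_events_def\<close>)

text \<open>The Poisson process of intensity \<open>r\<close> in a bounded region as a density
  against \<open>LP\<close>; the exponential normalises. In this form the Mecke equation of
  \<open>LP\<close> is available for the driving process.\<close>

definition poisson_law :: "real \<Rightarrow> 'a set measure" where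
  "poisson_law r = density LP (\<lambda>\<eta>. ennreal (exp (- (r * measure lborel \<Lambda>)) * r ^ card \<eta>))"

lemma sets_poisson_law [simp, measurable_cong]: "sets (poisson_law r) = sets CS"
  by (simp add: poisson_law_def)

lemma space_poisson_law [simp]: "space (poisson_law r) = configs \<Lambda>"
  using sets_eq_imp_space_eq[OF sets_poisson_law] by simp

lemma emeasure_poisson_law_void:
  assumes r: "0 \<le> r" and B: "B \<in> sets borel"
  shows "emeasure (poisson_law r) {\<eta> \<in> configs \<Lambda>. \<eta> \<inter> B = {}} = ennreal (exp (- (r * measure lborel (\<Lambda> \<inter> B))))"
proof -
  let ?m = "measure lborel \<Lambda>"
  have "emeasure (poisson_law r) {\<eta> \<in> configs \<Lambda>. \<eta> \<inter> B = {}}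
      = (\<integral>\<^sup>+\<eta>. ennreal (exp (- (r * ?m)) * r ^ card \<eta>) * indicator {\<eta> \<in> configs \<Lambda>. \<eta> \<inter> B = {}} \<eta> \<partial>LP)"
    unfolding poisson_law_def using void_event_measurable[OF B] by (subst emeasure_density) auto
  also have "\<dots> = (\<integral>\<^sup>+\<eta>. ennreal (exp (- (r * ?m))) * (if \<eta> \<inter> B = {} then ennreal (r ^ card \<eta>) else 0) \<partial>LP)"
    using r by (intro nn_integral_cong) (auto simp: indicator_def ennreal_mult')
  also have "\<dots> = ennreal (exp (- (r * ?m))) * ennreal (exp (r * measure lborel (\<Lambda> - B)))"
    using void_weight_measurable[OF B] by (subst nn_integral_cmult) (auto simp: nn_integral_LP_void[OF B r] cong: measurable_cong_sets)
  also have "\<dots> = ennreal (exp (- (r * measure lborel (\<Lambda> \<inter> B))))"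
  proof -
    have "measure lborel \<Lambda> = measure lborel ((\<Lambda> \<inter> B) \<union> (\<Lambda> - B))" by (rule arg_cong[where f="measure lborel"]) auto
    also have "\<dots> = measure lborel (\<Lambda> \<inter> B) + measure lborel (\<Lambda> - B)"
    proof (rule measure_Union)
      have "emeasure lborel (\<Lambda> \<inter> B) \<le> emeasure lborel \<Lambda>" "emeasure lborel (\<Lambda> - B) \<le> emeasure lborel \<Lambda>"
        by (intro emeasure_mono; use region_borel in auto)+
      then show "emeasure lborel (\<Lambda> \<inter> B) \<noteq> \<infinity>" "emeasure lborel (\<Lambda> - B) \<noteq> \<infinity>"
        using emeasure_L_finite by auto
    qed (use region_borel B in auto)
    finally show ?thesis by (simp add: ennreal_mult'[symmetric] exp_add[symmetric] algebra_simps)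
  qed
  finally show ?thesis .
qed

lemma prob_space_poisson_law: assumes "0 \<le> r" shows "prob_space (poisson_law r)"
  by (rule prob_spaceI) (use emeasure_poisson_law_void[OF assms, of "{}"] in simp)

text \<open>The trace on a bounded window is a random finite configuration, and the counting law at
  \<open>k = 0\<close> supplies the void probabilities that determine its distribution.\<close>

lemma
  assumes ppp: "poisson_point_process M S r X" and S: "\<Lambda> \<subseteq> S" and r: "0 \<le> r"
  shows poisson_process_restrict_measurable: "(\<lambda>\<omega>. X \<omega> \<inter> \<Lambda>) \<in> measurable M CS"
    and poisson_process_restrict_law: "distr M CS (\<lambda>\<omega>. X \<omega> \<inter> \<Lambda>) = poisson_law r"
proof -
  interpret M: prob_space M using ppp by (simp add: poisson_point_process_def)
  have count: "(\<lambda>\<omega>. card (X \<omega> \<inter> B)) \<in> measurable M (count_space UNIV)"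
    "measure M {\<omega> \<in> space M. card (X \<omega> \<inter> B) = k} = (r * measure lborel B) ^ k / fact k * exp (- (r * measure lborel B))"
    if "B \<in> sets borel" "B \<subseteq> \<Lambda>" for B k
    using ppp that S bounded_subset[OF region_bounded] unfolding poisson_point_process_def by auto
  have fin: "finite (X \<omega> \<inter> \<Lambda>)" if "\<omega> \<in> space M" for \<omega>
    using ppp that region_bounded unfolding poisson_point_process_def by auto
  show m: "(\<lambda>\<omega>. X \<omega> \<inter> \<Lambda>) \<in> measurable M CS"
  proof (rule measurable_configI)
    fix B assume B: "B \<in> sets borel" "B \<subseteq> \<Lambda>"
    then have "X \<omega> \<inter> \<Lambda> \<inter> B = X \<omega> \<inter> B" for \<omega> by auto
    then show "(\<lambda>\<omega>. card (X \<omega> \<inter> \<Lambda> \<inter> B)) \<in> measurable M (count_space UNIV)" using count(1)[OF B] by simp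
  qed (use fin in \<open>auto simp: configs_def\<close>)
  show "distr M CS (\<lambda>\<omega>. X \<omega> \<inter> \<Lambda>) = poisson_law r"
  proof (rule measure_eqI_void)
    interpret D: prob_space "distr M CS (\<lambda>\<omega>. X \<omega> \<inter> \<Lambda>)" by (rule M.prob_space_distr[OF m])
    show "emeasure (distr M CS (\<lambda>\<omega>. X \<omega> \<inter> \<Lambda>)) (configs \<Lambda>) \<noteq> \<infinity>"
      using D.emeasure_space_1 by simp
    fix B :: "'a set" assume B: "B \<in> sets borel"
    have LB: "\<Lambda> \<inter> B \<in> sets borel" "\<Lambda> \<inter> B \<subseteq> \<Lambda>" using region_borel B by auto
    have "emeasure (distr M CS (\<lambda>\<omega>. X \<omega> \<inter> \<Lambda>)) {\<eta> \<in> configs \<Lambda>. \<eta> \<inter> B = {}}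
        = emeasure M ((\<lambda>\<omega>. X \<omega> \<inter> \<Lambda>) -` {\<eta> \<in> configs \<Lambda>. \<eta> \<inter> B = {}} \<inter> space M)"
      by (rule emeasure_distr[OF m void_event_measurable[OF B]])
    also have "(\<lambda>\<omega>. X \<omega> \<inter> \<Lambda>) -` {\<eta> \<in> configs \<Lambda>. \<eta> \<inter> B = {}} \<inter> space M
        = {\<omega> \<in> space M. card (X \<omega> \<inter> (\<Lambda> \<inter> B)) = 0}"
    proof -
      have "card (X \<omega> \<inter> (\<Lambda> \<inter> B)) = 0 \<longleftrightarrow> X \<omega> \<inter> \<Lambda> \<inter> B = {}" if "\<omega> \<in> space M" for \<omega>
      proof -
        have "finite (X \<omega> \<inter> (\<Lambda> \<inter> B))" by (rule finite_subset[OF _ fin[OF that]]) auto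
        then show ?thesis by (simp add: Int_assoc)
      qed
      then show ?thesis using fin by (auto simp: configs_def)
    qed
    also have "emeasure M \<dots> = ennreal (exp (- (r * measure lborel (\<Lambda> \<inter> B))))"
      unfolding M.emeasure_eq_measure count(2)[OF LB] by simp
    also have "\<dots> = emeasure (poisson_law r) {\<eta> \<in> configs \<Lambda>. \<eta> \<inter> B = {}}"
      by (rule emeasure_poisson_law_void[OF r B, symmetric])
    finally show "emeasure (distr M CS (\<lambda>\<omega>. X \<omega> \<inter> \<Lambda>)) {\<eta> \<in> configs \<Lambda>. \<eta> \<inter> B = {}}
      = emeasure (poisson_law r) {\<eta> \<in> configs \<Lambda>. \<eta> \<inter> B = {}}" .
  qed simp_all
qed

lemma integral_poisson_law:
  fixes h :: "'a set \<Rightarrow> real"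
  assumes "0 \<le> r" "h \<in> borel_measurable CS"
  shows "(\<integral>\<eta>. h \<eta> \<partial>poisson_law r) = exp (- (r * measure lborel \<Lambda>)) * (\<integral>\<eta>. r ^ card \<eta> * h \<eta> \<partial>LP)"
proof -
  have "(\<integral>\<eta>. h \<eta> \<partial>poisson_law r) = (\<integral>\<eta>. (exp (- (r * measure lborel \<Lambda>)) * r ^ card \<eta>) *\<^sub>R h \<eta> \<partial>LP)"
    unfolding poisson_law_def using assms
    by (intro integral_density) (auto cong: measurable_cong_sets)
  then show ?thesis by (simp add: mult.assoc)
qed

lemma AE_poisson_law: assumes "AE \<eta> in LP. P \<eta>" shows "AE \<eta> in poisson_law r. P \<eta>"
  unfolding poisson_law_def using assms by (subst AE_density) (auto elim: eventually_mono)

end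

section \<open>The pinned set as a function of the Poisson process\<close>

abbreviation (input) arrival :: "'a \<times> real \<times> real \<Rightarrow> real" where "arrival w \<equiv> fst (snd w)"

text \<open>The inequality is strict so that a point never sees itself or a simultaneous one: the
  history that judges \<open>w\<close> is unchanged when \<open>w\<close> is removed.\<close>

definition before :: "('a \<times> real \<times> real) set \<Rightarrow> real \<Rightarrow> ('a \<times> real \<times> real) set" where
  "before Y s = {w \<in> Y. arrival w < s}"

lemma before_before: "s' \<le> s \<Longrightarrow> before (before Y s) s' = before Y s'"
  by (auto simp: before_def)

lemma before_remove: "s \<le> arrival w \<Longrightarrow> before (Y - {w}) s = before Y s"
  by (auto simp: before_def)

lemma before_all: "(\<And>w. w \<in> Y \<Longrightarrow> arrival w < s) \<Longrightarrow> before Y s = Y"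
  by (auto simp: before_def)

locale negative_fields = localization \<Lambda> \<phi> lam c f
  for \<Lambda> :: "'a::euclidean_space set" and \<phi> lam c f +
  fixes t :: real
  assumes t_nonneg: "0 \<le> t"
begin

text \<open>All arrivals up to \<open>t\<close>, with their marks. Being bounded, the window is
  itself a region in the product space, so the results on configurations apply to it.\<close>

definition W :: "('a \<times> real \<times> real) set" where "W = \<Lambda> \<times> {0..t} \<times> {0..1}"

lemma region_W: "region W"
proof
  have "\<Lambda> \<times> {0..t} \<times> {0..1::real} \<in> sets (borel \<Otimes>\<^sub>M (borel \<Otimes>\<^sub>M borel))"
    using region_borel by (intro pair_measureI) auto
  then show "W \<in> sets borel" unfolding borel_prod W_def .
  show "bounded W" unfolding W_def by (intro bounded_Times region_bounded) auto
qed

sublocale W: region W by (rule region_W)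

definition accepts :: "'a set \<Rightarrow> 'a \<times> real \<times> real \<Rightarrow> bool" where
  "accepts A w \<longleftrightarrow> snd (snd w) \<le> \<iota> (loc (arrival w) A) (fst w) / c"

abbreviation "step \<equiv> nf_step \<phi> \<Lambda> lam c"

definition acc :: "('a \<times> real \<times> real) set \<Rightarrow> 'a set" where
  "acc Y = nf_pinned \<phi> \<Lambda> lam c Y t"

lemma step_eq: "step X s A = A \<union> {fst w | w. w \<in> X \<and> arrival w = s \<and> accepts A w}"
  unfolding nf_step_def accepts_def loc_def by force

lemma step_cong: "{w \<in> X. arrival w = s} = {w \<in> Y. arrival w = s} \<Longrightarrow> step X s A = step Y s A"
  unfolding step_eq by blast

lemma times_eq: "{s. s \<le> t \<and> (\<exists>x l. (x, s, l) \<in> X)} = arrival ` {w \<in> X. arrival w \<le> t}"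
  by force

lemma configs_W: "Y \<in> configs W \<Longrightarrow> finite Y"
  "Y \<in> configs W \<Longrightarrow> w \<in> Y \<Longrightarrow> fst w \<in> \<Lambda>"
  "Y \<in> configs W \<Longrightarrow> w \<in> Y \<Longrightarrow> 0 \<le> arrival w"
  "Y \<in> configs W \<Longrightarrow> w \<in> Y \<Longrightarrow> arrival w \<le> t"
  by (auto simp: configs_def W_def)

lemma before_configs: "Y \<in> configs W \<Longrightarrow> before Y s \<in> configs W"
  by (auto simp: configs_def before_def)

text \<open>The fold reads no arrival after \<open>t\<close>, so the process may be cut to the
  window, where it is finite.\<close>

lemma nf_pinned_window:
  assumes "X \<subseteq> \<Lambda> \<times> {0..} \<times> {0..1}" "finite (X \<inter> W)"
  shows "nf_pinned \<phi> \<Lambda> lam c X t = acc (X \<inter> W)"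
proof -
  have in_W: "{w \<in> X. arrival w \<le> t} = X \<inter> W"
    using assms(1) by (force simp: W_def)
  then have "{w \<in> X \<inter> W. arrival w \<le> t} = X \<inter> W" by auto
  then have times: "{s. s \<le> t \<and> (\<exists>x l. (x, s, l) \<in> X)} = {s. s \<le> t \<and> (\<exists>x l. (x, s, l) \<in> X \<inter> W)}"
    unfolding times_eq in_W by simp
  have fin: "finite {s. s \<le> t \<and> (\<exists>x l. (x, s, l) \<in> X \<inter> W)}"
    unfolding times_eq by (intro finite_imageI finite_subset[OF _ assms(2)]) auto
  show ?thesis unfolding nf_pinned_def acc_def times
  proof (rule fold_cong[OF refl refl], rule ext)
    fix s A assume "s \<in> set (sorted_list_of_set {s. s \<le> t \<and> (\<exists>x l. (x, s, l) \<in> X \<inter> W)})"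
    then have "s \<le> t" using fin by simp
    then have "{w \<in> X. arrival w = s} = {w \<in> X \<inter> W. arrival w = s}" using in_W by auto
    then show "step X s A = step (X \<inter> W) s A" by (rule step_cong)
  qed
qed

lemma acc_empty [simp]: "acc {} = {}"
  by (simp add: acc_def nf_pinned_def)

text \<open>The greatest arrival time comes last in the sorted list, and the earlier updates see
  only \<open>before Y (arrival w)\<close>. A whole \<open>step\<close> remains because points tied
  at that time are tested together.\<close>

lemma acc_last:
  assumes Y: "Y \<in> configs W" and w: "w \<in> Y" and last: "\<And>w'. w' \<in> Y \<Longrightarrow> arrival w' \<le> arrival w"
  shows "acc Y = step Y (arrival w) (acc (before Y (arrival w)))"
proof -
  let ?s = "arrival w"
  define T where "T = arrival ` before Y ?s"
  have fin: "finite T" using configs_W(1)[OF Y] by (auto simp: T_def before_def)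
  have t1: "{s. s \<le> t \<and> (\<exists>x l. (x, s, l) \<in> before Y ?s)} = T"
    unfolding times_eq T_def using configs_W(4)[OF Y] by (auto simp: before_def)
  have "{s. s \<le> t \<and> (\<exists>x l. (x, s, l) \<in> Y)} = arrival ` Y"
    unfolding times_eq using configs_W(4)[OF Y] by auto
  also have "\<dots> = insert ?s T"
    unfolding T_def before_def using w last by (force simp: image_iff)
  finally have t2: "{s. s \<le> t \<and> (\<exists>x l. (x, s, l) \<in> Y)} = insert ?s T" .
  have less: "\<And>r. r \<in> T \<Longrightarrow> r < ?s" by (auto simp: T_def before_def)
  have "sorted_list_of_set (insert ?s T) = insort ?s (sorted_list_of_set T)"
    using fin less by (subst sorted_list_of_set_insert_remove) (auto intro: arg_cong[where f="\<lambda>A. insort ?s (sorted_list_of_set A)"])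
  also have "\<dots> = sorted_list_of_set T @ [?s]"
    using fin less by (intro sorted_insort_is_snoc) (auto intro: less_imp_le)
  finally have l: "sorted_list_of_set (insert ?s T) = sorted_list_of_set T @ [?s]" .
  have "fold (step Y) (sorted_list_of_set T) {} = fold (step (before Y ?s)) (sorted_list_of_set T) {}"
  proof (rule fold_cong[OF refl refl], rule ext)
    fix r A assume "r \<in> set (sorted_list_of_set T)"
    then have "r < ?s" using fin less by simp
    then show "step Y r A = step (before Y ?s) r A" by (intro step_cong) (auto simp: before_def)
  qed
  then show ?thesis unfolding acc_def nf_pinned_def t1 t2 l by simp
qed

lemma card_before_less:
  assumes "Y \<in> configs W" "w \<in> Y" shows "card (before Y (arrival w)) < card Y"
  using assms configs_W(1)[OF assms(1)] by (intro psubset_card_mono) (auto simp: before_def)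

lemma exists_last:
  assumes Y: "Y \<in> configs W" and "Y \<noteq> {}"
  obtains w where "w \<in> Y" "\<And>w'. w' \<in> Y \<Longrightarrow> arrival w' \<le> arrival w"
proof -
  have "Max (arrival ` Y) \<in> arrival ` Y" using assms configs_W(1)[OF Y] by (intro Max_in) auto
  then obtain w where "w \<in> Y" "arrival w = Max (arrival ` Y)" by auto
  then show ?thesis using that configs_W(1)[OF Y] by simp
qed

text \<open>Every point is judged by the set built from its strict past. This description without
  sorting is what measurability rests on. The induction is on the number of points, splitting off
  the last arrival time.\<close>

lemma acc_eq: "Y \<in> configs W \<Longrightarrow> acc Y = fst ` {w \<in> Y. accepts (acc (before Y (arrival w))) w}"
proof (induction "card Y" arbitrary: Y rule: less_induct)
  case less
  note Y = less.prems
  show ?case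
  proof (cases "Y = {}")
    case False
    then obtain w where w: "w \<in> Y" "\<And>w'. w' \<in> Y \<Longrightarrow> arrival w' \<le> arrival w"
      using exists_last[OF Y] by blast
    let ?B = "before Y (arrival w)"
    have "acc ?B = fst ` {v \<in> ?B. accepts (acc (before ?B (arrival v))) v}"
      by (rule less.hyps[OF card_before_less[OF Y w(1)] before_configs[OF Y]])
    also have "{v \<in> ?B. accepts (acc (before ?B (arrival v))) v} = {v \<in> ?B. accepts (acc (before Y (arrival v))) v}"
    proof -
      have "before ?B (arrival v) = before Y (arrival v)" if "v \<in> ?B" for v
        using that by (intro before_before) (auto simp: before_def)
      then show ?thesis by auto
    qed
    finally have B: "acc ?B = fst ` {v \<in> ?B. accepts (acc (before Y (arrival v))) v}" .
    have "acc Y = acc ?B \<union> {fst v | v. v \<in> Y \<and> arrival v = arrival w \<and> accepts (acc ?B) v}"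
      using acc_last[OF Y w] unfolding step_eq .
    also have "{fst v | v. v \<in> Y \<and> arrival v = arrival w \<and> accepts (acc ?B) v}
        = fst ` {v \<in> Y. arrival v = arrival w \<and> accepts (acc ?B) v}" by blast
    also have "{v \<in> Y. arrival v = arrival w \<and> accepts (acc ?B) v}
        = {v \<in> Y. arrival v = arrival w \<and> accepts (acc (before Y (arrival v))) v}"
      by (rule Collect_cong) metis
    also have "acc ?B \<union> fst ` {v \<in> Y. arrival v = arrival w \<and> accepts (acc (before Y (arrival v))) v}
        = fst ` ({v \<in> ?B. accepts (acc (before Y (arrival v))) v}
            \<union> {v \<in> Y. arrival v = arrival w \<and> accepts (acc (before Y (arrival v))) v})"
      unfolding B image_Un ..
    also have "{v \<in> ?B. accepts (acc (before Y (arrival v))) v} \<union> {v \<in> Y. arrival v = arrival w \<and> accepts (acc (before Y (arrival v))) v}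
        = {v \<in> Y. accepts (acc (before Y (arrival v))) v}"
      unfolding before_def using w(2) by force
    finally show ?thesis .
  qed simp
qed

lemma acc_configs: assumes "Y \<in> configs W" shows "acc Y \<in> configs \<Lambda>"
proof -
  have "acc Y \<subseteq> fst ` Y" unfolding acc_eq[OF assms] by blast
  moreover have "fst ` Y \<subseteq> \<Lambda>" using configs_W(2)[OF assms] by blast
  ultimately show ?thesis
    using configs_W(1)[OF assms] unfolding configs_def by (blast intro: finite_subset finite_imageI)
qed

text \<open>The recursion \<open>acc_eq\<close> unfolded \<open>k\<close> times; this is exact once \<open>k \<ge> card Y\<close>.\<close>

primrec acc_upto :: "nat \<Rightarrow> ('a \<times> real \<times> real) set \<Rightarrow> 'a set" where
  "acc_upto 0 Y = {}"
| "acc_upto (Suc k) Y = fst ` {w \<in> Y. accepts (acc_upto k (before Y (arrival w))) w}"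

lemma acc_upto_eq: "Y \<in> configs W \<Longrightarrow> card Y \<le> k \<Longrightarrow> acc_upto k Y = acc Y"
proof (induction k arbitrary: Y)
  case 0 then show ?case using configs_W(1)[OF 0(1)] by simp
next
  case (Suc k)
  have "acc_upto k (before Y (arrival w)) = acc (before Y (arrival w))" if "w \<in> Y" for w
    using card_before_less[OF Suc.prems(1) that] Suc.prems before_configs by (intro Suc.IH) auto
  then show ?case using acc_eq[OF Suc.prems(1)] by auto
qed

section \<open>Measurability of the pinned set\<close>

lemma arrival_measurable: "(\<lambda>w. arrival w) \<in> measurable W.L borel"
  and fst_W_measurable: "fst \<in> measurable W.L L"
  and mark_measurable: "(\<lambda>w. snd (snd w)) \<in> measurable W.L borel"
proof -
  have b: "(\<lambda>w::'a \<times> real \<times> real. arrival w) \<in> borel_measurable borel"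
    "(\<lambda>w::'a \<times> real \<times> real. snd (snd w)) \<in> borel_measurable borel"
    "(\<lambda>w::'a \<times> real \<times> real. fst w) \<in> borel_measurable borel"
    by (intro borel_measurable_continuous_onI continuous_intros)+
  show "(\<lambda>w. arrival w) \<in> measurable W.L borel" "(\<lambda>w. snd (snd w)) \<in> measurable W.L borel"
    using b W.id_L_borel by (auto intro: measurable_compose)
  have "fst \<in> measurable W.L (restrict_space borel \<Lambda>)"
    using measurable_compose[OF W.id_L_borel b(3)]
    by (intro measurable_restrict_space2) (auto simp: W_def space_restrict_space)
  then show "fst \<in> measurable W.L L"
    by (simp add: measurable_cong_sets[OF refl sets_L])
qed

lemma before_measurable:
  assumes Y: "Y \<in> measurable Q W.CS" and s: "s \<in> borel_measurable Q"
  shows "(\<lambda>q. before (Y q) (s q)) \<in> measurable Q W.CS"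
  unfolding before_def
proof (rule W.measurable_filter_config[OF Y])
  have [measurable]: "(\<lambda>p. arrival (snd p)) \<in> borel_measurable (Q \<Otimes>\<^sub>M W.L)"
    by (rule measurable_compose[OF measurable_snd arrival_measurable])
  note s [measurable]
  show "{p \<in> space (Q \<Otimes>\<^sub>M W.L). arrival (snd p) < s (fst p)} \<in> sets (Q \<Otimes>\<^sub>M W.L)" by measurable
qed

lemma rate_measurable:
  assumes A: "A \<in> measurable Q CS" and w: "w \<in> measurable Q W.L"
  shows "(\<lambda>q. \<iota> (loc (arrival (w q)) (A q)) (fst (w q))) \<in> borel_measurable Q"
  by (intro iota_loc_measurable A measurable_compose[OF w arrival_measurable] measurable_compose[OF w fst_W_measurable])

lemma accepts_measurable:
  assumes A: "A \<in> measurable Q CS" and w: "w \<in> measurable Q W.L"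
  shows "Measurable.pred Q (\<lambda>q. accepts (A q) (w q))"
proof -
  note [measurable] = rate_measurable[OF A w] measurable_compose[OF w mark_measurable]
  show ?thesis unfolding accepts_def by measurable
qed

text \<open>One unfolding is a filter by a measurable relation between a configuration and its
  points, followed by the projection to \<open>\<Lambda>\<close>, which
  \<open>measurable_image_config\<close> handles.\<close>

lemma acc_upto_measurable: "acc_upto k \<in> measurable W.CS CS"
proof (induction k)
  case 0
  have "(\<lambda>_. {}) \<in> measurable W.CS CS" by (rule measurable_const) simp
  then show ?case by (simp add: fun_eq_iff cong: measurable_cong)
next
  case (Suc k)
  have b: "(\<lambda>p. before (fst p) (arrival (snd p))) \<in> measurable (W.CS \<Otimes>\<^sub>M W.L) W.CS"
    by (intro before_measurable measurable_fst measurable_compose[OF measurable_snd arrival_measurable])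
  have "Measurable.pred (W.CS \<Otimes>\<^sub>M W.L) (\<lambda>p. accepts (acc_upto k (before (fst p) (arrival (snd p)))) (snd p))"
    by (intro accepts_measurable measurable_compose[OF b Suc] measurable_snd)
  then have "{p \<in> space (W.CS \<Otimes>\<^sub>M W.L). accepts (acc_upto k (before (fst p) (arrival (snd p)))) (snd p)} \<in> sets (W.CS \<Otimes>\<^sub>M W.L)"
    by (simp add: pred_def)
  then have "(\<lambda>Y. {w \<in> Y. accepts (acc_upto k (before Y (arrival w))) w}) \<in> measurable W.CS W.CS"
    by (intro W.measurable_filter_config) auto
  from measurable_image_config[OF region_axioms W.region_axioms this fst_W_measurable]
  show ?case by simp
qed

text \<open>The required number of unfoldings is \<open>card Y\<close>, a measurable index with
  countably many values.\<close>

lemma acc_measurable: "acc \<in> measurable W.CS CS"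
proof (rule measurable_cong[THEN iffD2])
  show "acc Y = acc_upto (card Y) Y" if "Y \<in> space W.CS" for Y
    using that acc_upto_eq[of Y "card Y"] by simp
  show "(\<lambda>Y. acc_upto (card Y) Y) \<in> measurable W.CS CS"
    by (rule measurable_compose_countable[of "\<lambda>n Y. acc_upto n Y"]) (auto intro: acc_upto_measurable)
qed

text \<open>The left limit of the pinned set at time \<open>s\<close>, that is, its predictable
  version: it decides on the points arriving at \<open>s\<close>.\<close>

definition accb :: "('a \<times> real \<times> real) set \<Rightarrow> real \<Rightarrow> 'a set" where
  "accb Y s = acc (before Y s)"

lemma accb_configs: "Y \<in> configs W \<Longrightarrow> accb Y s \<in> configs \<Lambda>"
  unfolding accb_def by (intro acc_configs before_configs)

lemma accb_measurable:
  assumes "Y \<in> measurable Q W.CS" "s \<in> borel_measurable Q"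
  shows "(\<lambda>q. accb (Y q) (s q)) \<in> measurable Q CS"
  unfolding accb_def by (rule measurable_compose[OF before_measurable[OF assms] acc_measurable])

lemma accb_before: "s' \<le> s \<Longrightarrow> accb (before Y s) s' = accb Y s'"
  by (simp add: accb_def before_before)

text \<open>Predictability in the form in which Mecke uses it: a point has no influence on the set
  that judges it.\<close>

lemma accb_remove: "accb (Y - {w}) (arrival w) = accb Y (arrival w)"
  by (simp add: accb_def before_remove)

definition jump :: "'a set \<Rightarrow> 'a \<times> real \<times> real \<Rightarrow> real" where
  "jump A w = (if accepts A w then lvar (arrival w) (insert (fst w) A) - lvar (arrival w) A else 0)"

lemma lvar'_accb_integrable:
  assumes Y: "Y \<in> configs W" and r: "0 \<le> r" "r \<le> u"
  shows "set_integrable lborel {r<..u} (\<lambda>s. lvar' s (accb Y s))"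
proof -
  have m: "(\<lambda>s. lvar' s (accb Y s)) \<in> borel_measurable borel"
    by (intro lvar'_measurable accb_measurable measurable_const measurable_ident_sets) (auto simp: Y)
  show ?thesis
    by (rule set_integral_abs_le(1)[where B="5 * (c * measure lborel \<Lambda>)", OF m]) (use lvar'_bound[OF accb_configs[OF Y]] r c_pos in auto)
qed

text \<open>Pathwise change of the variance as jumps at arrivals plus drift in between. The
  induction removes the last arrival, applies the fundamental theorem of calculus from there to
  \<open>u\<close>, and relies on distinct arrival times so that each jump concerns one
  point.\<close>

lemma lvar_path_all:
  "Y \<in> configs W \<Longrightarrow> inj_on (\<lambda>w. arrival w) Y \<Longrightarrow> 0 \<le> u \<Longrightarrow> (\<And>w. w \<in> Y \<Longrightarrow> arrival w < u) \<Longrightarrow>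
    lvar u (acc Y) = lvar 0 {} + (\<Sum>w\<in>Y. jump (accb Y (arrival w)) w)
      + (LINT s:{0<..u}|lborel. lvar' s (accb Y s))"
proof (induction "card Y" arbitrary: Y u rule: less_induct)
  case less
  note Y = less.prems(1) and inj = less.prems(2) and u = less.prems(3,4)
  show ?case
  proof (cases "Y = {}")
    case True
    then show ?thesis using lvar_FTC[of "{}" 0 u] u by (simp add: accb_def before_def)
  next
    case False
    then obtain w where w: "w \<in> Y" "\<And>w'. w' \<in> Y \<Longrightarrow> arrival w' \<le> arrival w"
      using exists_last[OF Y] by blast
    let ?s = "arrival w"
    define Y' where "Y' = before Y ?s"
    \<comment> \<open>Without ties the strict past of the last point is everything except that
      point.\<close>
    have Y'Y: "Y' = Y - {w}"
    proof -
      have "arrival w' < ?s" if "w' \<in> Y" "w' \<noteq> w" for w'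
        using w(2)[OF that(1)] inj_onD[OF inj _ that(1) w(1)] that(2) by fastforce
      then show ?thesis unfolding Y'_def before_def by auto
    qed
    have Y': "Y' \<in> configs W" unfolding Y'_def by (rule before_configs[OF Y])
    have s0: "0 \<le> ?s" "?s < u" using configs_W(3)[OF Y w(1)] u(2)[OF w(1)] by auto
    have accs: "accb Y' r = accb Y r" if "r \<le> ?s" for r
      unfolding Y'_def by (rule accb_before[OF that])
    have IH: "lvar ?s (acc Y') = lvar 0 {} + (\<Sum>v\<in>Y'. jump (accb Y' (arrival v)) v)
        + (LINT r:{0<..?s}|lborel. lvar' r (accb Y' r))"
    proof (rule less.hyps[OF _ Y' _ s0(1)])
      show "card Y' < card Y" unfolding Y'_def by (rule card_before_less[OF Y w(1)])
      show "inj_on (\<lambda>w. arrival w) Y'" using inj unfolding Y'Y by (rule inj_on_subset) auto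
    qed (auto simp: Y'_def before_def)
    have s1: "(\<Sum>v\<in>Y'. jump (accb Y' (arrival v)) v) = (\<Sum>v\<in>Y'. jump (accb Y (arrival v)) v)"
    proof (rule sum.cong[OF refl])
      fix v assume "v \<in> Y'"
      then have "arrival v \<le> ?s" using w(2) Y'Y by auto
      then show "jump (accb Y' (arrival v)) v = jump (accb Y (arrival v)) v" by (simp add: accs)
    qed
    have s2: "(LINT r:{0<..?s}|lborel. lvar' r (accb Y' r)) = (LINT r:{0<..?s}|lborel. lvar' r (accb Y r))"
      by (rule set_lebesgue_integral_cong) (auto simp: accs)
    have acc_Y': "accb Y ?s = acc Y'" by (simp add: accb_def Y'_def)
    have acc_Y: "acc Y = (if accepts (acc Y') w then insert (fst w) (acc Y') else acc Y')"
    proof -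
      have un: "v = w" if "v \<in> Y" "arrival v = ?s" for v
        using inj_onD[OF inj _ that(1) w(1)] that(2) by auto
      have "{fst v | v. v \<in> Y \<and> arrival v = ?s \<and> accepts (acc Y') v} = (if accepts (acc Y') w then {fst w} else {})"
      proof (cases "accepts (acc Y') w")
        case True
        then have "{fst v | v. v \<in> Y \<and> arrival v = ?s \<and> accepts (acc Y') v} = {fst w}" using un w(1) by blast
        then show ?thesis using True by (simp only: if_True)
      next
        case False
        then have "{fst v | v. v \<in> Y \<and> arrival v = ?s \<and> accepts (acc Y') v} = {}" using un by blast
        then show ?thesis using False by (simp only: if_False)
      qed
      then show ?thesis using acc_last[OF Y w] unfolding step_eq Y'_def by auto
    qed
    have jw: "jump (accb Y ?s) w = lvar ?s (acc Y) - lvar ?s (acc Y')"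
      unfolding acc_Y' jump_def acc_Y by simp
    have "lvar u (acc Y) - lvar ?s (acc Y) = (LINT r:{?s<..u}|lborel. lvar' r (acc Y))"
      using s0 by (intro lvar_FTC acc_configs[OF Y]) auto
    also have "\<dots> = (LINT r:{?s<..u}|lborel. lvar' r (accb Y r))"
    proof (rule set_lebesgue_integral_cong, simp, safe)
      fix r assume "r \<in> {?s<..u}"
      \<comment> \<open>After the last arrival the left limit has reached its final value.\<close>
      then have "before Y r = Y" using w(2) by (intro before_all) (fastforce intro: le_less_trans)
      then show "lvar' r (acc Y) = lvar' r (accb Y r)" by (simp add: accb_def)
    qed
    finally have FTC: "lvar u (acc Y) - lvar ?s (acc Y) = (LINT r:{?s<..u}|lborel. lvar' r (accb Y r))" .
    have split: "(LINT r:{0<..u}|lborel. lvar' r (accb Y r))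
        = (LINT r:{0<..?s}|lborel. lvar' r (accb Y r)) + (LINT r:{?s<..u}|lborel. lvar' r (accb Y r))"
    proof -
      have "{0<..u} = {0<..?s} \<union> {?s<..u}" using s0 by auto
      then show ?thesis
        using lvar'_accb_integrable[OF Y, of 0 ?s] lvar'_accb_integrable[OF Y, of ?s u] s0
        by (simp only:) (rule set_integral_Un, auto)
    qed
    have "(\<Sum>v\<in>Y. jump (accb Y (arrival v)) v) = jump (accb Y ?s) w + (\<Sum>v\<in>Y'. jump (accb Y (arrival v)) v)"
      unfolding Y'Y by (rule sum.remove[OF configs_W(1)[OF Y] w(1)])
    then show ?thesis using IH FTC split jw s1 s2 by linarith
  qed
qed

lemma lvar_path:
  assumes Y: "Y \<in> configs W" and inj: "inj_on (\<lambda>w. arrival w) Y" and u: "0 \<le> u"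
  shows "lvar u (accb Y u) = lvar 0 {} + (\<Sum>w\<in>Y. if arrival w < u then jump (accb Y (arrival w)) w else 0)
      + (LINT s:{0<..u}|lborel. lvar' s (accb Y s))"
proof -
  let ?B = "before Y u"
  have "lvar u (acc ?B) = lvar 0 {} + (\<Sum>w\<in>?B. jump (accb ?B (arrival w)) w)
      + (LINT s:{0<..u}|lborel. lvar' s (accb ?B s))"
  proof (rule lvar_path_all[OF before_configs[OF Y] _ u])
    show "inj_on (\<lambda>w. arrival w) ?B" by (rule inj_on_subset[OF inj]) (auto simp: before_def)
  qed (auto simp: before_def)
  also have "(\<Sum>w\<in>?B. jump (accb ?B (arrival w)) w) = (\<Sum>w\<in>?B. jump (accb Y (arrival w)) w)"
    by (rule sum.cong) (auto simp: before_def accb_before[unfolded before_def])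
  also have "\<dots> = (\<Sum>w\<in>Y. if arrival w < u then jump (accb Y (arrival w)) w else 0)"
    unfolding before_def by (rule sum.inter_filter[OF configs_W(1)[OF Y]])
  also have "(LINT s:{0<..u}|lborel. lvar' s (accb ?B s)) = (LINT s:{0<..u}|lborel. lvar' s (accb Y s))"
    by (rule set_lebesgue_integral_cong) (auto simp: accb_before)
  finally show ?thesis by (simp add: accb_def)
qed

section \<open>Almost sure absence of prescribed and of simultaneous arrival times\<close>

lemma emeasure_time_slice: "emeasure lborel {w::'a \<times> real \<times> real. arrival w = s} = 0"
proof -
  have sf: "sigma_finite_measure (lborel \<Otimes>\<^sub>M lborel :: (real \<times> real) measure)"
    by (simp add: lborel_prod sigma_finite_lborel)
  have "{w::'a \<times> real \<times> real. arrival w = s} = UNIV \<times> ({s} \<times> UNIV)" by auto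
  then have "emeasure lborel {w::'a \<times> real \<times> real. arrival w = s}
      = emeasure (lborel \<Otimes>\<^sub>M (lborel \<Otimes>\<^sub>M lborel)) ((UNIV :: 'a set) \<times> ({s} \<times> (UNIV :: real set)))"
    by (simp only: lborel_prod)
  also have "\<dots> = emeasure lborel (UNIV :: 'a set) * emeasure (lborel \<Otimes>\<^sub>M lborel) ({s} \<times> (UNIV :: real set))"
    by (rule sigma_finite_measure.emeasure_pair_measure_Times[OF sf]) auto
  also have "emeasure (lborel \<Otimes>\<^sub>M lborel) ({s} \<times> (UNIV :: real set)) = 0"
    by (subst lborel.emeasure_pair_measure_Times) auto
  finally show ?thesis by simp
qed

lemma time_slice_borel: "{w::'a \<times> real \<times> real. arrival w = s} \<in> sets borel"
  by (intro borel_closed closed_Collect_eq continuous_intros)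

lemma AE_no_arrival: "AE Y in W.LP. \<forall>w\<in>Y. arrival w \<noteq> s"
  using W.AE_LP_disjoint[OF time_slice_borel emeasure_time_slice, of s]
  by (auto elim!: eventually_mono)

text \<open>Mecke for the number of points sharing the arrival time of a marked point: a time slice
  is a null set, so the inner integral vanishes, and the total number of coincidences is almost
  everywhere 0.\<close>

lemma AE_distinct_arrivals: "AE Y in W.LP. inj_on (\<lambda>w. arrival w) Y"
proof -
  let ?F = "\<lambda>w Y. of_nat (card {v \<in> Y. arrival v = arrival w}) :: ennreal"
  have am: "(\<lambda>p. arrival (fst p)) \<in> borel_measurable (W.L \<Otimes>\<^sub>M W.CS)"
    by (rule measurable_compose[OF measurable_fst arrival_measurable])
  have "(\<lambda>p. card {v \<in> snd p. arrival v = arrival (fst p)}) \<in> measurable (W.L \<Otimes>\<^sub>M W.CS) (count_space UNIV)"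
  proof (rule W.measurable_card_filter[OF measurable_snd])
    have [measurable]: "(\<lambda>p. arrival (snd p)) \<in> borel_measurable ((W.L \<Otimes>\<^sub>M W.CS) \<Otimes>\<^sub>M W.L)"
      by (rule measurable_compose[OF measurable_snd arrival_measurable])
    have [measurable]: "(\<lambda>p. arrival (fst (fst p))) \<in> borel_measurable ((W.L \<Otimes>\<^sub>M W.CS) \<Otimes>\<^sub>M W.L)"
      by (rule measurable_compose[OF measurable_fst am])
    show "{p \<in> space ((W.L \<Otimes>\<^sub>M W.CS) \<Otimes>\<^sub>M W.L). arrival (snd p) = arrival (fst (fst p))}
        \<in> sets ((W.L \<Otimes>\<^sub>M W.CS) \<Otimes>\<^sub>M W.L)" by measurable
  qed
  then have m: "(\<lambda>p. ?F (fst p) (snd p)) \<in> borel_measurable (W.L \<Otimes>\<^sub>M W.CS)"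
    by (rule measurable_compose) simp
  have zero: "(\<integral>\<^sup>+Y. ?F w Y \<partial>W.LP) = 0" for w
  proof -
    have "AE Y in W.LP. ?F w Y = 0"
      using AE_no_arrival[of "arrival w"]
    proof eventually_elim
      case (elim Y)
      then have "{v \<in> Y. arrival v = arrival w} = {}" by auto
      then show ?case by (simp only: card.empty of_nat_0)
    qed
    then have "(\<integral>\<^sup>+Y. ?F w Y \<partial>W.LP) = (\<integral>\<^sup>+Y. 0 \<partial>W.LP)" by (rule nn_integral_cong_AE)
    then show ?thesis by simp
  qed
  have "(\<integral>\<^sup>+Y. (\<Sum>w\<in>Y. ?F w (Y - {w})) \<partial>W.LP) = (\<integral>\<^sup>+w. (\<integral>\<^sup>+Y. ?F w Y \<partial>W.LP) \<partial>W.L)"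
    by (rule W.mecke_nn[of ?F, OF m])
  also have "\<dots> = 0" by (simp only: zero) simp
  finally have "(\<integral>\<^sup>+Y. (\<Sum>w\<in>Y. ?F w (Y - {w})) \<partial>W.LP) = 0" .
  then have "AE Y in W.LP. (\<Sum>w\<in>Y. ?F w (Y - {w})) = 0"
    using W.measurable_sum_remove[of ?F, OF m] by (subst (asm) nn_integral_0_iff_AE) (auto cong: measurable_cong_sets)
  then show ?thesis using AE_space
  proof eventually_elim
    case (elim Y)
    then have fin: "finite Y" by (simp add: configs_def)
    show ?case
    proof (rule inj_onI, rule ccontr)
      fix v w assume vw: "v \<in> Y" "w \<in> Y" "arrival v = arrival w" "v \<noteq> w"
      have "card {v \<in> Y - {w}. arrival v = arrival w} = 0" using elim(1) fin vw(2) by auto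
      then have "{v \<in> Y - {w}. arrival v = arrival w} = {}" using fin by simp
      then show False using vw by blast
    qed
  qed
qed

end

section \<open>Expected variance along the process\<close>

context region
begin

lemma tame2_Fubini:
  assumes F: "tame2 F"
  shows "(\<integral>x. (\<integral>\<eta>. F x \<eta> \<partial>LP) \<partial>L) = (\<integral>\<eta>. (\<integral>x. F x \<eta> \<partial>L) \<partial>LP)"
proof -
  interpret LLP: pair_sigma_finite L LP ..
  have m: "(\<lambda>p. F (fst p) (snd p)) \<in> borel_measurable (L \<Otimes>\<^sub>M LP)"
    using tame2_measurable[OF F] by (simp cong: measurable_cong_sets)
  have absF: "tame2 (\<lambda>x \<eta>. \<bar>F x \<eta>\<bar>)"
    using F
  proof (rule tame2E)
    fix K r assume "(\<lambda>p. F (fst p) (snd p)) \<in> borel_measurable (L \<Otimes>\<^sub>M CS)" "0 \<le> K" "1 \<le> r"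
      "\<And>x \<eta>. x \<in> \<Lambda> \<Longrightarrow> \<eta> \<in> configs \<Lambda> \<Longrightarrow> \<bar>F x \<eta>\<bar> \<le> K * r ^ card \<eta>"
    then show ?thesis by (intro tame2I[of _ K r]) auto
  qed
  have "integrable (L \<Otimes>\<^sub>M LP) (\<lambda>p. F (fst p) (snd p))"
    by (rule LLP.Fubini_integrable[OF m])
      (use tame2_integrable[OF absF] tame_integrable[OF tame2_section[OF F]] in \<open>auto intro!: AE_I2\<close>)
  then show ?thesis using LLP.Fubini_integral[of F] by (simp add: split_beta')
qed

end

context negative_fields
begin

lemma jump_bound: "A \<in> configs \<Lambda> \<Longrightarrow> p \<in> W \<Longrightarrow> \<bar>jump A p\<bar> \<le> 1"
  using lvar_bounds[of A "arrival p"] lvar_bounds[OF configs_insert, of A "fst p" "arrival p"]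
  by (auto simp: jump_def W_def)

lemma lvar_jump_measurable:
  assumes A: "A \<in> measurable Q CS" and p: "p \<in> measurable Q W.L"
  shows "(\<lambda>q. jump (A q) (p q)) \<in> borel_measurable Q"
proof -
  note s = measurable_compose[OF p arrival_measurable] and x = measurable_compose[OF p fst_W_measurable]
  have [measurable]: "(\<lambda>q. lvar (arrival (p q)) (insert (fst (p q)) (A q)) - lvar (arrival (p q)) (A q)) \<in> borel_measurable Q"
    by (intro borel_measurable_diff lvar_measurable s measurable_insert_config A x)
  note accepts_measurable[OF A p, measurable]
  show ?thesis unfolding jump_def by measurable
qed

text \<open>\<open>jump_rate_integral\<close> expresses the form through \<open>lvar\<close> and its
  derivative, whose joint measurability is known; the mean shift need not be treated.\<close>

lemma dirichlet_measurable:
  assumes s: "s \<in> borel_measurable Q" and \<xi>: "\<xi> \<in> measurable Q CS"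
  shows "(\<lambda>q. dirichlet (s q) (\<xi> q)) \<in> borel_measurable Q"
proof -
  note s' = measurable_compose[OF measurable_fst s] and \<xi>' = measurable_compose[OF measurable_fst \<xi>]
  have "(\<lambda>p. \<iota> (loc (s (fst p)) (\<xi> (fst p))) (snd p)
      * (lvar (s (fst p)) (insert (snd p) (\<xi> (fst p))) - lvar (s (fst p)) (\<xi> (fst p)))) \<in> borel_measurable (Q \<Otimes>\<^sub>M L)"
    by (intro borel_measurable_times borel_measurable_diff iota_loc_measurable lvar_measurable
        measurable_insert_config s' \<xi>' measurable_snd)
  then have "(\<lambda>q. \<integral>x. \<iota> (loc (s q) (\<xi> q)) x * (lvar (s q) (insert x (\<xi> q)) - lvar (s q) (\<xi> q)) \<partial>L) \<in> borel_measurable Q"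
    by (intro L.borel_measurable_lebesgue_integral) (simp add: split_beta')
  then have "(\<lambda>q. - lvar' (s q) (\<xi> q) - (\<integral>x. \<iota> (loc (s q) (\<xi> q)) x * (lvar (s q) (insert x (\<xi> q)) - lvar (s q) (\<xi> q)) \<partial>L)) \<in> borel_measurable Q"
    by (intro borel_measurable_diff borel_measurable_uminus lvar'_measurable s \<xi>)
  then show ?thesis
    by (rule measurable_cong[THEN iffD1, rotated])
      (use measurable_space[OF \<xi>] in \<open>simp add: jump_rate_integral\<close>)
qed

text \<open>Fubini on the window with the mark innermost and time outermost: the mark integral
  produces the acceptance probability, the space integral the jump rate at a fixed time.\<close>

lemma integral_W:
  fixes g :: "'a \<times> real \<times> real \<Rightarrow> real"
  assumes g: "g \<in> borel_measurable W.L" and B: "\<And>w. w \<in> W \<Longrightarrow> \<bar>g w\<bar> \<le> B"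
    and K: "\<And>x s. x \<in> \<Lambda> \<Longrightarrow> s \<in> {0..t} \<Longrightarrow> (\<integral>l. indicator {0..1} l * g (x, s, l) \<partial>lborel) = K x s"
  shows "(\<integral>w. g w \<partial>W.L) = (\<integral>s. indicator {0..t} s * (\<integral>x. K x s \<partial>L) \<partial>lborel)"
proof -
  have Wb: "W \<in> sets borel" by (rule W.region_borel)
  \<comment> \<open>Extension by 0 to the whole space, where \<open>lborel\<close> is a product
    measure.\<close>
  define G where "G w = indicator W w * g w" for w
  have Gm: "G \<in> borel_measurable borel"
    using g Wb unfolding G_def
    by (subst (asm) borel_measurable_restrict_space_iff) (auto simp: mult.commute)
  have GB: "\<bar>G w\<bar> \<le> max 0 B" for w using B[of w] by (auto simp: G_def indicator_def)
  have iG: "integrable (lborel \<Otimes>\<^sub>M (lborel \<Otimes>\<^sub>M lborel)) G"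
  proof -
    have "integrable lborel (\<lambda>w. indicator W w *\<^sub>R G w)"
      by (rule integrableI_bounded_set_indicator[where B="max 0 B"])
        (use Wb Gm GB W.emeasure_L_finite in auto)
    moreover have "(\<lambda>w. indicator W w *\<^sub>R G w) = G" by (auto simp: fun_eq_iff G_def indicator_def)
    ultimately show ?thesis by (simp only: lborel_prod)
  qed
  have ip: "integrable (lborel \<Otimes>\<^sub>M lborel) (\<lambda>p. G (x, p))" for x
  proof -
    have "integrable (lborel \<Otimes>\<^sub>M lborel) (\<lambda>p. indicator ({0..t} \<times> {0..1}) p *\<^sub>R G (x, p))"
    proof (rule integrableI_bounded_set_indicator[where B="max 0 B"])
      show "(\<lambda>p. G (x, p)) \<in> borel_measurable (lborel \<Otimes>\<^sub>M lborel)"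
        unfolding lborel_prod using measurable_compose[OF _ Gm, of "\<lambda>p. (x, p)" lborel]
        by (auto intro: borel_measurable_Pair)
      show "emeasure (lborel \<Otimes>\<^sub>M lborel) ({0..t} \<times> {0..1::real}) < \<infinity>"
        using t_nonneg by (subst lborel.emeasure_pair_measure_Times) (auto simp: ennreal_mult_less_top)
    qed (use GB in auto)
    moreover have "(\<lambda>p. indicator ({0..t} \<times> {0..1}) p *\<^sub>R G (x, p)) = (\<lambda>p. G (x, p))"
      by (auto simp: fun_eq_iff G_def W_def indicator_def)
    ultimately show ?thesis by (simp only:)
  qed
  interpret P3: pair_sigma_finite "lborel :: 'a measure" "lborel \<Otimes>\<^sub>M lborel :: (real \<times> real) measure"
    by (intro pair_sigma_finite.intro sigma_finite_lborel) (simp add: lborel_prod sigma_finite_lborel)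
  have P2: "pair_sigma_finite (lborel :: real measure) (lborel :: real measure)"
    and Q2: "pair_sigma_finite (lborel :: 'a measure) (lborel :: real measure)"
    by (intro pair_sigma_finite.intro sigma_finite_lborel)+
  define R where "R x s = (indicator \<Lambda> x * indicator {0..t} s * K x s :: real)" for x s
  have R: "(\<integral>l. G (x, s, l) \<partial>lborel) = R x s" for x s
  proof (cases "x \<in> \<Lambda> \<and> s \<in> {0..t}")
    case True
    then have "(\<lambda>l. G (x, s, l)) = (\<lambda>l. indicator {0..1} l * g (x, s, l))"
      by (auto simp: G_def W_def indicator_def)
    then show ?thesis using K True by (simp add: R_def)
  next
    case False
    then have "(\<lambda>l. G (x, s, l)) = (\<lambda>l. 0)" by (auto simp: G_def W_def indicator_def)
    then show ?thesis using False by (auto simp: R_def)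
  qed
  have Rm: "(\<lambda>q. R (fst q) (snd q)) \<in> borel_measurable (lborel \<Otimes>\<^sub>M lborel)"
  proof -
    have "(\<lambda>q::('a \<times> real) \<times> real. (fst (fst q), snd (fst q), snd q)) \<in> borel_measurable ((lborel \<Otimes>\<^sub>M lborel) \<Otimes>\<^sub>M lborel)"
      unfolding lborel_prod measurable_lborel2 by (intro borel_measurable_continuous_onI continuous_intros)
    from measurable_compose[OF this Gm]
    have "(\<lambda>(q, l). G (fst q, snd q, l)) \<in> borel_measurable ((lborel \<Otimes>\<^sub>M lborel) \<Otimes>\<^sub>M lborel)"
      by (simp add: split_beta')
    from lborel.borel_measurable_lebesgue_integral[OF this] show ?thesis by (simp add: R)
  qed
  have RB: "\<bar>R x s\<bar> \<le> max 0 B" for x s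
  proof -
    have "\<bar>R x s\<bar> \<le> (\<integral>l. \<bar>G (x, s, l)\<bar> \<partial>lborel)" unfolding R[symmetric] by (rule integral_abs_bound)
    also have "\<dots> \<le> (\<integral>l. indicator {0..1::real} l * max 0 B \<partial>lborel)"
    proof (rule Bochner_Integration.integral_mono')
      show "integrable lborel (\<lambda>l. indicator {0..1::real} l * max 0 B)" by (intro integrable_mult_left) simp
      show "\<bar>G (x, s, l)\<bar> \<le> indicator {0..1} l * max 0 B" for l
        using GB[of "(x, s, l)"] by (auto simp: G_def W_def indicator_def)
    qed auto
    finally show ?thesis by simp
  qed
  have iR: "integrable (lborel \<Otimes>\<^sub>M lborel) (\<lambda>(x, s). R x s)"
  proof -
    have "integrable (lborel \<Otimes>\<^sub>M lborel) (\<lambda>q. indicator (\<Lambda> \<times> {0..t}) q *\<^sub>R R (fst q) (snd q))"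
    proof (rule integrableI_bounded_set_indicator[where B="max 0 B"])
      show "emeasure (lborel \<Otimes>\<^sub>M lborel) (\<Lambda> \<times> {0..t}) < \<infinity>"
        using region_borel emeasure_L_finite t_nonneg
        by (subst lborel.emeasure_pair_measure_Times) (auto simp: ennreal_mult_less_top)
    qed (use Rm RB region_borel in auto)
    moreover have "(\<lambda>q. indicator (\<Lambda> \<times> {0..t}) q *\<^sub>R R (fst q) (snd q)) = (\<lambda>(x, s). R x s)"
      by (auto simp: fun_eq_iff R_def indicator_def)
    ultimately show ?thesis by (simp only:)
  qed
  have "(\<integral>w. g w \<partial>W.L) = (\<integral>w. G w \<partial>lborel)"
    using Wb by (subst integral_restrict_space) (auto simp: G_def[abs_def])
  also have "\<dots> = (\<integral>w. G w \<partial>(lborel \<Otimes>\<^sub>M (lborel \<Otimes>\<^sub>M lborel)))" by (simp add: lborel_prod)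
  also have "\<dots> = (\<integral>x. (\<integral>p. G (x, p) \<partial>(lborel \<Otimes>\<^sub>M lborel)) \<partial>lborel)"
    by (rule P3.integral_fst'[OF iG, symmetric])
  also have "\<dots> = (\<integral>x. (\<integral>s. R x s \<partial>lborel) \<partial>lborel)"
    using pair_sigma_finite.integral_fst'[OF P2 ip] by (simp add: R)
  also have "\<dots> = (\<integral>s. (\<integral>x. R x s \<partial>lborel) \<partial>lborel)"
    by (rule pair_sigma_finite.Fubini_integral[OF Q2 iR, symmetric])
  also have "\<dots> = (\<integral>s. indicator {0..t} s * (\<integral>x. K x s \<partial>L) \<partial>lborel)"
  proof (intro Bochner_Integration.integral_cong refl)
    fix s
    have "(\<integral>x. R x s \<partial>lborel) = (\<integral>x. indicator {0..t} s * (indicator \<Lambda> x * K x s) \<partial>lborel)"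
      by (simp add: R_def mult_ac)
    also have "\<dots> = indicator {0..t} s * (\<integral>x. K x s \<partial>L)"
      using region_borel by (subst integral_restrict_space) auto
    finally show "(\<integral>x. R x s \<partial>lborel) = indicator {0..t} s * (\<integral>x. K x s \<partial>L)" .
  qed
  finally show ?thesis .
qed

lemma dirichlet_accb_measurable:
  "Y \<in> configs W \<Longrightarrow> (\<lambda>s. dirichlet s (accb Y s)) \<in> borel_measurable borel"
  "Y \<in> configs W \<Longrightarrow> (\<lambda>s. lvar' s (accb Y s)) \<in> borel_measurable borel"
  by (intro dirichlet_measurable lvar'_measurable accb_measurable measurable_const measurable_ident_sets; simp)+

text \<open>Integrating the mark turns acceptance into the probability \<open>\<iota> / c\<close>,
  and the intensity \<open>c\<close> of the driving process cancels the denominator. What remains at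
  each time is the integral computed in \<open>jump_rate_integral\<close>.\<close>

lemma jump_integral:
  assumes Y: "Y \<in> configs W" and u: "0 \<le> u" "u \<le> t"
  shows "c * (\<integral>w. (if arrival w < u then jump (accb Y (arrival w)) w else 0) \<partial>W.L)
    = (LINT s:{0<..u}|lborel. - lvar' s (accb Y s) - dirichlet s (accb Y s))"
proof -
  note A = accb_configs[OF Y]
  let ?g = "\<lambda>w. if arrival w < u then jump (accb Y (arrival w)) w else 0"
  let ?D = "\<lambda>s x. lvar s (insert x (accb Y s)) - lvar s (accb Y s)"
  let ?K = "\<lambda>x s. if s < u then \<iota> (loc s (accb Y s)) x / c * ?D s x else 0"
  let ?H = "\<lambda>s. - lvar' s (accb Y s) - dirichlet s (accb Y s)"
  have gm: "?g \<in> borel_measurable W.L"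
  proof -
    have [measurable]: "(\<lambda>w. jump (accb Y (arrival w)) w) \<in> borel_measurable W.L"
      using Y by (intro lvar_jump_measurable accb_measurable arrival_measurable measurable_const measurable_ident_sets) auto
    note arrival_measurable [measurable]
    show ?thesis by measurable
  qed
  have K: "(\<integral>l. indicator {0..1} l * ?g (x, s, l) \<partial>lborel) = ?K x s" if x: "x \<in> \<Lambda>" and s: "s \<in> {0..t}" for x s
  proof (cases "s < u")
    case True
    let ?a = "\<iota> (loc s (accb Y s)) x / c"
    \<comment> \<open>The activity at a time \<open>s \<ge> 0\<close> is bounded by
      \<open>c\<close>, so the accepting marks in [0,1] are exactly those in
      \<open>{0..?a}\<close>.\<close>
    have a: "0 \<le> ?a" "?a \<le> 1"
      using iota_bounds[OF loc_act_c[OF A, of s s] x] s c_pos by (auto simp: divide_le_eq)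
    have "(\<lambda>l. indicator {0..1} l * ?g (x, s, l)) = (\<lambda>l. indicator {0..?a} l * ?D s x)"
      using True a by (auto simp: jump_def accepts_def indicator_def fun_eq_iff)
    then show ?thesis using True a by simp
  qed simp
  have "c * (\<integral>w. ?g w \<partial>W.L) = c * (\<integral>s. indicator {0..t} s * (\<integral>x. ?K x s \<partial>L) \<partial>lborel)"
    by (subst integral_W[OF gm _ K, of 1]) (use jump_bound[OF A] in auto)
  also have "\<dots> = (\<integral>s. c * (indicator {0..t} s * (\<integral>x. ?K x s \<partial>L)) \<partial>lborel)" by simp
  also have "\<dots> = (\<integral>s. indicator {0..<u} s *\<^sub>R ?H s \<partial>lborel)"
  proof (intro Bochner_Integration.integral_cong refl)
    fix s
    have "(\<integral>x. \<iota> (loc s (accb Y s)) x / c * ?D s x \<partial>L) = (\<integral>x. (\<iota> (loc s (accb Y s)) x * ?D s x) / c \<partial>L)"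
      by (simp add: divide_inverse mult_ac)
    also have "\<dots> = ?H s / c" using jump_rate_integral[OF A, of s s] by simp
    finally have "c * (\<integral>x. \<iota> (loc s (accb Y s)) x / c * ?D s x \<partial>L) = ?H s" using c_pos by simp
    then show "c * (indicator {0..t} s * (\<integral>x. ?K x s \<partial>L)) = indicator {0..<u} s *\<^sub>R ?H s"
      using u by (cases "s < u") (auto simp: indicator_def)
  qed
  \<comment> \<open>Jumps strictly before \<open>u\<close> give the interval closed on the left, the
    path identity the one closed on the right; they differ by two points.\<close>
  also have "\<dots> = (\<integral>s. indicator {0<..u} s *\<^sub>R ?H s \<partial>lborel)"
  proof (rule integral_cong_AE)
    note dirichlet_accb_measurable[OF Y, measurable]
    show "(\<lambda>s. indicator {0..<u} s *\<^sub>R ?H s) \<in> borel_measurable lborel"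
      "(\<lambda>s. indicator {0<..u} s *\<^sub>R ?H s) \<in> borel_measurable lborel" by measurable
    show "AE s in lborel. indicator {0..<u} s *\<^sub>R ?H s = indicator {0<..u} s *\<^sub>R ?H s"
      using AE_lborel_singleton[of 0] AE_lborel_singleton[of u]
      by eventually_elim (auto simp: indicator_def)
  qed
  finally show ?thesis unfolding set_lebesgue_integral_def .
qed

end

text \<open>Monotonicity of \<open>C\<close> alone suffices: iterate the step inequality on a grid
  of mesh \<open>t / n\<close>, bound the product of the factors \<open>1 - C * h\<close> from below
  by an exponential, compare the left Riemann sum with the integral, and let \<open>n\<close> tend
  to infinity.\<close>

lemma gronwall_antimono:
  fixes V C :: "real \<Rightarrow> real"
  assumes t: "0 \<le> t" and C0: "\<And>s. 0 \<le> C s" and C: "\<And>r s. r \<le> s \<Longrightarrow> C s \<le> C r"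
    and V0: "\<And>s. 0 \<le> V s"
    and step: "\<And>r u. 0 \<le> r \<Longrightarrow> r \<le> u \<Longrightarrow> u \<le> t \<Longrightarrow> V r * (1 - C r * (u - r)) \<le> V u"
  shows "exp (- (LINT s:{0..t}|lborel. C s)) * V 0 \<le> V t"
proof -
  have Cm: "C \<in> borel_measurable borel"
  proof -
    have "mono (\<lambda>s. - C s)" using C by (auto simp: mono_def)
    then have "(\<lambda>s. - (- C s)) \<in> borel_measurable borel" by (intro borel_measurable_uminus borel_measurable_mono)
    then show ?thesis by simp
  qed
  have si: "set_integrable lborel {a..b} C" if "0 \<le> a" for a b
    unfolding set_integrable_def
  proof (rule integrableI_bounded_set_indicator[where B="C 0"])
    show "AE s in lborel. s \<in> {a..b} \<longrightarrow> norm (C s) \<le> C 0" using C C0 that by (intro AE_I2) auto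
  qed (use Cm in \<open>auto simp: emeasure_lborel_Icc_eq\<close>)
  note io = set_borel_integral_eq_integral(1)[OF si]
  let ?I = "integral {0..t} C"
  have I: "(LINT s:{0..t}|lborel. C s) = ?I" by (rule set_borel_integral_eq_integral(2)[OF si]) simp
  \<comment> \<open>Error terms at mesh \<open>h\<close>: \<open>C 0 * h\<close> from the left
    Riemann sum, and \<open>n\<close> times twice the square of \<open>C 0 * h\<close> from
    replacing each factor by an exponential, where \<open>n * h = t\<close>.\<close>
  have bound: "exp (- ?I - (C 0 * h + 2 * t * (C 0)\<^sup>2 * h)) * V 0 \<le> V t"
    if n: "0 < n" and h: "h = t / real n" and small: "C 0 * h \<le> 1 / 2" for n h
  proof -
    have h0: "0 \<le> h" using t n h by simp
    have nh: "real n * h = t" using n h by simp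
    have "real k \<le> real n \<Longrightarrow> real k * h \<le> t" for k using mult_right_mono[OF _ h0, of "real k" "real n"] nh by simp
    then have kh: "k \<le> n \<Longrightarrow> real k * h \<le> t" for k by simp
    have kh0: "0 \<le> real k * h" for k using h0 by simp
    have V: "k \<le> n \<Longrightarrow> exp (- (\<Sum>i<k. C (real i * h) * h + 2 * (C 0 * h)\<^sup>2)) * V 0 \<le> V (real k * h)" for k
    proof (induction k)
      case (Suc k)
      let ?x = "C (real k * h) * h" and ?S = "\<Sum>i<k. C (real i * h) * h + 2 * (C 0 * h)\<^sup>2"
      have Ck: "C (real k * h) \<le> C 0" using C[OF kh0] by simp
      have x: "0 \<le> ?x" "?x \<le> C 0 * h" using C0 h0 Ck by (auto intro: mult_right_mono)
      have "?x\<^sup>2 \<le> (C 0 * h)\<^sup>2" using x by (intro power_mono) auto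
      then have "- (?x + 2 * (C 0 * h)\<^sup>2) \<le> - ?x - 2 * ?x\<^sup>2" by simp
      \<comment> \<open>This logarithmic bound holds for arguments up to 1/2, hence the condition
        \<open>small\<close>.\<close>
      also have "\<dots> \<le> ln (1 - ?x)" using x small by (intro ln_one_minus_pos_lower_bound) auto
      finally have "exp (- (?x + 2 * (C 0 * h)\<^sup>2)) \<le> exp (ln (1 - ?x))" by (rule exp_le_cancel_iff[THEN iffD2])
      also have "exp (ln (1 - ?x)) = 1 - ?x" using x small by (intro exp_ln) linarith
      finally have e: "exp (- (?x + 2 * (C 0 * h)\<^sup>2)) \<le> 1 - ?x" .
      have "exp (- (?S + (?x + 2 * (C 0 * h)\<^sup>2))) * V 0 = exp (- ?S) * V 0 * exp (- (?x + 2 * (C 0 * h)\<^sup>2))"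
        by (simp add: exp_add[symmetric] mult_ac)
      also have "\<dots> \<le> V (real k * h) * (1 - ?x)"
        using Suc e V0 by (intro mult_mono) auto
      also have "\<dots> = V (real k * h) * (1 - C (real k * h) * (real (Suc k) * h - real k * h))"
        by (simp add: algebra_simps)
      also have "\<dots> \<le> V (real (Suc k) * h)"
        using Suc.prems h0 by (intro step kh0 kh mult_right_mono) auto
      finally show ?case by simp
    qed simp
    \<comment> \<open>On each cell a non-increasing \<open>C\<close> is at least its right endpoint
      value; passing from right to left endpoints afterwards costs the single term
      \<open>C 0 * h\<close>.\<close>
    have low: "k \<le> n \<Longrightarrow> (\<Sum>i<k. C (real (Suc i) * h) * h) \<le> integral {0..real k * h} C" for k
    proof (induction k)
      case (Suc k)
      have "C (real (Suc k) * h) * h = integral {real k * h..real (Suc k) * h} (\<lambda>_. C (real (Suc k) * h))"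
        using h0 by (simp add: algebra_simps)
      also have "\<dots> \<le> integral {real k * h..real (Suc k) * h} C"
        using C kh0 by (intro integral_le io) auto
      finally have "(\<Sum>i<Suc k. C (real (Suc i) * h) * h)
          \<le> integral {0..real k * h} C + integral {real k * h..real (Suc k) * h} C" using Suc by simp
      also have "\<dots> = integral {0..real (Suc k) * h} C"
        using h0 by (intro Henstock_Kurzweil_Integration.integral_combine io) (auto simp: algebra_simps)
      finally show ?case .
    qed simp
    have "(\<Sum>i<n. C (real i * h) * h) \<le> C 0 * h + (\<Sum>i<n. C (real (Suc i) * h) * h)"
    proof -
      have "(\<Sum>i<n. C (real i * h) * h) \<le> (\<Sum>i<Suc n. C (real i * h) * h)" using C0 h0 by simp
      also have "\<dots> = C 0 * h + (\<Sum>i<n. C (real (Suc i) * h) * h)" by (subst sum.lessThan_Suc_shift) simp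
      finally show ?thesis .
    qed
    also have "\<dots> \<le> C 0 * h + ?I" using low[of n] nh by simp
    finally have S: "(\<Sum>i<n. C (real i * h) * h) \<le> C 0 * h + ?I" .
    have "real n * (2 * (C 0 * h)\<^sup>2) = 2 * (real n * h) * (C 0)\<^sup>2 * h"
      by (simp add: power2_eq_square)
    then have "(\<Sum>i<n. C (real i * h) * h + 2 * (C 0 * h)\<^sup>2) = (\<Sum>i<n. C (real i * h) * h) + 2 * t * (C 0)\<^sup>2 * h"
      by (simp add: sum.distrib nh)
    with S have "(\<Sum>i<n. C (real i * h) * h + 2 * (C 0 * h)\<^sup>2) \<le> C 0 * h + ?I + 2 * t * (C 0)\<^sup>2 * h"
      by linarith
    then have "exp (- ?I - (C 0 * h + 2 * t * (C 0)\<^sup>2 * h)) * V 0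
        \<le> exp (- (\<Sum>i<n. C (real i * h) * h + 2 * (C 0 * h)\<^sup>2)) * V 0"
      using V0 by (intro mult_right_mono) auto
    also have "\<dots> \<le> V t" using V[of n] nh by simp
    finally show ?thesis .
  qed
  have h: "(\<lambda>n. t / real n) \<longlonglongrightarrow> 0" by (rule lim_const_over_n)
  have lim: "(\<lambda>n. exp (- ?I - (C 0 * (t / real n) + 2 * t * (C 0)\<^sup>2 * (t / real n))) * V 0)
      \<longlonglongrightarrow> exp (- ?I - (C 0 * 0 + 2 * t * (C 0)\<^sup>2 * 0)) * V 0"
    by (intro tendsto_intros h)
  have "eventually (\<lambda>n. C 0 * (t / real n) < 1 / 2) sequentially"
    using tendsto_mult_left[OF h, of "C 0"] by (intro order_tendstoD(2)) auto
  then have "eventually (\<lambda>n. exp (- ?I - (C 0 * (t / real n) + 2 * t * (C 0)\<^sup>2 * (t / real n))) * V 0 \<le> V t) sequentially"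
    using eventually_gt_at_top[of 0] by eventually_elim (rule bound, auto)
  from tendsto_upperbound[OF lim this] show ?thesis by (simp add: I)
qed

section \<open>Expectation over the driving Poisson process\<close>

context negative_fields
begin

abbreviation "P \<equiv> W.poisson_law c"

lemma prob_space_P: "prob_space P"
  using c_pos by (intro W.prob_space_poisson_law) simp

sublocale P: prob_space P by (rule prob_space_P)

lemma prob_configs_W [simp]: "P.prob (configs W) = 1"
  using P.prob_space by simp

lemma integrable_P:
  fixes h :: "('a \<times> real \<times> real) set \<Rightarrow> real"
  assumes "h \<in> borel_measurable W.CS" "\<And>Y. Y \<in> configs W \<Longrightarrow> \<bar>h Y\<bar> \<le> B"
  shows "integrable P h"
  using assms by (intro P.integrable_const_bound[where B=B]) (auto cong: measurable_cong_sets intro!: AE_I2)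

lemma accb_P_measurable: "(\<lambda>Y. accb Y s) \<in> measurable W.CS CS"
  by (intro accb_measurable measurable_ident_sets measurable_const) auto

lemma jump_term_measurable:
  "(\<lambda>p. if arrival (fst p) < u then jump (accb (snd p) (arrival (fst p))) (fst p) else 0)
    \<in> borel_measurable (W.L \<Otimes>\<^sub>M W.CS)"
proof -
  have [measurable]: "(\<lambda>p. arrival (fst p)) \<in> borel_measurable (W.L \<Otimes>\<^sub>M W.CS)"
    by (rule measurable_compose[OF measurable_fst arrival_measurable])
  have [measurable]: "(\<lambda>p. jump (accb (snd p) (arrival (fst p))) (fst p)) \<in> borel_measurable (W.L \<Otimes>\<^sub>M W.CS)"
    by (intro lvar_jump_measurable accb_measurable measurable_fst measurable_snd
        measurable_compose[OF measurable_fst arrival_measurable])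
  show ?thesis by measurable
qed

lemma jump_term_tame2:
  "W.tame2 (\<lambda>w Y. if arrival w < u then jump (accb Y (arrival w)) w else 0)"
proof (rule W.tame2I[of _ 1 1])
  show "\<bar>if arrival w < u then jump (accb Y (arrival w)) w else 0\<bar> \<le> 1 * 1 ^ card Y"
    if "w \<in> W" "Y \<in> configs W" for w Y
    using jump_bound[OF accb_configs[OF that(2)] that(1)] by simp
qed (use jump_term_measurable in auto)

text \<open>The compensator formula: Mecke replaces the sum over arrivals by an integral over the
  window, the jump of \<open>w\<close> being the same with or without \<open>w\<close> in the
  configuration, and \<open>jump_integral\<close> evaluates that integral for each fixed
  path.\<close>

lemma jump_sum_expectation:
  assumes u: "0 \<le> u" "u \<le> t"
  shows "(\<integral>Y. (\<Sum>w\<in>Y. if arrival w < u then jump (accb Y (arrival w)) w else 0) \<partial>P)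
    = (\<integral>Y. (LINT s:{0<..u}|lborel. - lvar' s (accb Y s) - dirichlet s (accb Y s)) \<partial>P)"
    and jump_sum_measurable:
      "(\<lambda>Y. \<Sum>w\<in>Y. if arrival w < u then jump (accb Y (arrival w)) w else 0) \<in> borel_measurable W.CS"
proof -
  let ?j = "\<lambda>w Y. if arrival w < u then jump (accb Y (arrival w)) w else 0"
  \<comment> \<open>The power of \<open>c\<close> is the Poisson density up to normalisation; the
    further factor \<open>c\<close> belongs to the removed point and becomes the intensity.\<close>
  let ?F = "\<lambda>w Y. c ^ card Y * (c * ?j w Y)"
  let ?\<kappa> = "exp (- (c * measure lborel W))"
  have F: "W.tame2 ?F"
    by (intro W.tame2_mult W.tame2_const jump_term_tame2 W.tame2_config W.tame_power_card)
  have rem: "?j w (Y - {w}) = ?j w Y" for w Y by (simp add: accb_remove)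
  have sum: "(\<Sum>w\<in>Y. ?F w (Y - {w})) = c ^ card Y * (\<Sum>w\<in>Y. ?j w Y)" if "Y \<in> configs W" for Y
    unfolding sum_distrib_left
  proof (rule sum.cong[OF refl])
    fix w assume "w \<in> Y"
    then have "card Y = Suc (card (Y - {w}))" using configs_W(1)[OF that] by (metis card_Suc_Diff1)
    then show "?F w (Y - {w}) = c ^ card Y * ?j w Y" unfolding rem by simp
  qed
  have tj: "W.tame (\<lambda>Y. \<Sum>w\<in>Y. ?j w (Y - {w}))" by (rule W.tame_sum_remove[OF jump_term_tame2])
  then show m: "(\<lambda>Y. \<Sum>w\<in>Y. ?j w Y) \<in> borel_measurable W.CS" unfolding rem by (rule W.tame_measurable)
  have sec: "(\<lambda>Y. \<integral>w. ?j w Y \<partial>W.L) \<in> borel_measurable W.CS"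
  proof (rule W.L.borel_measurable_lebesgue_integral)
    have "(\<lambda>q. (snd q, fst q)) \<in> measurable (W.CS \<Otimes>\<^sub>M W.L) (W.L \<Otimes>\<^sub>M W.CS)" by measurable
    from measurable_compose[OF this jump_term_measurable, unfolded fst_conv snd_conv]
    show "(\<lambda>(Y, w). ?j w Y) \<in> borel_measurable (W.CS \<Otimes>\<^sub>M W.L)" unfolding split_beta' .
  qed
  have "(\<integral>Y. (\<Sum>w\<in>Y. ?j w Y) \<partial>P) = ?\<kappa> * (\<integral>Y. c ^ card Y * (\<Sum>w\<in>Y. ?j w Y) \<partial>W.LP)"
    using c_pos by (intro W.integral_poisson_law m) simp
  also have "(\<integral>Y. c ^ card Y * (\<Sum>w\<in>Y. ?j w Y) \<partial>W.LP) = (\<integral>Y. (\<Sum>w\<in>Y. ?F w (Y - {w})) \<partial>W.LP)"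
    by (intro Bochner_Integration.integral_cong refl) (simp only: sum W.space_LP)
  also have "\<dots> = (\<integral>w. (\<integral>Y. ?F w Y \<partial>W.LP) \<partial>W.L)" by (rule W.mecke[OF F])
  also have "\<dots> = (\<integral>Y. (\<integral>w. ?F w Y \<partial>W.L) \<partial>W.LP)" by (rule W.tame2_Fubini[OF F])
  also have "\<dots> = (\<integral>Y. c ^ card Y * (c * (\<integral>w. ?j w Y \<partial>W.L)) \<partial>W.LP)" by simp
  also have "?\<kappa> * \<dots> = (\<integral>Y. c * (\<integral>w. ?j w Y \<partial>W.L) \<partial>P)"
    using c_pos sec by (intro W.integral_poisson_law[symmetric]) auto
  also have "\<dots> = (\<integral>Y. (LINT s:{0<..u}|lborel. - lvar' s (accb Y s) - dirichlet s (accb Y s)) \<partial>P)"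
    by (intro Bochner_Integration.integral_cong refl) (simp only: W.space_poisson_law jump_integral[OF _ u])
  finally show "(\<integral>Y. (\<Sum>w\<in>Y. ?j w Y) \<partial>P)
    = (\<integral>Y. (LINT s:{0<..u}|lborel. - lvar' s (accb Y s) - dirichlet s (accb Y s)) \<partial>P)" .
qed

definition V :: "real \<Rightarrow> real" where "V u = (\<integral>Y. lvar u (accb Y u) \<partial>P)"

lemma V_bounds: "0 \<le> V u"
  unfolding V_def using lvar_bounds(1)[OF accb_configs]
  by (intro Bochner_Integration.integral_nonneg_AE AE_I2) simp

lemma lvar_accb_measurable: "(\<lambda>Y. lvar u (accb Y u)) \<in> borel_measurable W.CS"
  by (intro lvar_measurable accb_P_measurable measurable_const) auto

lemma integrable_lvar_accb: "integrable P (\<lambda>Y. lvar u (accb Y u))"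
  by (rule integrable_P[OF lvar_accb_measurable, of _ 1]) (use lvar_bounds accb_configs in \<open>auto simp: abs_le_iff intro: order_trans[of _ 0]\<close>)

lemma AE_P_distinct: "AE Y in P. inj_on (\<lambda>w. arrival w) Y"
  by (rule W.AE_poisson_law[OF AE_distinct_arrivals])

lemma time_integral_measurable:
  fixes h :: "('a \<times> real \<times> real) set \<Rightarrow> real \<Rightarrow> real"
  assumes "(\<lambda>p. h (fst p) (snd p)) \<in> borel_measurable (W.CS \<Otimes>\<^sub>M borel)"
  shows "(\<lambda>Y. LINT s:{r<..u}|lborel. h Y s) \<in> borel_measurable W.CS"
proof -
  have "(\<lambda>p. indicator {r<..u} (snd p) *\<^sub>R h (fst p) (snd p)) \<in> borel_measurable (W.CS \<Otimes>\<^sub>M borel)"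
    by (intro borel_measurable_scaleR assms measurable_compose[OF measurable_snd] borel_measurable_indicator) simp
  then have "(\<lambda>(Y, s). indicator {r<..u} s *\<^sub>R h Y s) \<in> borel_measurable (W.CS \<Otimes>\<^sub>M lborel)"
    by (simp add: split_beta' cong: measurable_cong_sets)
  then show ?thesis unfolding set_lebesgue_integral_def
    by (rule lborel.borel_measurable_lebesgue_integral)
qed

lemma accb_joint_measurable: "(\<lambda>p. accb (fst p) (snd p)) \<in> measurable (W.CS \<Otimes>\<^sub>M borel) CS"
  by (intro accb_measurable measurable_fst measurable_snd)

lemma dirichlet_joint: "(\<lambda>p. dirichlet (snd p) (accb (fst p) (snd p))) \<in> borel_measurable (W.CS \<Otimes>\<^sub>M borel)"
  by (intro dirichlet_measurable accb_joint_measurable measurable_snd)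

lemma lvar'_joint: "(\<lambda>p. lvar' (snd p) (accb (fst p) (snd p))) \<in> borel_measurable (W.CS \<Otimes>\<^sub>M borel)"
  by (intro lvar'_measurable accb_joint_measurable measurable_snd)

section \<open>Decay of the expected variance when the volume is positive and the influence constant
  is a genuine infimum\<close>

context
  assumes vol: "0 < measure lborel \<Lambda>"
begin

abbreviation "IC s \<equiv> influence_const \<phi> \<Lambda> (exp (- s) * c)"

lemma IC_nonneg: "0 \<le> IC s"
  using c_pos by (intro influence_const_nonneg vol) simp

lemma IC_antimono: "r \<le> s \<Longrightarrow> IC s \<le> IC r"
  using c_pos by (intro influence_const_mono vol) auto

lemma dirichlet_le: assumes "A \<in> configs \<Lambda>" shows "dirichlet s A \<le> IC s" "\<bar>dirichlet s A\<bar> \<le> IC s"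
proof -
  have "IC s * lvar s A \<le> IC s * 1" using lvar_bounds[OF assms] IC_nonneg by (intro mult_left_mono) auto
  then show "dirichlet s A \<le> IC s" using dirichlet_bounds(2)[OF assms vol, of s] by simp
  then show "\<bar>dirichlet s A\<bar> \<le> IC s" using dirichlet_bounds(1)[OF assms vol, of s] by simp
qed

lemma
  assumes Y: "Y \<in> configs W" and r: "0 \<le> r" "r \<le> u"
  shows dirichlet_accb_integrable: "set_integrable lborel {r<..u} (\<lambda>s. dirichlet s (accb Y s))"
    and dirichlet_accb_bound: "\<bar>LINT s:{r<..u}|lborel. dirichlet s (accb Y s)\<bar> \<le> IC 0 * (u - r)"
proof -
  have "\<bar>dirichlet s (accb Y s)\<bar> \<le> IC 0" if "s \<in> {r<..u}" for s
    using dirichlet_le(2)[OF accb_configs[OF Y], of s s] IC_antimono[of 0 s] that r by simp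
  note * = set_integral_abs_le[OF dirichlet_accb_measurable(1)[OF Y] this r(2) IC_nonneg]
  show "set_integrable lborel {r<..u} (\<lambda>s. dirichlet s (accb Y s))"
    "\<bar>LINT s:{r<..u}|lborel. dirichlet s (accb Y s)\<bar> \<le> IC 0 * (u - r)"
    by (rule *, simp)+
qed

lemma integrable_P_dirichlet:
  assumes "0 \<le> r" "r \<le> u"
  shows "integrable P (\<lambda>Y. LINT s:{r<..u}|lborel. dirichlet s (accb Y s))"
  by (rule integrable_P[OF time_integral_measurable[OF dirichlet_joint] dirichlet_accb_bound[OF _ assms]])

text \<open>In the expectation of the path identity the drift integral cancels against the
  compensator of the jumps. Everything is done in integrated form, so \<open>V\<close> is never
  differentiated.\<close>

lemma V_eq:
  assumes u: "0 \<le> u" "u \<le> t"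
  shows "V u = lvar 0 {} - (\<integral>Y. (LINT s:{0<..u}|lborel. dirichlet s (accb Y s)) \<partial>P)"
proof -
  let ?J = "\<lambda>Y. \<Sum>w\<in>Y. if arrival w < u then jump (accb Y (arrival w)) w else 0"
  let ?L = "\<lambda>Y. LINT s:{0<..u}|lborel. lvar' s (accb Y s)"
  let ?D = "\<lambda>Y. LINT s:{0<..u}|lborel. dirichlet s (accb Y s)"
  have Lb: "\<bar>?L Y\<bar> \<le> 5 * (c * measure lborel \<Lambda>) * (u - 0)" if "Y \<in> configs W" for Y
    using c_pos u lvar'_bound[OF accb_configs[OF that]]
    by (intro set_integral_abs_le(2) dirichlet_accb_measurable(2)[OF that]) auto
  have iL: "integrable P ?L"
    by (rule integrable_P[OF time_integral_measurable[OF lvar'_joint] Lb])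
  have iD: "integrable P ?D" by (rule integrable_P_dirichlet) (use u in auto)
  have path: "AE Y in P. lvar u (accb Y u) - lvar 0 {} - ?L Y = ?J Y"
    using AE_P_distinct AE_space
    by eventually_elim (use lvar_path u in auto)
  have iV: "integrable P (\<lambda>Y. lvar u (accb Y u) - lvar 0 {} - ?L Y)"
    by (intro Bochner_Integration.integrable_diff integrable_lvar_accb iL) simp
  have split: "(LINT s:{0<..u}|lborel. - lvar' s (accb Y s) - dirichlet s (accb Y s)) = - ?L Y - ?D Y" if "Y \<in> configs W" for Y
    using u lvar'_accb_integrable[OF that, of 0 u] dirichlet_accb_integrable[OF that _ u(1)]
    by (subst set_integral_diff) (auto simp: set_lebesgue_integral_def set_integrable_def)
  have "V u - lvar 0 {} - (\<integral>Y. ?L Y \<partial>P) = (\<integral>Y. lvar u (accb Y u) - lvar 0 {} - ?L Y \<partial>P)"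
    unfolding V_def using integrable_lvar_accb iL by (simp add: P.prob_space)
  also have "\<dots> = (\<integral>Y. ?J Y \<partial>P)"
    using jump_sum_measurable[OF u] iV path by (intro integral_cong_AE) (auto cong: measurable_cong_sets)
  also have "\<dots> = (\<integral>Y. - ?L Y - ?D Y \<partial>P)"
    unfolding jump_sum_expectation[OF u]
    by (intro Bochner_Integration.integral_cong refl) (simp only: W.space_poisson_law split)
  also have "\<dots> = - (\<integral>Y. ?L Y \<partial>P) - (\<integral>Y. ?D Y \<partial>P)" using iL iD by simp
  finally show ?thesis by simp
qed

text \<open>Fubini puts the expectation inside the time integral, where the bound by the influence
  constant is available at each fixed time.\<close>

lemma V_decrement:
  assumes r: "0 \<le> r" "r \<le> u" "u \<le> t"
  shows "V r - V u = (LINT s:{r<..u}|lborel. (\<integral>Y. dirichlet s (accb Y s) \<partial>P))"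
    and "integrable lborel (\<lambda>s. indicator {r<..u} s *\<^sub>R (\<integral>Y. dirichlet s (accb Y s) \<partial>P))"
proof -
  interpret PL: pair_sigma_finite P "lborel :: real measure" ..
  let ?D = "\<lambda>a b Y. LINT s:{a<..b}|lborel. dirichlet s (accb Y s)"
  let ?h = "\<lambda>Y s. indicator {r<..u} s *\<^sub>R dirichlet s (accb Y s)"
  have add: "?D 0 u Y = ?D 0 r Y + ?D r u Y" if "Y \<in> configs W" for Y
  proof -
    have "{0<..u} = {0<..r} \<union> {r<..u}" using r by auto
    then show ?thesis
      using dirichlet_accb_integrable[OF that, of 0 r] dirichlet_accb_integrable[OF that, of r u] r
      by (simp only:) (rule set_integral_Un, auto)
  qed
  have "V r - V u = (\<integral>Y. ?D 0 u Y \<partial>P) - (\<integral>Y. ?D 0 r Y \<partial>P)"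
    using V_eq[of r] V_eq[of u] r by simp
  also have "(\<integral>Y. ?D 0 u Y \<partial>P) = (\<integral>Y. ?D 0 r Y + ?D r u Y \<partial>P)"
    by (intro Bochner_Integration.integral_cong refl) (simp only: W.space_poisson_law add)
  also have "\<dots> = (\<integral>Y. ?D 0 r Y \<partial>P) + (\<integral>Y. ?D r u Y \<partial>P)"
    using integrable_P_dirichlet[of 0 r] integrable_P_dirichlet[of r u] r by (intro Bochner_Integration.integral_add) auto
  finally have 1: "V r - V u = (\<integral>Y. (\<integral>s. ?h Y s \<partial>lborel) \<partial>P)" by (simp add: set_lebesgue_integral_def)
  have i: "integrable (P \<Otimes>\<^sub>M lborel) (\<lambda>(Y, s). ?h Y s)"
  proof -
    have "integrable (P \<Otimes>\<^sub>M lborel) (\<lambda>p. indicator (configs W \<times> {r<..u}) p *\<^sub>R ?h (fst p) (snd p))"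
    proof (rule integrableI_bounded_set_indicator[where B="IC 0"])
      have "(\<lambda>p. ?h (fst p) (snd p)) \<in> borel_measurable (W.CS \<Otimes>\<^sub>M borel)"
        using dirichlet_joint by measurable
      then show "(\<lambda>p. ?h (fst p) (snd p)) \<in> borel_measurable (P \<Otimes>\<^sub>M lborel)"
        by (simp cong: measurable_cong_sets)
      show "configs W \<times> {r<..u} \<in> sets (P \<Otimes>\<^sub>M lborel)"
        using sets.top[of P] by (intro pair_measureI) auto
      show "emeasure (P \<Otimes>\<^sub>M lborel) (configs W \<times> {r<..u}) < \<infinity>"
        using r sets.top[of P] P.emeasure_space_1 by (subst lborel.emeasure_pair_measure_Times) auto
      show "AE p in P \<Otimes>\<^sub>M lborel. p \<in> configs W \<times> {r<..u} \<longrightarrow> norm (?h (fst p) (snd p)) \<le> IC 0"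
      proof (rule AE_I2, rule impI)
        fix p assume p: "p \<in> configs W \<times> {r<..u}"
        then have "\<bar>dirichlet (snd p) (accb (fst p) (snd p))\<bar> \<le> IC (snd p)"
          by (intro dirichlet_le(2) accb_configs) auto
        also have "\<dots> \<le> IC 0" using p r by (intro IC_antimono) auto
        finally show "norm (?h (fst p) (snd p)) \<le> IC 0" using p by (auto simp: indicator_def)
      qed
    qed
    then show ?thesis
      by (rule Bochner_Integration.integrable_cong[THEN iffD1, OF refl, rotated])
        (auto simp: space_pair_measure indicator_def)
  qed
  have "integrable lborel (\<lambda>s. \<integral>Y. ?h Y s \<partial>P)" using PL.integrable_snd[OF i] .
  then show "integrable lborel (\<lambda>s. indicator {r<..u} s *\<^sub>R (\<integral>Y. dirichlet s (accb Y s) \<partial>P))" by simp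
  show "V r - V u = (LINT s:{r<..u}|lborel. (\<integral>Y. dirichlet s (accb Y s) \<partial>P))"
    unfolding 1 PL.Fubini_integral[OF i, symmetric] set_lebesgue_integral_def by simp
qed

text \<open>\<open>V\<close> and the influence constant are both non-increasing, so on the whole
  interval the loss rate is at most its bound at \<open>r\<close>: one Euler step with the rate
  frozen at the left endpoint.\<close>

lemma V_step:
  assumes r: "0 \<le> r" "r \<le> u" "u \<le> t"
  shows "V r * (1 - IC r * (u - r)) \<le> V u"
proof -
  let ?E = "\<lambda>s. \<integral>Y. dirichlet s (accb Y s) \<partial>P"
  have Dm: "(\<lambda>Y. dirichlet s (accb Y s)) \<in> borel_measurable W.CS" for s
    by (intro dirichlet_measurable accb_P_measurable measurable_const) auto
  have E0: "0 \<le> ?E s" for s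
    using dirichlet_bounds(1)[OF accb_configs vol] by (intro Bochner_Integration.integral_nonneg_AE AE_I2) simp
  have mono: "V s \<le> V r" if "s \<in> {r<..u}" for s
  proof -
    have "0 \<le> (LINT s:{r<..s}|lborel. ?E s)"
      unfolding set_lebesgue_integral_def using E0 by (intro Bochner_Integration.integral_nonneg_AE AE_I2) simp
    then show ?thesis using V_decrement(1)[of r s] that r by simp
  qed
  have E: "?E s \<le> IC r * V r" if s: "s \<in> {r<..u}" for s
  proof -
    have "?E s \<le> (\<integral>Y. IC s * lvar s (accb Y s) \<partial>P)"
    proof (rule integral_mono)
      show "integrable P (\<lambda>Y. dirichlet s (accb Y s))"
        by (rule integrable_P[OF Dm dirichlet_le(2)[OF accb_configs]])
      show "integrable P (\<lambda>Y. IC s * lvar s (accb Y s))" using integrable_lvar_accb by simp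
    qed (use dirichlet_bounds(2)[OF accb_configs vol] in simp)
    also have "\<dots> = IC s * V s" by (simp add: V_def)
    also have "\<dots> \<le> IC r * V r"
      using s mono IC_antimono[of r s] V_bounds IC_nonneg by (intro mult_mono) auto
    finally show ?thesis .
  qed
  have "V r - V u \<le> (\<integral>s. indicator {r<..u} s * (IC r * V r) \<partial>lborel)"
    unfolding V_decrement(1)[OF r] set_lebesgue_integral_def
  proof (rule integral_mono[OF V_decrement(2)[OF r]])
    show "integrable lborel (\<lambda>s. indicator {r<..u} s * (IC r * V r))"
      by (intro integrable_mult_left integrable_real_indicator) (simp_all add: r)
  qed (use E in \<open>auto simp: indicator_def\<close>)
  also have "\<dots> = IC r * V r * (u - r)" using r by simp
  finally show ?thesis by (simp add: algebra_simps)
qed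

lemma V_lower_bound: "exp (- (LINT s:{0..t}|lborel. IC s)) * V 0 \<le> V t"
  by (rule gronwall_antimono[OF t_nonneg IC_nonneg IC_antimono V_bounds V_step])

end

section \<open>Identification of the endpoints, and the null region\<close>

lemma V_0: "V 0 = lvar 0 {}"
proof -
  have "V 0 = (\<integral>Y. lvar 0 {} \<partial>P)"
    unfolding V_def
  proof (intro Bochner_Integration.integral_cong refl)
    fix Y assume "Y \<in> space P"
    then have "before Y 0 = {}" using configs_W(3)[of Y] by (fastforce simp: before_def)
    then show "lvar 0 (accb Y 0) = lvar 0 {}" by (simp add: accb_def)
  qed
  then show ?thesis by (simp add: P.prob_space)
qed

text \<open>The left limit omits points arriving exactly at \<open>t\<close>, and almost surely
  there are none.\<close>

lemma V_t: "V t = (\<integral>Y. lvar t (acc Y) \<partial>P)"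
  unfolding V_def
proof (rule integral_cong_AE)
  have "(\<lambda>Y. lvar t (acc Y)) \<in> borel_measurable W.CS"
    by (intro lvar_measurable acc_measurable) auto
  then show "(\<lambda>Y. lvar t (acc Y)) \<in> borel_measurable P" by (simp cong: measurable_cong_sets)
  show "(\<lambda>Y. lvar t (accb Y t)) \<in> borel_measurable P"
    using lvar_accb_measurable by (simp cong: measurable_cong_sets)
  show "AE Y in P. lvar t (accb Y t) = lvar t (acc Y)"
    using W.AE_poisson_law[OF AE_no_arrival[of t]] AE_space
  proof eventually_elim
    case (elim Y)
    then have "before Y t = Y" using configs_W(4)[of Y] by (intro before_all) (fastforce simp: less_le)
    then show ?case by (simp add: accb_def)
  qed
qed

lemma localization_variance:
  assumes "A \<in> configs \<Lambda>"
  shows "prob_space.variance (pinned_gibbs \<phi> \<Lambda> (tilt (- s) (pin \<phi> A ({}, lam)))) f = lvar s A"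
proof -
  note l = loc_act[OF assms, of s]
  have eq: "tilt (- s) (pin \<phi> A ({}, lam)) = (A, loc s A)"
    by (simp add: tilt_def pin_def loc_def mult.assoc)
  have m: "(\<integral>\<eta>. f \<eta> \<partial>pinned_gibbs \<phi> \<Lambda> (A, loc s A)) = Ex (loc s A) (fA A)"
    unfolding fA_def[abs_def] by (rule pinned_gibbs_integral[OF l assms f_measurable])
  have "(\<integral>\<eta>. (f \<eta> - Ex (loc s A) (fA A))\<^sup>2 \<partial>pinned_gibbs \<phi> \<Lambda> (A, loc s A))
      = Ex (loc s A) (\<lambda>\<eta>. (fA A \<eta> - Ex (loc s A) (fA A))\<^sup>2)"
    using f_measurable pinned_gibbs_integral[OF l assms, of "\<lambda>\<eta>. (f \<eta> - Ex (loc s A) (fA A))\<^sup>2"]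
    by (simp add: fA_def)
  also have "\<dots> = lvar s A" unfolding lvar_def by (rule Ex_variance_nonneg(1)[OF l tame_fA[OF assms]])
  finally show ?thesis unfolding eq m .
qed

lemma gibbs_variance: "prob_space.variance (gibbs \<phi> \<Lambda> lam) f = lvar 0 {}"
proof -
  have l: "loc 0 {} = lam" by (simp add: loc_def)
  have "fA {} = f" by (simp add: fA_def[abs_def])
  moreover have "(\<integral>\<eta>. f \<eta> \<partial>gibbs \<phi> \<Lambda> lam) = Ex lam f" by (rule integral_gibbs[OF lam f_measurable])
  moreover have "(\<integral>\<eta>. (f \<eta> - Ex lam f)\<^sup>2 \<partial>gibbs \<phi> \<Lambda> lam) = Ex lam (\<lambda>\<eta>. (f \<eta> - Ex lam f)\<^sup>2)"
    using f_measurable by (intro integral_gibbs[OF lam]) simp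
  moreover have "\<dots> = Ex lam (\<lambda>\<eta>. (f \<eta>)\<^sup>2) - (Ex lam f)\<^sup>2"
    using tame_fA[of "{}"] by (intro Ex_variance_nonneg(1)[OF lam]) (simp add: \<open>fA {} = f\<close>)
  ultimately show ?thesis by (simp add: lvar_def l)
qed

text \<open>In a null region almost every configuration is empty, so each expectation is evaluation
  at the empty set.\<close>

lemma lvar_null: assumes "measure lborel \<Lambda> = 0" shows "lvar 0 {} = 0"
proof -
  note l = loc_act[OF empty_config, of 0]
  have "emeasure lborel \<Lambda> = 0"
    using emeasure_eq_ennreal_measure[of lborel \<Lambda>] assms emeasure_L_finite by simp
  have ae: "AE \<eta> in LP. \<eta> = {}"
    using AE_LP_disjoint[OF region_borel \<open>emeasure lborel \<Lambda> = 0\<close>] AE_space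
    by eventually_elim (auto simp: configs_def)
  have "Ex (loc 0 {}) h = h {}" if "h \<in> borel_measurable CS" for h
  proof -
    have "Ex (loc 0 {}) h = Ex (loc 0 {}) (\<lambda>_. h {})"
      using ae by (intro Ex_cong_AE[OF l that]) (auto elim: eventually_mono)
    then show ?thesis by (simp add: Ex_const[OF l])
  qed
  then show ?thesis using fA_measurable[of "{}"] by (simp add: lvar_def)
qed

end

lemma poisson_point_process_subset:
  "poisson_point_process M S r X \<Longrightarrow> \<omega> \<in> space M \<Longrightarrow> X \<omega> \<subseteq> S"
  by (simp add: poisson_point_process_def)

theorem mainTheorem6:
  fixes \<phi> :: "'a::euclidean_space \<Rightarrow> 'a \<Rightarrow> ennreal"
    and \<Lambda> :: "'a set" and lam :: "'a \<Rightarrow> real" and c t :: real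
    and M :: "'w measure" and X :: "'w \<Rightarrow> ('a \<times> real \<times> real) set"
    and f :: "'a set \<Rightarrow> real"
  assumes "repulsive_finite_range \<phi>"
    and "\<Lambda> \<in> sets borel" and "bounded \<Lambda>"
    and "0 < c" and "ereal c < lambda_SSM \<phi>"
    and "lam \<in> activities \<Lambda> c"
    and "poisson_point_process M (\<Lambda> \<times> {0..} \<times> {0..1}) c X"
    and "t \<ge> 0"
    and "f \<in> borel_measurable (config_space \<Lambda>)"
    and "\<forall>\<eta>\<in>configs \<Lambda>. - 1 \<le> f \<eta> \<and> f \<eta> \<le> 1"
  shows "prob_space.expectation M (\<lambda>\<omega>. prob_space.variance (nf_localization \<phi> \<Lambda> lam c (X \<omega>) t) f)
    \<ge> exp (- (LBINT s:{0..t}. influence_const \<phi> \<Lambda> (exp (- s) * c)))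
        * prob_space.variance (gibbs \<phi> \<Lambda> lam) f"
proof -
  interpret negative_fields \<Lambda> \<phi> lam c f t
    by unfold_locales (use assms in \<open>auto simp: abs_le_iff minus_le_iff\<close>)
  show ?thesis
  proof (cases "measure lborel \<Lambda> = 0")
    case True
    \<comment> \<open>Here the influence constant in the exponent is unspecified, but the variance
      that it multiplies is 0.\<close>
    then have "prob_space.variance (gibbs \<phi> \<Lambda> lam) f = 0" by (simp only: gibbs_variance lvar_null)
    moreover have "0 \<le> prob_space.expectation M (\<lambda>\<omega>. prob_space.variance (nf_localization \<phi> \<Lambda> lam c (X \<omega>) t) f)"
      by (intro Bochner_Integration.integral_nonneg_AE AE_I2) simp
    ultimately show ?thesis by simp
  next
    case False
    then have vol: "0 < measure lborel \<Lambda>" by (simp add: less_le)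
    have sub: "W \<subseteq> \<Lambda> \<times> {0..} \<times> {0..1}" by (auto simp: W_def)
    have c0: "0 \<le> c" using c_pos by simp
    note XW = W.poisson_process_restrict_measurable[OF assms(7) sub c0]
    have X: "X \<omega> \<subseteq> \<Lambda> \<times> {0..} \<times> {0..1}" if "\<omega> \<in> space M" for \<omega>
      using assms(7) that by (rule poisson_point_process_subset)
    have "prob_space.variance (nf_localization \<phi> \<Lambda> lam c (X \<omega>) t) f = lvar t (acc (X \<omega> \<inter> W))"
      if w: "\<omega> \<in> space M" for \<omega>
    proof -
      have Y: "X \<omega> \<inter> W \<in> configs W" using measurable_space[OF XW w] by simp
      have "nf_pinned \<phi> \<Lambda> lam c (X \<omega>) t = acc (X \<omega> \<inter> W)"
        by (rule nf_pinned_window[OF X[OF w] configs_W(1)[OF Y]])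
      then show ?thesis
        unfolding nf_localization_def by (simp only: localization_variance[OF acc_configs[OF Y]])
    qed
    then have "prob_space.expectation M (\<lambda>\<omega>. prob_space.variance (nf_localization \<phi> \<Lambda> lam c (X \<omega>) t) f)
        = (\<integral>\<omega>. lvar t (acc (X \<omega> \<inter> W)) \<partial>M)"
      by (intro Bochner_Integration.integral_cong refl)
    \<comment> \<open>The integrand depends on the process through its trace on the window, whose
      law is known; this leaves the given probability space.\<close>
    also have "\<dots> = (\<integral>Y. lvar t (acc Y) \<partial>distr M W.CS (\<lambda>\<omega>. X \<omega> \<inter> W))"
      by (rule integral_distr[OF XW, symmetric]) (intro lvar_measurable acc_measurable, auto)
    also have "\<dots> = V t"
      unfolding V_t W.poisson_process_restrict_law[OF assms(7) sub c0] ..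
    finally have E: "prob_space.expectation M (\<lambda>\<omega>. prob_space.variance (nf_localization \<phi> \<Lambda> lam c (X \<omega>) t) f) = V t" .
    show ?thesis unfolding E gibbs_variance V_0[symmetric] by (rule V_lower_bound[OF vol])
  qed
qed

end
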